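(* Let $F(x)=e^{-|x|}$ for $|x|<1$, let $\theta\in[0,2\pi)$, let $A_\theta\supset -iD_F$ be the associated selfadjoint extension in $\mathscr{H}_F$, and let $\Lambda_\theta\subset\mathbb{R}$ be the spectrum of $A_\theta$ (a discrete subset of $\mathbb{R}$). Write $e_\lambda(x)=e^{i\lambda x}$. Then $$\widetilde{F}_\theta(x)=\sum_{\lambda\in\Lambda_\theta}\frac{2}{\lambda^{2}+3}\,e_\lambda(x),\qquad x\in\mathbb{R},$$ is a continuous positive definite extension of $F$ from $(-1,1)$ to the real line.
   Context: Inner products are conjugate-linear in the first variable. A continuous function $G$ on $\mathbb{R}$ is positive definite if $\sum_{i,j}\overline{c_i}c_jG(x_i-x_j)\ge 0$ for all finite systems $c_i\in\mathbb{C}$, $x_i\in\mathbb{R}$. $\mathscr{H}_F$ is the reproducing kernel Hilbert space of functions on $(0,1)$ (all of which extend continuously to $[0,1]$): the completion of the span of $\{F(\cdot-x):x\in(0,1)\}$ with respect to $\langle F(\cdot-x),F(\cdot-y)\rangle_{\mathscr{H}_F}=F(x-y)$; it satisfies $\langle F(\cdot-x),\xi\rangle_{\mathscr{H}_F}=\xi(x)$. For $\varphi\in C_c^\infty(0,1)$ put $F_\varphi(x)=\int_0^1\varphi(y)F(x-y)\,dy$. $D_F$ is the densely defined skew-Hermitian operator in $\mathscr{H}_F$ with domain $\{F_\varphi:\varphi\in C_c^\infty(0,1)\}$ and $D_F(F_\varphi)=F_{\varphi'}$; $\overline{D_F}$ is its closure. For $\theta\in[0,2\pi)$, $A_\theta$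 is the selfadjoint extension of $-iD_F$ with $$\mathrm{dom}(A_\theta)=\{h+c(e^{-x}+e^{i\theta}e^{x-1}): h\in\mathrm{dom}(\overline{D_F}),\ c\in\mathbb{C}\},$$ $$A_\theta\big(h+c(e^{-x}+e^{i\theta}e^{x-1})\big)=-ih'+ic(e^{-x}-e^{i\theta}e^{x-1}).$$ *)

theory Defs
  imports "HOL-Analysis.Analysis"
begin

text \<open>
  Functions on the open interval \<open>(0,1)\<close> are encoded as functions of type
  \<open>real \<Rightarrow> complex\<close> that are \<open>0\<close> outside \<open>(0,1)\<close>.
  The kernel function \<open>F\<close> is only ever evaluated on \<open>(-1,1)\<close>.
\<close>

definition on01 :: "(real \<Rightarrow> complex) \<Rightarrow> real \<Rightarrow> complex" where
  "on01 f = (\<lambda>x. if 0 < x \<and> x < 1 then f x else 0)"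

definition positive_definite :: "(real \<Rightarrow> complex) \<Rightarrow> bool" where
  "positive_definite G \<longleftrightarrow>
     (\<forall>(n::nat) (c :: nat \<Rightarrow> complex) (x :: nat \<Rightarrow> real).
        (\<Sum>i<n. \<Sum>j<n. cnj (c i) * c j * G (x i - x j)) \<in> \<real>\<^sub>\<ge>\<^sub>0)"

subsection \<open>The reproducing kernel Hilbert space\<close>

text \<open>
  An element of the span of \<open>{F(\<cdot> - x) : x \<in> (0,1)}\<close> is given by a finitely supported family
  \<open>a\<close> of coefficients, standing for the function \<open>\<Sum>x. a x * F(\<cdot> - x)\<close>.
\<close>

definition coeffs01 :: "(real \<Rightarrow> complex) set" where
  "coeffs01 = {a. finite {x. a x \<noteq> 0} \<and> {x. a x \<noteq> 0} \<subseteq> {0<..<1}}"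

definition ker_comb :: "(real \<Rightarrow> complex) \<Rightarrow> (real \<Rightarrow> complex) \<Rightarrow> real \<Rightarrow> complex" where
  "ker_comb F a = on01 (\<lambda>t. \<Sum>x | a x \<noteq> 0. a x * F (t - x))"

definition ker_form :: "(real \<Rightarrow> complex) \<Rightarrow> (real \<Rightarrow> complex) \<Rightarrow> (real \<Rightarrow> complex) \<Rightarrow> complex" where
  "ker_form F a b = (\<Sum>x | a x \<noteq> 0. \<Sum>y | b y \<noteq> 0. cnj (a x) * b y * F (x - y))"

definition ker_norm :: "(real \<Rightarrow> complex) \<Rightarrow> (real \<Rightarrow> complex) \<Rightarrow> real" where
  "ker_norm F a = sqrt (Re (ker_form F a a))"

text \<open>
  The completion of the span is realised as a space of functions in the usual way
  (Moore--Aronszajn): Cauchy sequences of the span converge pointwise, and a point of the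
  completion is identified with the pointwise limit of any Cauchy sequence representing it.
\<close>

definition rkhs_repr :: "(real \<Rightarrow> complex) \<Rightarrow> (nat \<Rightarrow> real \<Rightarrow> complex) \<Rightarrow> (real \<Rightarrow> complex) \<Rightarrow> bool" where
  "rkhs_repr F a \<xi> \<longleftrightarrow>
     (\<forall>n. a n \<in> coeffs01) \<and>
     (\<forall>e>0. \<exists>N. \<forall>m\<ge>N. \<forall>n\<ge>N. ker_norm F (\<lambda>x. a m x - a n x) < e) \<and>
     (\<forall>t. (\<lambda>n. ker_comb F (a n) t) \<longlonglongrightarrow> \<xi> t)"

definition rkhs :: "(real \<Rightarrow> complex) \<Rightarrow> (real \<Rightarrow> complex) set" where
  "rkhs F = {\<xi>. \<exists>a. rkhs_repr F a \<xi>}"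

definition rkhs_inner :: "(real \<Rightarrow> complex) \<Rightarrow> (real \<Rightarrow> complex) \<Rightarrow> (real \<Rightarrow> complex) \<Rightarrow> complex" where
  "rkhs_inner F \<xi> \<eta> =
     (THE z. \<exists>a b. rkhs_repr F a \<xi> \<and> rkhs_repr F b \<eta> \<and>
                   (\<lambda>n. ker_form F (a n) (b n)) \<longlonglongrightarrow> z)"

definition rkhs_norm :: "(real \<Rightarrow> complex) \<Rightarrow> (real \<Rightarrow> complex) \<Rightarrow> real" where
  "rkhs_norm F \<xi> = sqrt (Re (rkhs_inner F \<xi> \<xi>))"

definition rkhs_tendsto :: "(real \<Rightarrow> complex) \<Rightarrow> (nat \<Rightarrow> real \<Rightarrow> complex) \<Rightarrow> (real \<Rightarrow> complex) \<Rightarrow> bool" where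
  "rkhs_tendsto F s \<xi> \<longleftrightarrow> (\<lambda>n. rkhs_norm F (\<lambda>t. s n t - \<xi> t)) \<longlonglongrightarrow> 0"

subsection \<open>The operators\<close>

text \<open>Unbounded operators in \<open>rkhs F\<close> are given by their graphs.\<close>

type_synonym op_graph = "((real \<Rightarrow> complex) \<times> (real \<Rightarrow> complex)) set"

definition vderiv :: "(real \<Rightarrow> complex) \<Rightarrow> real \<Rightarrow> complex" where
  "vderiv f = (\<lambda>t. vector_derivative f (at t))"

text \<open>The test functions \<open>C\<^sub>c\<^sup>\<infinity>(0,1)\<close>, extended by \<open>0\<close> to the real line.\<close>

definition test_funs01 :: "(real \<Rightarrow> complex) set" where
  "test_funs01 = {\<phi>. (\<forall>k::nat. (vderiv ^^ k) \<phi> differentiable_on UNIV) \<and>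
                      closure {x. \<phi> x \<noteq> 0} \<subseteq> {0<..<1}}"

definition smear :: "(real \<Rightarrow> complex) \<Rightarrow> (real \<Rightarrow> complex) \<Rightarrow> real \<Rightarrow> complex" where
  "smear F \<phi> = on01 (\<lambda>x. integral {0..1} (\<lambda>y. \<phi> y * F (x - y)))"

definition D_graph :: "(real \<Rightarrow> complex) \<Rightarrow> op_graph" where
  "D_graph F = {(smear F \<phi>, smear F (vderiv \<phi>)) | \<phi>. \<phi> \<in> test_funs01}"

definition op_closure :: "(real \<Rightarrow> complex) \<Rightarrow> op_graph \<Rightarrow> op_graph" where
  "op_closure F T = {(\<xi>, \<eta>). \<xi> \<in> rkhs F \<and> \<eta> \<in> rkhs F \<and>
     (\<exists>s r. (\<forall>n. (s n, r n) \<in> T) \<and> rkhs_tendsto F s \<xi> \<and> rkhs_tendsto F r \<eta>)}"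

definition A_graph :: "(real \<Rightarrow> complex) \<Rightarrow> real \<Rightarrow> op_graph" where
  "A_graph F \<theta> =
     {(on01 (\<lambda>x. h x + c * (exp (- of_real x) + cis \<theta> * exp (of_real x - 1))),
       on01 (\<lambda>x. - \<i> * vderiv h x + \<i> * c * (exp (- of_real x) - cis \<theta> * exp (of_real x - 1))))
      | h c. h \<in> Domain (op_closure F (D_graph F))}"

definition op_resolvent_set :: "(real \<Rightarrow> complex) \<Rightarrow> op_graph \<Rightarrow> complex set" where
  "op_resolvent_set F T =
     {z. (\<forall>\<zeta>\<in>rkhs F. \<exists>!\<xi>. (\<xi>, \<lambda>t. \<zeta> t + z * \<xi> t) \<in> T) \<and>
         (\<exists>M. \<forall>(\<xi>, \<eta>)\<in>T. rkhs_norm F \<xi> \<le> M * rkhs_norm F (\<lambda>t. \<eta> t - z * \<xi> t))}"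

definition op_spectrum :: "(real \<Rightarrow> complex) \<Rightarrow> op_graph \<Rightarrow> complex set" where
  "op_spectrum F T = - op_resolvent_set F T"

text \<open>The spectrum of \<open>A\<^sub>\<theta>\<close> as a set of real numbers; that it contains no other points is
  part of the theorem.\<close>

definition Lambda_spec :: "(real \<Rightarrow> complex) \<Rightarrow> real \<Rightarrow> real set" where
  "Lambda_spec F \<theta> = {l. complex_of_real l \<in> op_spectrum F (A_graph F \<theta>)}"

definition F_term :: "real \<Rightarrow> real \<Rightarrow> complex" where
  "F_term x l = of_real (2 / (l\<^sup>2 + 3)) * exp (\<i> * of_real l * of_real x)"

definition F_ext :: "(real \<Rightarrow> complex) \<Rightarrow> real \<Rightarrow> real \<Rightarrow> complex" where
  "F_ext F \<theta> x = (\<Sum>\<^sub>\<infinity>l\<in>Lambda_spec F \<theta>. F_term x l)"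

end

theory Submission
  imports Defs "HOL-Complex_Analysis.Complex_Analysis" "HOL-Real_Asymp.Real_Asymp"
begin

text \<open>
  The kernel \<open>e\<^bsup>-|x-y|\<^esup>\<close> on \<open>(0,1)\<close> is the Gram kernel of the vectors \<open>(e\<^bsup>-x\<^esup>, \<surd>2 e\<^bsup>t-x\<^esup> 1\<^bsub>t<x\<^esub>)\<close> of
  \<open>\<complex> \<oplus> L\<^sup>2(0,1)\<close>. This makes its reproducing kernel space the Sobolev space \<open>W\<^sup>1\<^sup>,\<^sup>2(0,1)\<close>, of which
  two consequences are used: norm convergence is uniform up to the boundary, the boundary values
  being inner products with the two functions \<open>e\<^bsup>-x\<^esup>\<close> and \<open>e\<^bsup>x-1\<^esup>\<close>, and the norm of a continuously
  differentiable function is controlled by uniform bounds (\<open>nrm_le_sup\<close>).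

  Smeared kernels satisfy \<open>h' = h\<close> at \<open>0\<close> and \<open>h' = -h\<close> at \<open>1\<close>, and so do all elements in the
  domain of the closure of \<open>D\<^sub>F\<close>. Hence \<open>A\<^sub>\<theta>\<close> is the operator \<open>-\<i> d/dx\<close> with the boundary condition
  \<open>u'(1) + u(1) = e\<^bsup>\<i> \<theta>\<^esup> (u(0) - u'(0))\<close>. Solving \<open>(A\<^sub>\<theta> - z) u = \<zeta>\<close> by variation of constants shows
  that \<open>A\<^sub>\<theta> - z\<close> is bounded below unless \<open>e\<^bsup>\<i> z x\<^esup>\<close> satisfies the boundary condition, that is, unless
  \<open>char_fun \<theta> z = 0\<close>. The range is treated by duality: a vector orthogonal to it is a weak solution
  of a first order equation, thus an exponential, and the defect vector tests whether the
  exponential is really orthogonal. So the spectrum consists of the zeros of \<open>char_fun \<theta>\<close>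
  (\<open>op_spectrum_A_graph\<close>), and these are real.

  The value at \<open>x\<close> of the series is a sum of residues: \<open>2 e\<^bsup>\<i> \<lambda> x\<^esup> / (\<lambda>\<^sup>2 + 3)\<close> is the residue at the
  zero \<open>\<lambda>\<close> of \<open>2 \<i> e\<^bsup>\<i> z (1 + x)\<^esup> / ((1 - \<i> z) char_fun \<theta> z)\<close>, whose only other pole \<open>-\<i>\<close> has residue
  \<open>-e\<^bsup>x\<^esup>\<close>. For \<open>-1 \<le> x \<le> 0\<close> this function decays quadratically along suitable squares, so the series
  sums to \<open>e\<^bsup>x\<^esup>\<close> (\<open>partial_sum_limit\<close>), and complex conjugation covers \<open>0 \<le> x \<le> 1\<close>. The case \<open>x = 0\<close>
  yields the summability of the weights \<open>2 / (\<lambda>\<^sup>2 + 3)\<close>, and with it absolute and uniform convergence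
  on the real line; the sum is positive definite because every exponential is.
\<close>

section \<open>Semi-inner product spaces and approximate representers\<close>

text \<open>
  Two instances follow: the coefficient families of kernel combinations with the kernel form, and
  the completed space with its inner product. The form is conjugate-linear in its first argument.
\<close>

locale semi_inner_space =
  fixes V :: "('a \<Rightarrow> complex) set" and B :: "('a \<Rightarrow> complex) \<Rightarrow> ('a \<Rightarrow> complex) \<Rightarrow> complex"
  assumes zero_mem: "(\<lambda>t. 0) \<in> V"
    and add_mem: "x \<in> V \<Longrightarrow> y \<in> V \<Longrightarrow> (\<lambda>t. x t + y t) \<in> V"
    and scale_mem: "x \<in> V \<Longrightarrow> (\<lambda>t. c * x t) \<in> V"
    and B_add: "x \<in> V \<Longrightarrow> y \<in> V \<Longrightarrow> z \<in> V \<Longrightarrow> B x (\<lambda>t. y t + z t) = B x y + B x z"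
    and B_scale: "x \<in> V \<Longrightarrow> y \<in> V \<Longrightarrow> B x (\<lambda>t. c * y t) = c * B x y"
    and B_herm: "x \<in> V \<Longrightarrow> y \<in> V \<Longrightarrow> B y x = cnj (B x y)"
    and B_pos: "x \<in> V \<Longrightarrow> 0 \<le> Re (B x x)"
begin

definition nrm :: "('a \<Rightarrow> complex) \<Rightarrow> real" where
  "nrm x = sqrt (Re (B x x))"

lemma diff_mem: "x \<in> V \<Longrightarrow> y \<in> V \<Longrightarrow> (\<lambda>t. x t - y t) \<in> V"
  using add_mem[OF _ scale_mem[of y "-1"], of x] by simp

lemma B_add_left: "x \<in> V \<Longrightarrow> y \<in> V \<Longrightarrow> z \<in> V \<Longrightarrow> B (\<lambda>t. x t + y t) z = B x z + B y z"
  using B_herm[of z "\<lambda>t. x t + y t"] B_herm[of z x] B_herm[of z y] by (simp add: add_mem B_add)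

lemma B_scale_left: "x \<in> V \<Longrightarrow> y \<in> V \<Longrightarrow> B (\<lambda>t. c * x t) y = cnj c * B x y"
  using B_herm[of y "\<lambda>t. c * x t"] B_herm[of y x] by (simp add: scale_mem B_scale)

lemma B_diff: "x \<in> V \<Longrightarrow> y \<in> V \<Longrightarrow> z \<in> V \<Longrightarrow> B x (\<lambda>t. y t - z t) = B x y - B x z"
  using B_add[of x y "\<lambda>t. -1 * z t"] B_scale[of x z "-1"] scale_mem[of z "-1"] by simp

lemma B_diff_left: "x \<in> V \<Longrightarrow> y \<in> V \<Longrightarrow> z \<in> V \<Longrightarrow> B (\<lambda>t. x t - y t) z = B x z - B y z"
  using B_add_left[of x "\<lambda>t. -1 * y t" z] B_scale_left[of y z "-1"] scale_mem[of y "-1"] by simp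

lemma nrm_nonneg: "x \<in> V \<Longrightarrow> 0 \<le> nrm x"
  by (simp add: nrm_def B_pos)

lemma nrm_sq: "x \<in> V \<Longrightarrow> (nrm x)\<^sup>2 = Re (B x x)"
  by (simp add: nrm_def B_pos)

lemma B_self: "x \<in> V \<Longrightarrow> B x x = of_real ((nrm x)\<^sup>2)"
  using B_herm[of x x] by (simp add: nrm_sq complex_eq_iff)

lemma nrm_scale: "x \<in> V \<Longrightarrow> nrm (\<lambda>t. c * x t) = cmod c * nrm x"
proof -
  assume x: "x \<in> V"
  have "B (\<lambda>t. c * x t) (\<lambda>t. c * x t) = c * cnj c * B x x"
    using x by (simp add: B_scale_left B_scale scale_mem)
  also have "\<dots> = of_real ((cmod c)\<^sup>2 * (nrm x)\<^sup>2)"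
    unfolding B_self[OF x] using complex_norm_square[of c] by simp
  finally have "nrm (\<lambda>t. c * x t) = sqrt ((cmod c)\<^sup>2 * (nrm x)\<^sup>2)"
    by (simp add: nrm_def)
  then show ?thesis using nrm_nonneg[OF x] by (simp add: real_sqrt_mult)
qed

lemma nrm_uminus: "x \<in> V \<Longrightarrow> nrm (\<lambda>t. - x t) = nrm x"
  using nrm_scale[of x "-1"] by simp

lemma nrm_minus_commute:
  assumes "x \<in> V" "y \<in> V" shows "nrm (\<lambda>t. x t - y t) = nrm (\<lambda>t. y t - x t)"
  using nrm_uminus[OF diff_mem[OF assms]] by simp

lemma nrm_add_sq:
  assumes "x \<in> V" "y \<in> V"
  shows "(nrm (\<lambda>t. x t + y t))\<^sup>2 = (nrm x)\<^sup>2 + 2 * Re (B x y) + (nrm y)\<^sup>2"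
  using assms by (simp add: nrm_sq add_mem B_add B_add_left B_herm[of x y])

lemma nrm_diff_sq:
  assumes "x \<in> V" "y \<in> V"
  shows "(nrm (\<lambda>t. x t - y t))\<^sup>2 = (nrm x)\<^sup>2 - 2 * Re (B x y) + (nrm y)\<^sup>2"
  using assms by (simp add: nrm_sq diff_mem B_diff B_diff_left B_herm[of x y])

lemma Cauchy_Schwarz:
  assumes x: "x \<in> V" and y: "y \<in> V"
  shows "cmod (B x y) \<le> nrm x * nrm y"
proof -
  define b where "b = B x y"
  define p where "p = (nrm x)\<^sup>2"
  define q where "q = (nrm y)\<^sup>2"
  have quad: "0 \<le> p + 2 * s * (cmod b)\<^sup>2 + s\<^sup>2 * (cmod b)\<^sup>2 * q" for s :: real
  proof -
    have m: "(\<lambda>t. (of_real s * cnj b) * y t) \<in> V" by (rule scale_mem[OF y])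
    have "B x (\<lambda>t. (of_real s * cnj b) * y t) = of_real s * (b * cnj b)"
      using B_scale[OF x y, of "of_real s * cnj b"] by (simp add: b_def)
    then have e1: "Re (B x (\<lambda>t. (of_real s * cnj b) * y t)) = s * (cmod b)\<^sup>2"
      by (simp add: complex_norm_square[symmetric] del: of_real_power)
    have e2: "(nrm (\<lambda>t. (of_real s * cnj b) * y t))\<^sup>2 = s\<^sup>2 * (cmod b)\<^sup>2 * q"
      unfolding nrm_scale[OF y] by (simp add: norm_mult power_mult_distrib q_def)
    have "0 \<le> (nrm (\<lambda>t. x t + (of_real s * cnj b) * y t))\<^sup>2" by simp
    then show ?thesis unfolding nrm_add_sq[OF x m] e1 e2 p_def by simp
  qed
  have p0: "0 \<le> p" "0 \<le> q" by (simp_all add: p_def q_def)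
  have "(cmod b)\<^sup>2 \<le> p * q"
  proof (cases "q = 0")
    case True
    have "(cmod b)\<^sup>2 = 0"
    proof (rule ccontr)
      assume "(cmod b)\<^sup>2 \<noteq> 0"
      then have pos: "0 < (cmod b)\<^sup>2" by simp
      have "2 * (-((p+1) / (2 * (cmod b)\<^sup>2))) * (cmod b)\<^sup>2 = - (p + 1)"
        using pos by (simp add: field_simps)
      with quad[of "-((p+1) / (2 * (cmod b)\<^sup>2))"] True show False by simp
    qed
    then show ?thesis using True by simp
  next
    case False
    then have q: "0 < q" using p0 by simp
    have "p + 2 * (-(1/q)) * (cmod b)\<^sup>2 + (-(1/q))\<^sup>2 * (cmod b)\<^sup>2 * q = p - (cmod b)\<^sup>2 / q"
      using q by (simp add: field_simps power2_eq_square)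
    with quad[of "-(1/q)"] have "(cmod b)\<^sup>2 / q \<le> p" by simp
    then show ?thesis using q by (simp add: field_simps)
  qed
  then have "(cmod b)\<^sup>2 \<le> (nrm x * nrm y)\<^sup>2"
    by (simp add: p_def q_def power_mult_distrib)
  then show ?thesis
    unfolding b_def by (rule power2_le_imp_le) (simp add: nrm_nonneg x y)
qed

lemma nrm_triangle:
  assumes x: "x \<in> V" and y: "y \<in> V"
  shows "nrm (\<lambda>t. x t + y t) \<le> nrm x + nrm y"
proof (rule power2_le_imp_le)
  have "Re (B x y) \<le> nrm x * nrm y"
    using Cauchy_Schwarz[OF x y] complex_Re_le_cmod[of "B x y"] by linarith
  then show "(nrm (\<lambda>t. x t + y t))\<^sup>2 \<le> (nrm x + nrm y)\<^sup>2"
    unfolding nrm_add_sq[OF x y] by (simp add: power2_sum)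
qed (use nrm_nonneg x y in auto)

definition nCauchy :: "(nat \<Rightarrow> 'a \<Rightarrow> complex) \<Rightarrow> bool" where
  "nCauchy s \<longleftrightarrow> (\<forall>e>0. \<exists>N. \<forall>m\<ge>N. \<forall>n\<ge>N. nrm (\<lambda>t. s m t - s n t) < e)"

lemma nCauchyD: "nCauchy s \<Longrightarrow> 0 < e \<Longrightarrow> \<exists>N. \<forall>m\<ge>N. \<forall>n\<ge>N. nrm (\<lambda>t. s m t - s n t) < e"
  by (auto simp: nCauchy_def)

lemma nCauchy_add:
  assumes "\<And>n. s n \<in> V" "\<And>n. r n \<in> V" "nCauchy s" "nCauchy r"
  shows "nCauchy (\<lambda>n t. s n t + r n t)"
  unfolding nCauchy_def
proof (intro allI impI)
  fix e :: real assume "0 < e"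
  then obtain N1 N2 where
    N: "\<forall>m\<ge>N1. \<forall>n\<ge>N1. nrm (\<lambda>t. s m t - s n t) < e/2"
       "\<forall>m\<ge>N2. \<forall>n\<ge>N2. nrm (\<lambda>t. r m t - r n t) < e/2"
    using nCauchyD[OF assms(3), of "e/2"] nCauchyD[OF assms(4), of "e/2"] by auto
  have "nrm (\<lambda>t. s m t + r m t - (s n t + r n t)) < e" if "m \<ge> max N1 N2" "n \<ge> max N1 N2" for m n
  proof -
    have "nrm (\<lambda>t. (s m t - s n t) + (r m t - r n t)) \<le> nrm (\<lambda>t. s m t - s n t) + nrm (\<lambda>t. r m t - r n t)"
      by (intro nrm_triangle diff_mem assms)
    also have "\<dots> < e/2 + e/2" using N that by (intro add_strict_mono) auto
    finally show ?thesis by (simp add: algebra_simps)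
  qed
  then show "\<exists>N. \<forall>m\<ge>N. \<forall>n\<ge>N. nrm (\<lambda>t. s m t + r m t - (s n t + r n t)) < e" by blast
qed

lemma nCauchy_bound:
  assumes "\<And>n. s n \<in> V" "\<And>n. r n \<in> V" "nCauchy s"
    and "\<And>m n. nrm (\<lambda>t. r m t - r n t) \<le> K * nrm (\<lambda>t. s m t - s n t)"
  shows "nCauchy r"
  unfolding nCauchy_def
proof (intro allI impI)
  fix e :: real assume "0 < e"
  then have "0 < e / (\<bar>K\<bar> + 1)" by simp
  from nCauchyD[OF assms(3) this] obtain N where
    N: "\<forall>m\<ge>N. \<forall>n\<ge>N. nrm (\<lambda>t. s m t - s n t) < e / (\<bar>K\<bar> + 1)" by blast
  have "nrm (\<lambda>t. r m t - r n t) < e" if "m \<ge> N" "n \<ge> N" for m n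
  proof -
    have "nrm (\<lambda>t. r m t - r n t) \<le> (\<bar>K\<bar> + 1) * nrm (\<lambda>t. s m t - s n t)"
      by (rule order_trans[OF assms(4)]) (intro mult_right_mono nrm_nonneg diff_mem assms, simp)
    also have "\<dots> < (\<bar>K\<bar> + 1) * (e / (\<bar>K\<bar> + 1))"
      using N that by (intro mult_strict_left_mono) auto
    finally show ?thesis by simp
  qed
  then show "\<exists>N. \<forall>m\<ge>N. \<forall>n\<ge>N. nrm (\<lambda>t. r m t - r n t) < e" by blast
qed

lemma nCauchy_scale:
  assumes "\<And>n. s n \<in> V" "nCauchy s"
  shows "nCauchy (\<lambda>n t. c * s n t)"
  by (rule nCauchy_bound[where s = s and K = "cmod c"])
     (auto simp: assms scale_mem nrm_scale diff_mem right_diff_distrib[symmetric])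

lemma nCauchy_bounded:
  assumes "\<And>n. s n \<in> V" "nCauchy s"
  obtains K where "0 \<le> K" "\<And>n. nrm (s n) \<le> K"
proof -
  obtain N where N: "\<forall>m\<ge>N. \<forall>n\<ge>N. nrm (\<lambda>t. s m t - s n t) < 1"
    using nCauchyD[OF assms(2), of 1] by auto
  define K where "K = Max ((\<lambda>n. nrm (s n)) ` {..N}) + 1"
  have le: "nrm (s n) \<le> K" for n
  proof (cases "n \<le> N")
    case True
    then have "nrm (s n) \<le> Max ((\<lambda>n. nrm (s n)) ` {..N})" by (intro Max_ge) auto
    then show ?thesis by (simp add: K_def)
  next
    case False
    have "nrm (s n) \<le> nrm (\<lambda>t. s n t - s N t) + nrm (s N)"
      using nrm_triangle[OF diff_mem[OF assms(1) assms(1)] assms(1), of n N N] by simp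
    also have "nrm (\<lambda>t. s n t - s N t) < 1" using N False by auto
    also have "nrm (s N) \<le> Max ((\<lambda>n. nrm (s n)) ` {..N})" by (intro Max_ge) auto
    finally show ?thesis by (simp add: K_def)
  qed
  show ?thesis using that[OF _ le] nrm_nonneg[OF assms(1)] le order_trans by blast
qed

lemma B_Cauchy:
  assumes s: "\<And>n. s n \<in> V" "nCauchy s" and r: "\<And>n. r n \<in> V" "nCauchy r"
  shows "convergent (\<lambda>n. B (s n) (r n))"
proof -
  obtain K where K: "0 \<le> K" "\<And>n. nrm (s n) \<le> K" using nCauchy_bounded[OF s] by blast
  obtain K' where K': "0 \<le> K'" "\<And>n. nrm (r n) \<le> K'" using nCauchy_bounded[OF r] by blast
  define M where "M = K + K' + 1"
  have M1: "0 < M" using K(1) K'(1) by (simp add: M_def)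
  have M2: "nrm (s n) \<le> M" for n using K(2)[of n] K'(1) by (simp add: M_def)
  have M3: "nrm (r n) \<le> M" for n using K'(2)[of n] K(1) by (simp add: M_def)
  note M = M1 M2 M3
  have "Cauchy (\<lambda>n. B (s n) (r n))"
  proof (rule metric_CauchyI)
    fix e :: real assume "0 < e"
    then have e: "0 < e / (2 * M)" using M by simp
    obtain N1 N2 where
      N: "\<forall>m\<ge>N1. \<forall>n\<ge>N1. nrm (\<lambda>t. s m t - s n t) < e / (2 * M)"
         "\<forall>m\<ge>N2. \<forall>n\<ge>N2. nrm (\<lambda>t. r m t - r n t) < e / (2 * M)"
      using nCauchyD[OF s(2) e] nCauchyD[OF r(2) e] by auto
    have "dist (B (s m) (r m)) (B (s n) (r n)) < e" if "m \<ge> max N1 N2" "n \<ge> max N1 N2" for m n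
    proof -
      have "B (s m) (r m) - B (s n) (r n) = B (\<lambda>t. s m t - s n t) (r m) + B (s n) (\<lambda>t. r m t - r n t)"
        by (simp add: B_diff B_diff_left s r)
      then have "dist (B (s m) (r m)) (B (s n) (r n)) \<le>
          cmod (B (\<lambda>t. s m t - s n t) (r m)) + cmod (B (s n) (\<lambda>t. r m t - r n t))"
        by (metis dist_norm norm_triangle_ineq)
      also have "\<dots> \<le> nrm (\<lambda>t. s m t - s n t) * nrm (r m) + nrm (s n) * nrm (\<lambda>t. r m t - r n t)"
        by (intro add_mono Cauchy_Schwarz diff_mem s r)
      also have "\<dots> \<le> nrm (\<lambda>t. s m t - s n t) * M + M * nrm (\<lambda>t. r m t - r n t)"
        by (intro add_mono mult_left_mono mult_right_mono M nrm_nonneg diff_mem s r)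
      also have "\<dots> < e / (2 * M) * M + M * (e / (2 * M))"
        using N that M by (intro add_strict_mono mult_strict_left_mono mult_strict_right_mono) auto
      also have "\<dots> = e" using M by simp
      finally show ?thesis .
    qed
    then show "\<exists>N. \<forall>m\<ge>N. \<forall>n\<ge>N. dist (B (s m) (r m)) (B (s n) (r n)) < e" by blast
  qed
  then show ?thesis by (simp add: Cauchy_convergent_iff)
qed

lemma nrm_add_scale_le:
  assumes "x \<in> V" "y \<in> V"
  shows "norm (nrm (\<lambda>t. x t + c * y t)) \<le> nrm x + cmod c * nrm y"
  using nrm_triangle[OF assms(1) scale_mem[OF assms(2), of c]] nrm_scale[OF assms(2), of c]
    nrm_nonneg[OF add_mem[OF assms(1) scale_mem[OF assms(2), of c]]]
  by simp

lemma nrm_tendsto_lin: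
  assumes m: "\<And>n. s n \<in> V" "\<And>n. r n \<in> V" "x \<in> V" "y \<in> V"
    and l: "(\<lambda>n. nrm (\<lambda>t. s n t - x t)) \<longlonglongrightarrow> 0" "(\<lambda>n. nrm (\<lambda>t. r n t - y t)) \<longlonglongrightarrow> 0"
  shows "(\<lambda>n. nrm (\<lambda>t. (s n t + c * r n t) - (x t + c * y t))) \<longlonglongrightarrow> 0"
proof (rule Lim_null_comparison)
  show "(\<lambda>n. nrm (\<lambda>t. s n t - x t) + cmod c * nrm (\<lambda>t. r n t - y t)) \<longlonglongrightarrow> 0"
    using tendsto_add[OF l(1) tendsto_mult_left[OF l(2), of "cmod c"]] by simp
  have "(\<lambda>t. (s n t + c * r n t) - (x t + c * y t)) = (\<lambda>t. (s n t - x t) + c * (r n t - y t))" for n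
    by (simp add: fun_eq_iff algebra_simps)
  then show "\<forall>\<^sub>F n in sequentially. norm (nrm (\<lambda>t. (s n t + c * r n t) - (x t + c * y t)))
      \<le> nrm (\<lambda>t. s n t - x t) + cmod c * nrm (\<lambda>t. r n t - y t)"
    by (simp only: nrm_add_scale_le[OF diff_mem[OF m(1,3)] diff_mem[OF m(2,4)]] eventually_True)
qed

lemma B_tendsto:
  assumes m: "\<And>n. s n \<in> V" "x \<in> V" "u \<in> V" and l: "(\<lambda>n. nrm (\<lambda>t. s n t - x t)) \<longlonglongrightarrow> 0"
  shows "(\<lambda>n. B u (s n)) \<longlonglongrightarrow> B u x"
proof -
  have "(\<lambda>n. B u (s n) - B u x) \<longlonglongrightarrow> 0"
  proof (rule Lim_null_comparison)
    show "(\<lambda>n. nrm u * nrm (\<lambda>t. s n t - x t)) \<longlonglongrightarrow> 0"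
      using tendsto_mult_left[OF l, of "nrm u"] by simp
    show "\<forall>\<^sub>F n in sequentially. cmod (B u (s n) - B u x) \<le> nrm u * nrm (\<lambda>t. s n t - x t)"
      unfolding B_diff[OF m(3,1,2), symmetric]
      by (simp only: Cauchy_Schwarz[OF m(3) diff_mem[OF m(1,2)]] eventually_True)
  qed
  then show ?thesis by (simp add: LIM_zero_iff)
qed

lemma B_tendsto_left:
  assumes m: "\<And>n. s n \<in> V" "x \<in> V" "u \<in> V" and l: "(\<lambda>n. nrm (\<lambda>t. s n t - x t)) \<longlonglongrightarrow> 0"
  shows "(\<lambda>n. B (s n) u) \<longlonglongrightarrow> B x u"
  using tendsto_cnj[OF B_tendsto[OF m l]]
  by (simp only: B_herm[OF m(3) m(1), symmetric] B_herm[OF m(3,2), symmetric])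

text \<open>
  The Riesz representation theorem before completion. The functional
  \<open>v \<mapsto> \<parallel>v\<parallel>\<^sup>2 - 2 Re (L v)\<close> is bounded below because \<open>L\<close> is bounded. By the parallelogram law
  a minimising sequence is a Cauchy sequence, and comparing its values with those at
  \<open>s n + t v\<close> shows that \<open>s n\<close> represents \<open>L\<close> in the limit. This one statement serves twice: to
  recognise which functions belong to the completion, and to show that the range of
  \<open>A\<^sub>\<theta> - z\<close> is dense.
\<close>

lemma approximate_representer:
  assumes WV: "W \<subseteq> V" and W0: "(\<lambda>t. 0) \<in> W"
    and Wadd: "\<And>x y. x \<in> W \<Longrightarrow> y \<in> W \<Longrightarrow> (\<lambda>t. x t + y t) \<in> W"
    and Wscale: "\<And>c x. x \<in> W \<Longrightarrow> (\<lambda>t. c * x t) \<in> W"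
    and Ladd: "\<And>x y. x \<in> W \<Longrightarrow> y \<in> W \<Longrightarrow> L (\<lambda>t. x t + y t) = L x + L y"
    and Lscale: "\<And>c x. x \<in> W \<Longrightarrow> L (\<lambda>t. c * x t) = cnj c * L x"
    and Lbound: "\<And>x. x \<in> W \<Longrightarrow> cmod (L x) \<le> C * nrm x"
  obtains s where "\<And>n. s n \<in> W" "nCauchy s" "\<And>v. v \<in> W \<Longrightarrow> (\<lambda>n. B v (s n)) \<longlonglongrightarrow> L v"
proof -
  define J where "J = (\<lambda>v. (nrm v)\<^sup>2 - 2 * Re (L v))"
  have V: "v \<in> V" if "v \<in> W" for v using that WV by blast
  have Jlow: "- C\<^sup>2 \<le> J v" if v: "v \<in> W" for v
  proof -
    have "Re (L v) \<le> C * nrm v"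
      using Lbound[OF v] complex_Re_le_cmod[of "L v"] by linarith
    moreover have "0 \<le> (nrm v - C)\<^sup>2" by simp
    ultimately show ?thesis by (simp add: J_def power2_diff algebra_simps)
  qed
  have bdd: "bdd_below (J ` W)" using Jlow by (auto simp: bdd_below_def)
  define i where "i = Inf (J ` W)"
  have i_le: "i \<le> J v" if "v \<in> W" for v
    unfolding i_def by (rule cInf_lower) (use that bdd in auto)
  have "\<exists>v\<in>W. J v < i + inverse (real (Suc n))" for n
  proof -
    have "Inf (J ` W) < i + inverse (real (Suc n))" by (simp add: i_def)
    then show ?thesis using cInf_less_iff[of "J ` W"] W0 bdd by auto
  qed
  then obtain s where s: "\<And>n. s n \<in> W" "\<And>n. J (s n) < i + inverse (real (Suc n))"
    by metis
  \<comment> \<open>The midpoint of two near-minimisers is no better than the infimum, which by the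
    parallelogram law leaves no room for them to be far apart.\<close>
  have par: "(nrm (\<lambda>t. x t - y t))\<^sup>2 \<le> 2 * J x + 2 * J y - 4 * i" if xy: "x \<in> W" "y \<in> W" for x y
  proof -
    define h where "h = (\<lambda>t. (1/2) * (x t + y t))"
    have hW: "h \<in> W" unfolding h_def by (intro Wscale Wadd xy)
    have "nrm h = nrm (\<lambda>t. x t + y t) / 2"
      unfolding h_def by (subst nrm_scale) (auto intro: V Wadd xy)
    then have n: "(nrm h)\<^sup>2 = (nrm (\<lambda>t. x t + y t))\<^sup>2 / 4" by (simp only: power_divide) simp
    have "L h = (L x + L y) / 2"
      unfolding h_def by (subst Lscale) (auto intro: Wadd simp: Ladd xy)
    then have "Re (L h) = (Re (L x) + Re (L y)) / 2" by (simp only:) simp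
    then have "J h = (nrm (\<lambda>t. x t + y t))\<^sup>2 / 4 - Re (L x) - Re (L y)"
      unfolding J_def n by simp
    moreover have "i \<le> J h" by (rule i_le[OF hW])
    moreover have "(nrm (\<lambda>t. x t + y t))\<^sup>2 + (nrm (\<lambda>t. x t - y t))\<^sup>2 = 2 * (nrm x)\<^sup>2 + 2 * (nrm y)\<^sup>2"
      by (simp add: nrm_add_sq nrm_diff_sq V xy)
    moreover have "d \<le> 2 * (a - 2 * lx) + 2 * (b - 2 * ly) - 4 * i"
      if "jh = p / 4 - lx - ly" "i \<le> jh" "p + d = 2 * a + 2 * b" for a b d p jh lx ly :: real
      using that by (simp add: field_simps)
    ultimately show ?thesis unfolding J_def by blast
  qed
  have Cau: "nCauchy s"
    unfolding nCauchy_def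
  proof (intro allI impI)
    fix e :: real assume e: "0 < e"
    obtain N where N: "inverse (real (Suc N)) < e\<^sup>2 / 4"
      using reals_Archimedean[of "e\<^sup>2/4"] e by auto
    have "nrm (\<lambda>t. s m t - s n t) < e" if mn: "m \<ge> N" "n \<ge> N" for m n
    proof -
      have le: "inverse (real (Suc k)) \<le> inverse (real (Suc N))" if "k \<ge> N" for k
        using that by simp
      have "(nrm (\<lambda>t. s m t - s n t))\<^sup>2 \<le> 2 * J (s m) + 2 * J (s n) - 4 * i"
        by (rule par) (simp_all add: s)
      also have "\<dots> < e\<^sup>2"
      proof -
        have "J (s m) - i < e\<^sup>2 / 4" using s(2)[of m] le[OF mn(1)] N by linarith
        moreover have "J (s n) - i < e\<^sup>2 / 4" using s(2)[of n] le[OF mn(2)] N by linarith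
        ultimately show ?thesis by linarith
      qed
      finally show ?thesis by (rule power_less_imp_less_base) (use e in simp)
    qed
    then show "\<exists>N. \<forall>m\<ge>N. \<forall>n\<ge>N. nrm (\<lambda>t. s m t - s n t) < e" by blast
  qed
  have lim: "(\<lambda>n. B v (s n)) \<longlonglongrightarrow> L v" if v: "v \<in> W" for v
  proof -
    define N where "N = (nrm v)\<^sup>2"
    have N0: "0 \<le> N" by (simp add: N_def)
    have key: "(cmod (L v - B v (s n)))\<^sup>2 \<le> (1 + N) * inverse (real (Suc n))" for n
    proof -
      define d where "d = L v - B v (s n)"
      \<comment> \<open>Nearly the minimiser \<open>1/N\<close> of \<open>\<tau> \<mapsto> \<tau>\<^sup>2
        N - 2 \<tau>\<close>, but defined for \<open>N = 0\<close> as well.\<close>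
      define \<tau> where "\<tau> = 1 / (1 + N)"
      define t where "t = of_real \<tau> * d"
      have mem: "(\<lambda>u. t * v u) \<in> W" by (rule Wscale[OF v])
      have "J (\<lambda>u. s n u + t * v u) =
          (nrm (s n))\<^sup>2 + 2 * Re (B (s n) (\<lambda>u. t * v u)) + (cmod t)\<^sup>2 * N - 2 * Re (L (s n)) - 2 * Re (cnj t * L v)"
        unfolding J_def nrm_add_sq[OF V[OF s(1)] V[OF mem]] Ladd[OF s(1) mem] Lscale[OF v] nrm_scale[OF V[OF v]]
        by (simp add: power_mult_distrib N_def right_diff_distrib)
      also have "Re (B (s n) (\<lambda>u. t * v u)) = Re (cnj t * B v (s n))"
        using B_herm[of v "s n"] by (simp add: B_scale V s v)
      finally have 1: "J (\<lambda>u. s n u + t * v u) = J (s n) - 2 * Re (cnj t * d) + (cmod t)\<^sup>2 * N"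
        by (simp add: J_def d_def right_diff_distrib)
      have 2: "Re (cnj t * d) = \<tau> * (cmod d)\<^sup>2"
      proof -
        have "cnj t * d = of_real \<tau> * (d * cnj d)" by (simp add: t_def)
        also have "\<dots> = of_real (\<tau> * (cmod d)\<^sup>2)" unfolding complex_norm_square[symmetric] by simp
        finally show ?thesis by simp
      qed
      have 3: "(cmod t)\<^sup>2 = \<tau>\<^sup>2 * (cmod d)\<^sup>2"
        by (simp add: t_def norm_mult power_mult_distrib)
      have "i \<le> J (s n) - 2 * (\<tau> * (cmod d)\<^sup>2) + \<tau>\<^sup>2 * (cmod d)\<^sup>2 * N"
        using i_le[OF Wadd[OF s(1)[of n] mem]] unfolding 1 2 3 .
      moreover have "\<tau>\<^sup>2 * (cmod d)\<^sup>2 * N \<le> \<tau> * (cmod d)\<^sup>2"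
      proof -
        have "\<tau> * N \<le> 1" using N0 by (simp add: \<tau>_def field_simps)
        then have "(\<tau> * (cmod d)\<^sup>2) * (\<tau> * N) \<le> (\<tau> * (cmod d)\<^sup>2) * 1"
          using N0 by (intro mult_left_mono) (auto simp: \<tau>_def)
        then show ?thesis by (simp add: power2_eq_square algebra_simps)
      qed
      ultimately have "\<tau> * (cmod d)\<^sup>2 \<le> inverse (real (Suc n))"
        using s(2)[of n] by linarith
      then have "(1 + N) * (\<tau> * (cmod d)\<^sup>2) \<le> (1 + N) * inverse (real (Suc n))"
        using N0 by (intro mult_left_mono) auto
      moreover have "(1 + N) * (\<tau> * (cmod d)\<^sup>2) = (cmod d)\<^sup>2" using N0 by (simp add: \<tau>_def)
      ultimately show ?thesis unfolding d_def by (simp only:)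
    qed
    have "(\<lambda>n. (cmod (L v - B v (s n)))\<^sup>2) \<longlonglongrightarrow> 0"
    proof (rule tendsto_sandwich[OF _ _ tendsto_const])
      show "(\<lambda>n. (1 + N) * inverse (real (Suc n))) \<longlonglongrightarrow> 0"
        using tendsto_mult[OF tendsto_const LIMSEQ_inverse_real_of_nat, of "1 + N"] by simp
    qed (use key in auto)
    from tendsto_real_sqrt[OF this] have "(\<lambda>n. L v - B v (s n)) \<longlonglongrightarrow> 0"
      by (intro tendsto_norm_zero_cancel[of "\<lambda>n. L v - B v (s n)"]) simp
    then have "(\<lambda>n. L v - (L v - B v (s n))) \<longlonglongrightarrow> L v - 0" by (intro tendsto_diff tendsto_const)
    then show ?thesis by simp
  qed
  show ?thesis by (rule that[OF s(1) Cau lim])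
qed

end

section \<open>The completion as a reproducing kernel space\<close>

text \<open>
  The inner product of the kernel combination with coefficients \<open>a\<close> and the function \<open>f\<close>, as
  prescribed by the reproducing property.
\<close>

definition pair :: "(real \<Rightarrow> complex) \<Rightarrow> (real \<Rightarrow> complex) \<Rightarrow> complex" where
  "pair a f = (\<Sum>x | a x \<noteq> 0. cnj (a x) * f x)"

lemma pair_superset:
  assumes "finite S" "{x. a x \<noteq> 0} \<subseteq> S"
  shows "pair a f = (\<Sum>x\<in>S. cnj (a x) * f x)"
  unfolding pair_def by (rule sum.mono_neutral_left) (use assms in auto)

lemma ker_comb_superset:
  assumes "finite S" "{x. a x \<noteq> 0} \<subseteq> S"
  shows "ker_comb F a = on01 (\<lambda>t. \<Sum>x\<in>S. a x * F (t - x))"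
proof -
  have "(\<Sum>x | a x \<noteq> 0. a x * F (t - x)) = (\<Sum>x\<in>S. a x * F (t - x))" for t
    by (rule sum.mono_neutral_left) (use assms in auto)
  then show ?thesis by (simp add: ker_comb_def)
qed

lemma coeffs01_add: "a \<in> coeffs01 \<Longrightarrow> b \<in> coeffs01 \<Longrightarrow> (\<lambda>x. a x + b x) \<in> coeffs01"
proof -
  assume a: "a \<in> coeffs01" and b: "b \<in> coeffs01"
  have "{x. a x + b x \<noteq> 0} \<subseteq> {x. a x \<noteq> 0} \<union> {x. b x \<noteq> 0}" by auto
  then show ?thesis using a b unfolding coeffs01_def by (blast intro: finite_subset)
qed

lemma coeffs01_scale: "a \<in> coeffs01 \<Longrightarrow> (\<lambda>x. c * a x) \<in> coeffs01"
proof -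
  assume a: "a \<in> coeffs01"
  have "{x. c * a x \<noteq> 0} \<subseteq> {x. a x \<noteq> 0}" by auto
  then show ?thesis using a unfolding coeffs01_def by (blast intro: finite_subset)
qed

lemma pair_add_left:
  assumes "a \<in> coeffs01" "b \<in> coeffs01"
  shows "pair (\<lambda>x. a x + b x) f = pair a f + pair b f"
proof -
  let ?S = "{x. a x \<noteq> 0} \<union> {x. b x \<noteq> 0}"
  have S: "finite ?S" using assms by (simp add: coeffs01_def)
  have *: "{x. a x + b x \<noteq> 0} \<subseteq> ?S" "{x. a x \<noteq> 0} \<subseteq> ?S" "{x. b x \<noteq> 0} \<subseteq> ?S" by auto
  show ?thesis
    unfolding pair_superset[OF S *(1)] pair_superset[OF S *(2)] pair_superset[OF S *(3)]
    by (simp add: sum.distrib algebra_simps)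
qed

lemma pair_scale_left:
  assumes "a \<in> coeffs01"
  shows "pair (\<lambda>x. c * a x) f = cnj c * pair a f"
proof -
  have S: "finite {x. a x \<noteq> 0}" using assms by (simp add: coeffs01_def)
  have *: "{x. c * a x \<noteq> 0} \<subseteq> {x. a x \<noteq> 0}" by auto
  show ?thesis
    unfolding pair_superset[OF S *] pair_superset[OF S subset_refl]
    by (simp add: sum_distrib_left algebra_simps)
qed

lemma pair_add: "pair a (\<lambda>x. f x + g x) = pair a f + pair a g"
  by (simp add: pair_def sum.distrib algebra_simps)

lemma pair_scale: "pair a (\<lambda>x. c * f x) = c * pair a f"
  by (simp add: pair_def sum_distrib_left algebra_simps)

lemma pair_tendsto:
  assumes "a \<in> coeffs01" "\<And>x. 0 < x \<Longrightarrow> x < 1 \<Longrightarrow> ((\<lambda>n. f n x) \<longlongrightarrow> g x) net"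
  shows "((\<lambda>n. pair a (f n)) \<longlongrightarrow> pair a g) net"
  unfolding pair_def using assms
  by (intro tendsto_sum tendsto_mult tendsto_const) (auto simp: coeffs01_def)

lemma ker_form_eq_pair:
  assumes a: "a \<in> coeffs01"
  shows "ker_form F a b = pair a (ker_comb F b)"
  unfolding ker_form_def pair_def
proof (rule sum.cong[OF refl])
  fix x assume "x \<in> {x. a x \<noteq> 0}"
  then have "0 < x \<and> x < 1" using a by (auto simp: coeffs01_def)
  then show "(\<Sum>y | b y \<noteq> 0. cnj (a x) * b y * F (x - y)) = cnj (a x) * ker_comb F b x"
    by (simp add: ker_comb_def on01_def sum_distrib_left algebra_simps)
qed

lemma ker_comb_add:
  assumes "a \<in> coeffs01" "b \<in> coeffs01"
  shows "ker_comb F (\<lambda>x. a x + b x) = (\<lambda>t. ker_comb F a t + ker_comb F b t)"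
proof -
  let ?S = "{x. a x \<noteq> 0} \<union> {x. b x \<noteq> 0}"
  have S: "finite ?S" using assms by (simp add: coeffs01_def)
  have *: "{x. a x + b x \<noteq> 0} \<subseteq> ?S" "{x. a x \<noteq> 0} \<subseteq> ?S" "{x. b x \<noteq> 0} \<subseteq> ?S" by auto
  show ?thesis
    unfolding ker_comb_superset[OF S *(1)] ker_comb_superset[OF S *(2)] ker_comb_superset[OF S *(3)]
    by (auto simp: on01_def sum.distrib algebra_simps)
qed

lemma ker_comb_scale:
  assumes "a \<in> coeffs01"
  shows "ker_comb F (\<lambda>x. c * a x) = (\<lambda>t. c * ker_comb F a t)"
proof -
  have S: "finite {x. a x \<noteq> 0}" using assms by (simp add: coeffs01_def)
  have *: "{x. c * a x \<noteq> 0} \<subseteq> {x. a x \<noteq> 0}" by auto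
  show ?thesis
    unfolding ker_comb_superset[OF S *] ker_comb_superset[OF S subset_refl]
    by (auto simp: on01_def sum_distrib_left algebra_simps)
qed

text \<open>
  The coefficient family of the single kernel at \<open>x\<close>.
\<close>

definition delta :: "real \<Rightarrow> real \<Rightarrow> complex" where
  "delta x = (\<lambda>t. if t = x then 1 else 0)"

lemma delta_supp: "{t. delta x t \<noteq> 0} = {x}"
  by (auto simp: delta_def)

lemma delta_mem: "0 < x \<Longrightarrow> x < 1 \<Longrightarrow> delta x \<in> coeffs01"
  unfolding coeffs01_def mem_Collect_eq delta_supp by simp

lemma pair_delta: "pair (delta x) f = f x"
  unfolding pair_def delta_supp by (simp add: delta_def)

lemma ker_comb_delta: "ker_comb F (delta x) = on01 (\<lambda>t. F (t - x))"
  unfolding ker_comb_def delta_supp by (simp add: delta_def)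

locale pd_kernel =
  fixes F :: "real \<Rightarrow> complex"
  assumes F_herm: "\<bar>x\<bar> < 1 \<Longrightarrow> F (- x) = cnj (F x)"
    and F_pos: "a \<in> coeffs01 \<Longrightarrow> 0 \<le> Re (ker_form F a a)"
begin

lemma ker_form_herm:
  assumes "a \<in> coeffs01" "b \<in> coeffs01"
  shows "ker_form F b a = cnj (ker_form F a b)"
proof -
  have "ker_form F b a = (\<Sum>y | a y \<noteq> 0. \<Sum>x | b x \<noteq> 0. cnj (b x) * a y * F (x - y))"
    unfolding ker_form_def by (rule sum.swap)
  also have "\<dots> = (\<Sum>y | a y \<noteq> 0. \<Sum>x | b x \<noteq> 0. cnj (cnj (a y) * b x * F (y - x)))"
  proof (intro sum.cong refl)
    fix x y assume "x \<in> {x. b x \<noteq> 0}" "y \<in> {x. a x \<noteq> 0}"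
    then have "x \<in> {0<..<1}" "y \<in> {0<..<1}" using assms by (auto simp: coeffs01_def)
    then have "F (x - y) = cnj (F (y - x))" using F_herm[of "y - x"] by auto
    then show "cnj (b x) * a y * F (x - y) = cnj (cnj (a y) * b x * F (y - x))" by simp
  qed
  finally show ?thesis by (simp add: ker_form_def)
qed

sublocale span: semi_inner_space coeffs01 "ker_form F"
proof
  show "(\<lambda>t. 0) \<in> coeffs01" by (simp add: coeffs01_def)
  show "ker_form F y x = cnj (ker_form F x y)" if "x \<in> coeffs01" "y \<in> coeffs01" for x y
    using that by (rule ker_form_herm)
qed (use F_pos in \<open>auto simp: coeffs01_add coeffs01_scale ker_form_eq_pair[of _ F] ker_comb_add ker_comb_scale
  pair_add pair_scale\<close>)

lemma ker_norm_eq: "ker_norm F = span.nrm"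
  by (simp add: ker_norm_def span.nrm_def fun_eq_iff)

lemma repr_iff: "rkhs_repr F a \<xi> \<longleftrightarrow>
    (\<forall>n. a n \<in> coeffs01) \<and> span.nCauchy a \<and> (\<forall>t. (\<lambda>n. ker_comb F (a n) t) \<longlonglongrightarrow> \<xi> t)"
  by (simp add: rkhs_repr_def span.nCauchy_def ker_norm_eq)

lemma repr_add:
  assumes "rkhs_repr F a \<xi>" "rkhs_repr F b \<eta>"
  shows "rkhs_repr F (\<lambda>n x. a n x + b n x) (\<lambda>t. \<xi> t + \<eta> t)"
  using assms unfolding repr_iff
  by (auto simp: coeffs01_add ker_comb_add intro!: span.nCauchy_add tendsto_add)

lemma repr_scale:
  assumes "rkhs_repr F a \<xi>"
  shows "rkhs_repr F (\<lambda>n x. c * a n x) (\<lambda>t. c * \<xi> t)"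
  using assms unfolding repr_iff
  by (auto simp: coeffs01_scale ker_comb_scale intro!: span.nCauchy_scale tendsto_mult_left)

lemma repr_diff:
  assumes "rkhs_repr F a \<xi>" "rkhs_repr F b \<eta>"
  shows "rkhs_repr F (\<lambda>n x. a n x - b n x) (\<lambda>t. \<xi> t - \<eta> t)"
  using repr_add[OF assms(1) repr_scale[OF assms(2), of "-1"]] by simp

lemma repr_ker_comb: "a \<in> coeffs01 \<Longrightarrow> rkhs_repr F (\<lambda>n. a) (ker_comb F a)"
  using span.nrm_scale[OF span.zero_mem, of 0] by (simp add: repr_iff span.nCauchy_def)

text \<open>
  A Cauchy sequence of kernel combinations that tends to \<open>0\<close> pointwise tends to \<open>0\<close> in norm:
  for fixed \<open>m\<close> the products \<open>\<langle>a m, a n\<rangle>\<close> tend to \<open>0\<close>, since they only involve values of the second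
  function at finitely many points, while \<open>\<langle>a m, a m - a n\<rangle>\<close> is small by the Cauchy property.
  Hence the completion consists of functions, and its inner product is well defined.
\<close>

lemma repr_zero_norm:
  assumes r: "rkhs_repr F a (\<lambda>t. 0)"
  shows "(\<lambda>n. span.nrm (a n)) \<longlonglongrightarrow> 0"
proof (rule LIMSEQ_I)
  fix e :: real assume e: "0 < e"
  have a: "\<And>n. a n \<in> coeffs01" "span.nCauchy a" "\<And>t. (\<lambda>n. ker_comb F (a n) t) \<longlonglongrightarrow> 0"
    using r by (auto simp: repr_iff)
  obtain N where N: "\<forall>m\<ge>N. \<forall>n\<ge>N. span.nrm (\<lambda>t. a m t - a n t) < e/2"
    using span.nCauchyD[OF a(2), of "e/2"] e by auto
  have le: "span.nrm (a m) \<le> e/2" if m: "m \<ge> N" for m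
  proof -
    have "(\<lambda>n. ker_form F (a m) (a n)) \<longlonglongrightarrow> pair (a m) (\<lambda>t. 0)"
      unfolding ker_form_eq_pair[OF a(1)] by (intro pair_tendsto a)
    then have lim: "(\<lambda>n. ker_form F (a m) (a m) - ker_form F (a m) (a n)) \<longlonglongrightarrow> ker_form F (a m) (a m) - 0"
      by (intro tendsto_diff tendsto_const) (simp add: pair_def)
    have "cmod (ker_form F (a m) (a m)) \<le> span.nrm (a m) * (e/2)"
    proof (rule LIMSEQ_le_const2)
      show "(\<lambda>n. cmod (ker_form F (a m) (a m) - ker_form F (a m) (a n))) \<longlonglongrightarrow> cmod (ker_form F (a m) (a m))"
        using tendsto_norm[OF lim] by simp
      show "\<exists>N. \<forall>n\<ge>N. cmod (ker_form F (a m) (a m) - ker_form F (a m) (a n)) \<le> span.nrm (a m) * (e/2)"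
      proof (intro exI allI impI)
        fix n assume n: "n \<ge> N"
        have "ker_form F (a m) (a m) - ker_form F (a m) (a n) = ker_form F (a m) (\<lambda>t. a m t - a n t)"
          by (simp add: span.B_diff a)
        also have "cmod \<dots> \<le> span.nrm (a m) * span.nrm (\<lambda>t. a m t - a n t)"
          by (intro span.Cauchy_Schwarz span.diff_mem a)
        also have "\<dots> \<le> span.nrm (a m) * (e/2)"
          using N m n by (intro mult_left_mono span.nrm_nonneg a) (auto intro: less_imp_le)
        finally show "cmod (ker_form F (a m) (a m) - ker_form F (a m) (a n)) \<le> span.nrm (a m) * (e/2)" .
      qed
    qed
    then have "span.nrm (a m) * span.nrm (a m) \<le> span.nrm (a m) * (e/2)"
      unfolding span.B_self[OF a(1)] by (simp add: power2_eq_square norm_mult)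
    then show ?thesis using e span.nrm_nonneg[OF a(1), of m]
      by (cases "span.nrm (a m) = 0") auto
  qed
  show "\<exists>N. \<forall>n\<ge>N. norm (span.nrm (a n) - 0) < e"
  proof (intro exI[of _ N] allI impI)
    fix n assume "n \<ge> N"
    then have "span.nrm (a n) \<le> e/2" by (rule le)
    then show "norm (span.nrm (a n) - 0) < e" using span.nrm_nonneg[OF a(1), of n] e by simp
  qed
qed

lemma ker_form_convergent:
  assumes "rkhs_repr F a \<xi>" "rkhs_repr F b \<eta>"
  shows "convergent (\<lambda>n. ker_form F (a n) (b n))"
proof -
  have "\<And>n. a n \<in> coeffs01" "span.nCauchy a" "\<And>n. b n \<in> coeffs01" "span.nCauchy b"
    using assms unfolding repr_iff by blast+
  then show ?thesis by (rule span.B_Cauchy)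
qed

lemma ker_form_limit_unique:
  assumes "rkhs_repr F a \<xi>" "rkhs_repr F b \<eta>" "rkhs_repr F a' \<xi>" "rkhs_repr F b' \<eta>"
    and lim: "(\<lambda>n. ker_form F (a n) (b n)) \<longlonglongrightarrow> z"
  shows "(\<lambda>n. ker_form F (a' n) (b' n)) \<longlonglongrightarrow> z"
proof -
  have mem: "\<And>n. a n \<in> coeffs01" "\<And>n. b n \<in> coeffs01" "\<And>n. a' n \<in> coeffs01" "\<And>n. b' n \<in> coeffs01"
    and Cau: "span.nCauchy a'" "span.nCauchy b"
    using assms(1-4) unfolding repr_iff by blast+
  obtain K where K: "0 \<le> K" "\<And>n. span.nrm (a' n) \<le> K"
    using span.nCauchy_bounded[of a', OF mem(3) Cau(1)] by blast
  obtain K' where K': "0 \<le> K'" "\<And>n. span.nrm (b n) \<le> K'"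
    using span.nCauchy_bounded[of b, OF mem(2) Cau(2)] by blast
  have "rkhs_repr F (\<lambda>n x. a' n x - a n x) (\<lambda>t. 0)" "rkhs_repr F (\<lambda>n x. b' n x - b n x) (\<lambda>t. 0)"
    using repr_diff[OF assms(3,1)] repr_diff[OF assms(4,2)] by simp_all
  note rz = this
  have null: "(\<lambda>n. span.nrm (\<lambda>x. a' n x - a n x)) \<longlonglongrightarrow> 0" "(\<lambda>n. span.nrm (\<lambda>x. b' n x - b n x)) \<longlonglongrightarrow> 0"
    by (rule repr_zero_norm[OF rz(1)] repr_zero_norm[OF rz(2)])+
  have "(\<lambda>n. ker_form F (a' n) (b' n) - ker_form F (a n) (b n)) \<longlonglongrightarrow> 0"
  proof (rule Lim_null_comparison)
    show "(\<lambda>n. K * span.nrm (\<lambda>x. b' n x - b n x) + span.nrm (\<lambda>x. a' n x - a n x) * K') \<longlonglongrightarrow> 0"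
      using tendsto_add[OF tendsto_mult_left[OF null(2), of K] tendsto_mult_right[OF null(1), of K']] by simp
    show "\<forall>\<^sub>F n in sequentially. cmod (ker_form F (a' n) (b' n) - ker_form F (a n) (b n)) \<le>
        K * span.nrm (\<lambda>x. b' n x - b n x) + span.nrm (\<lambda>x. a' n x - a n x) * K'"
    proof (rule always_eventually, rule allI)
      fix n
      have "cmod (ker_form F (a' n) (b' n) - ker_form F (a n) (b n)) =
          cmod (ker_form F (a' n) (\<lambda>x. b' n x - b n x) + ker_form F (\<lambda>x. a' n x - a n x) (b n))"
        by (simp add: span.B_diff span.B_diff_left mem)
      also have "\<dots> \<le> span.nrm (a' n) * span.nrm (\<lambda>x. b' n x - b n x)
          + span.nrm (\<lambda>x. a' n x - a n x) * span.nrm (b n)"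
        by (intro norm_triangle_mono span.Cauchy_Schwarz span.diff_mem mem)
      also have "\<dots> \<le> K * span.nrm (\<lambda>x. b' n x - b n x) + span.nrm (\<lambda>x. a' n x - a n x) * K'"
        by (rule add_mono[OF mult_right_mono[OF K(2)] mult_left_mono[OF K'(2)]])
           (simp_all add: span.nrm_nonneg span.diff_mem mem)
      finally show "cmod (ker_form F (a' n) (b' n) - ker_form F (a n) (b n)) \<le>
        K * span.nrm (\<lambda>x. b' n x - b n x) + span.nrm (\<lambda>x. a' n x - a n x) * K'" .
    qed
  qed
  from tendsto_add[OF this lim] show ?thesis by simp
qed

lemma rkhs_inner_limit:
  assumes r: "rkhs_repr F a \<xi>" "rkhs_repr F b \<eta>"
  shows "(\<lambda>n. ker_form F (a n) (b n)) \<longlonglongrightarrow> rkhs_inner F \<xi> \<eta>"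
proof -
  obtain z where z: "(\<lambda>n. ker_form F (a n) (b n)) \<longlonglongrightarrow> z"
    using ker_form_convergent[OF r] by (auto simp: convergent_def)
  have "rkhs_inner F \<xi> \<eta> = z"
    unfolding rkhs_inner_def
  proof (rule the_equality)
    show "\<exists>a b. rkhs_repr F a \<xi> \<and> rkhs_repr F b \<eta> \<and> (\<lambda>n. ker_form F (a n) (b n)) \<longlonglongrightarrow> z"
      using r z by blast
    fix w assume "\<exists>a b. rkhs_repr F a \<xi> \<and> rkhs_repr F b \<eta> \<and> (\<lambda>n. ker_form F (a n) (b n)) \<longlonglongrightarrow> w"
    then obtain a' b' where "rkhs_repr F a' \<xi>" "rkhs_repr F b' \<eta>" "(\<lambda>n. ker_form F (a' n) (b' n)) \<longlonglongrightarrow> w"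
      by blast
    from ker_form_limit_unique[OF this(1,2) r this(3)] show "w = z" by (rule LIMSEQ_unique[OF _ z])
  qed
  then show ?thesis using z by simp
qed

sublocale H: semi_inner_space "rkhs F" "rkhs_inner F"
proof
  show "(\<lambda>t. 0) \<in> rkhs F"
    using repr_ker_comb[OF span.zero_mem] by (auto simp: rkhs_def ker_comb_def on01_def)
  show "(\<lambda>t. x t + y t) \<in> rkhs F" if "x \<in> rkhs F" "y \<in> rkhs F" for x y
    using that repr_add unfolding rkhs_def by blast
  show "(\<lambda>t. c * x t) \<in> rkhs F" if "x \<in> rkhs F" for x c
    using that repr_scale unfolding rkhs_def by blast
next
  fix x y z assume "x \<in> rkhs F" "y \<in> rkhs F" "z \<in> rkhs F"
  then obtain a b c where r: "rkhs_repr F a x" "rkhs_repr F b y" "rkhs_repr F c z"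
    by (auto simp: rkhs_def)
  have "(\<lambda>n. ker_form F (a n) (\<lambda>u. b n u + c n u)) \<longlonglongrightarrow> rkhs_inner F x y + rkhs_inner F x z"
    using tendsto_add[OF rkhs_inner_limit[OF r(1,2)] rkhs_inner_limit[OF r(1,3)]] r
    by (simp add: span.B_add repr_iff)
  then show "rkhs_inner F x (\<lambda>t. y t + z t) = rkhs_inner F x y + rkhs_inner F x z"
    by (rule LIMSEQ_unique[OF rkhs_inner_limit[OF r(1) repr_add[OF r(2,3)]]])
next
  fix x y c assume "x \<in> rkhs F" "y \<in> rkhs F"
  then obtain a b where r: "rkhs_repr F a x" "rkhs_repr F b y" by (auto simp: rkhs_def)
  have "(\<lambda>n. ker_form F (a n) (\<lambda>u. c * b n u)) \<longlonglongrightarrow> c * rkhs_inner F x y"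
    using tendsto_mult_left[OF rkhs_inner_limit[OF r], of c] r by (simp add: span.B_scale repr_iff)
  then show "rkhs_inner F x (\<lambda>t. c * y t) = c * rkhs_inner F x y"
    by (rule LIMSEQ_unique[OF rkhs_inner_limit[OF r(1) repr_scale[OF r(2)]]])
  have "(\<lambda>n. ker_form F (b n) (a n)) \<longlonglongrightarrow> cnj (rkhs_inner F x y)"
    using tendsto_cnj[OF rkhs_inner_limit[OF r]] r
    by (simp add: ker_form_herm[symmetric] repr_iff)
  then show "rkhs_inner F y x = cnj (rkhs_inner F x y)"
    by (rule LIMSEQ_unique[OF rkhs_inner_limit[OF r(2,1)]])
next
  fix x assume "x \<in> rkhs F"
  then obtain a where r: "rkhs_repr F a x" by (auto simp: rkhs_def)
  have "(\<lambda>n. Re (ker_form F (a n) (a n))) \<longlonglongrightarrow> Re (rkhs_inner F x x)"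
    by (intro tendsto_Re rkhs_inner_limit r)
  then show "0 \<le> Re (rkhs_inner F x x)"
  proof (rule LIMSEQ_le_const)
    have "0 \<le> Re (ker_form F (a n) (a n))" for n by (rule F_pos) (use r in \<open>simp add: repr_iff\<close>)
    then show "\<exists>N. \<forall>n\<ge>N. 0 \<le> Re (ker_form F (a n) (a n))" by blast
  qed
qed

lemma rkhs_norm_eq: "rkhs_norm F = H.nrm"
  by (simp add: rkhs_norm_def H.nrm_def fun_eq_iff)

lemma rkhs_vanish: "\<xi> \<in> rkhs F \<Longrightarrow> \<not> (0 < x \<and> x < 1) \<Longrightarrow> \<xi> x = 0"
proof -
  assume "\<xi> \<in> rkhs F" and x: "\<not> (0 < x \<and> x < 1)"
  then obtain a where "rkhs_repr F a \<xi>" by (auto simp: rkhs_def)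
  then have "(\<lambda>n. ker_comb F (a n) x) \<longlonglongrightarrow> \<xi> x" by (auto simp: repr_iff)
  moreover have "ker_comb F (a n) x = 0" for n using x by (auto simp: ker_comb_def on01_def)
  ultimately show ?thesis by (simp add: LIMSEQ_const_iff)
qed

lemma ker_comb_mem: "a \<in> coeffs01 \<Longrightarrow> ker_comb F a \<in> rkhs F"
  using repr_ker_comb by (auto simp: rkhs_def)

lemma inner_ker_comb:
  assumes a: "a \<in> coeffs01" and \<xi>: "\<xi> \<in> rkhs F"
  shows "rkhs_inner F (ker_comb F a) \<xi> = pair a \<xi>"
proof -
  obtain b where b: "rkhs_repr F b \<xi>" using \<xi> by (auto simp: rkhs_def)
  have "(\<lambda>n. ker_form F a (b n)) \<longlonglongrightarrow> pair a \<xi>"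
    unfolding ker_form_eq_pair[OF a] using b by (intro pair_tendsto a) (auto simp: repr_iff)
  then show ?thesis by (rule LIMSEQ_unique[OF rkhs_inner_limit[OF repr_ker_comb[OF a] b]])
qed

lemma nrm_ker_comb: "a \<in> coeffs01 \<Longrightarrow> H.nrm (ker_comb F a) = span.nrm a"
  by (simp add: H.nrm_def span.nrm_def inner_ker_comb ker_comb_mem ker_form_eq_pair)

lemma pair_bound: "a \<in> coeffs01 \<Longrightarrow> \<xi> \<in> rkhs F \<Longrightarrow> cmod (pair a \<xi>) \<le> H.nrm \<xi> * span.nrm a"
  using H.Cauchy_Schwarz[OF ker_comb_mem, of a \<xi>] by (simp add: inner_ker_comb nrm_ker_comb mult.commute)

lemma repr_nrm_limit:
  assumes r: "rkhs_repr F a \<xi>"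
  shows "(\<lambda>n. span.nrm (a n)) \<longlonglongrightarrow> H.nrm \<xi>"
  unfolding span.nrm_def H.nrm_def by (intro tendsto_real_sqrt tendsto_Re rkhs_inner_limit r)

text \<open>
  The span of the kernels is dense.
\<close>

lemma repr_tendsto:
  assumes r: "rkhs_repr F a \<xi>"
  shows "(\<lambda>n. H.nrm (\<lambda>t. ker_comb F (a n) t - \<xi> t)) \<longlonglongrightarrow> 0"
proof (rule LIMSEQ_I)
  fix e :: real assume e: "0 < e"
  have a: "\<And>n. a n \<in> coeffs01" "span.nCauchy a" using r by (auto simp: repr_iff)
  have \<xi>: "\<xi> \<in> rkhs F" using r by (auto simp: rkhs_def)
  obtain N where N: "\<forall>m\<ge>N. \<forall>n\<ge>N. span.nrm (\<lambda>t. a m t - a n t) < e/2"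
    using span.nCauchyD[OF a(2), of "e/2"] e by auto
  have "H.nrm (\<lambda>t. ker_comb F (a n) t - \<xi> t) < e" if n: "n \<ge> N" for n
  proof -
    have "(\<lambda>m. span.nrm (\<lambda>t. a n t - a m t)) \<longlonglongrightarrow> H.nrm (\<lambda>t. ker_comb F (a n) t - \<xi> t)"
      by (rule repr_nrm_limit[OF repr_diff[OF repr_ker_comb[OF a(1)] r]])
    then have "H.nrm (\<lambda>t. ker_comb F (a n) t - \<xi> t) \<le> e/2"
      by (rule LIMSEQ_le_const2) (use N n less_imp_le in blast)
    then show ?thesis using e by simp
  qed
  then show "\<exists>N. \<forall>n\<ge>N. norm (H.nrm (\<lambda>t. ker_comb F (a n) t - \<xi> t) - 0) < e"
    using H.nrm_nonneg[OF H.diff_mem[OF ker_comb_mem[OF a(1)] \<xi>]] by auto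
qed

text \<open>
  Aronszajn's description of the elements of a reproducing kernel space: \<open>f\<close> belongs to the
  space, with norm at most \<open>C\<close>, as soon as the functional that \<open>f\<close> should induce on the span is
  bounded by \<open>C\<close>. An approximate representer of that functional converges to \<open>f\<close> pointwise,
  because testing it with \<open>delta x\<close> evaluates at \<open>x\<close>. For concrete functions, such as smeared
  kernels, the criterion replaces the construction of a Cauchy sequence.
\<close>

lemma rkhs_criterion:
  assumes van: "\<And>x. \<not> (0 < x \<and> x < 1) \<Longrightarrow> f x = 0"
    and bd: "\<And>a. a \<in> coeffs01 \<Longrightarrow> cmod (pair a f) \<le> C * span.nrm a"
  shows "f \<in> rkhs F" and "0 \<le> C \<Longrightarrow> H.nrm f \<le> C"
proof -
  obtain s where s: "\<And>n. s n \<in> coeffs01" "span.nCauchy s"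
    "\<And>v. v \<in> coeffs01 \<Longrightarrow> (\<lambda>n. ker_form F v (s n)) \<longlonglongrightarrow> pair v f"
    by (rule span.approximate_representer[of coeffs01 "\<lambda>v. pair v f" C])
       (use bd in \<open>auto simp: span.zero_mem coeffs01_add coeffs01_scale pair_add_left pair_scale_left\<close>)
  have "(\<lambda>n. ker_comb F (s n) x) \<longlonglongrightarrow> f x" for x
  proof (cases "0 < x \<and> x < 1")
    case True
    then show ?thesis using s(3)[of "delta x"] by (simp add: delta_mem ker_form_eq_pair pair_delta)
  next
    case False
    then have "ker_comb F (s n) x = 0" for n by (auto simp: ker_comb_def on01_def)
    then show ?thesis using van[OF False] by simp
  qed
  then have r: "rkhs_repr F s f" using s by (simp add: repr_iff)
  then show f: "f \<in> rkhs F" by (auto simp: rkhs_def)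
  assume C: "0 \<le> C"
  have "(\<lambda>n. cmod (pair (s n) f)) \<longlonglongrightarrow> cmod (rkhs_inner F f f)"
    using tendsto_norm[OF H.B_tendsto_left[OF ker_comb_mem[OF s(1)] f f repr_tendsto[OF r]]]
    by (simp only: inner_ker_comb[OF s(1) f])
  then have "cmod (rkhs_inner F f f) \<le> C * H.nrm f"
    using tendsto_mult_left[OF repr_nrm_limit[OF r], of C] bd[OF s(1)] by (intro LIMSEQ_le) auto
  then have "H.nrm f * H.nrm f \<le> C * H.nrm f"
    unfolding H.B_self[OF f] by (simp add: power2_eq_square norm_mult)
  then show "H.nrm f \<le> C"
    using H.nrm_nonneg[OF f] C by (cases "H.nrm f = 0") auto
qed

lemma F0_nonneg: "0 \<le> Re (F 0)"
proof -
  have d: "delta (1/2) \<in> coeffs01" by (rule delta_mem) simp_all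
  show ?thesis
    using F_pos[OF d] unfolding ker_form_eq_pair[OF d] by (simp add: pair_delta ker_comb_delta on01_def)
qed

lemma eval_bound:
  assumes \<xi>: "\<xi> \<in> rkhs F" shows "cmod (\<xi> x) \<le> sqrt (Re (F 0)) * H.nrm \<xi>"
proof (cases "0 < x \<and> x < 1")
  case True
  then have d: "delta x \<in> coeffs01" by (simp add: delta_mem)
  have "span.nrm (delta x) = sqrt (Re (F 0))"
    using True by (simp add: span.nrm_def ker_form_eq_pair d pair_delta ker_comb_delta on01_def)
  then show ?thesis using pair_bound[OF d \<xi>] by (simp add: pair_delta mult.commute)
next
  case False
  then show ?thesis using F0_nonneg rkhs_vanish[OF \<xi> False] H.nrm_nonneg[OF \<xi>] by simp
qed

lemma nrm_eq_0D: "\<xi> \<in> rkhs F \<Longrightarrow> H.nrm \<xi> = 0 \<Longrightarrow> \<xi> x = 0"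
  using eval_bound[of \<xi> x] by simp

text \<open>
  A norm Cauchy sequence converges pointwise; the criterion, applied to the tails
  \<open>s n - \<xi>\<close>, shows that the pointwise limit is also the limit in norm.
\<close>

lemma rkhs_complete:
  assumes s: "\<And>n. s n \<in> rkhs F" "H.nCauchy s"
  obtains \<xi> where "\<xi> \<in> rkhs F" "(\<lambda>n. H.nrm (\<lambda>t. s n t - \<xi> t)) \<longlonglongrightarrow> 0"
proof -
  have "Cauchy (\<lambda>n. s n x)" for x
  proof (rule metric_CauchyI)
    fix e :: real assume e: "0 < e"
    define K where "K = sqrt (Re (F 0)) + 1"
    have K: "0 < K" "sqrt (Re (F 0)) \<le> K"
      using F0_nonneg by (simp_all add: K_def add_nonneg_pos)
    obtain N where N: "\<forall>m\<ge>N. \<forall>n\<ge>N. H.nrm (\<lambda>t. s m t - s n t) < e/K"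
      using H.nCauchyD[OF s(2), of "e/K"] e K by auto
    have "dist (s m x) (s n x) < e" if mn: "m \<ge> N" "n \<ge> N" for m n
    proof -
      have "dist (s m x) (s n x) \<le> sqrt (Re (F 0)) * H.nrm (\<lambda>t. s m t - s n t)"
        using eval_bound[OF H.diff_mem[OF s(1) s(1)]] by (simp add: dist_norm)
      also have "\<dots> \<le> K * H.nrm (\<lambda>t. s m t - s n t)"
        by (intro mult_right_mono K H.nrm_nonneg H.diff_mem s)
      also have "\<dots> < K * (e/K)" using N mn K by (intro mult_strict_left_mono) auto
      finally show ?thesis using K by simp
    qed
    then show "\<exists>N. \<forall>m\<ge>N. \<forall>n\<ge>N. dist (s m x) (s n x) < e" by blast
  qed
  then have "\<exists>l. (\<lambda>n. s n x) \<longlonglongrightarrow> l" for x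
    using Cauchy_convergent_iff convergent_def by blast
  then obtain \<xi> where \<xi>: "\<And>x. (\<lambda>n. s n x) \<longlonglongrightarrow> \<xi> x" by metis
  have van: "\<xi> x = 0" if "\<not> (0 < x \<and> x < 1)" for x
    using \<xi>[of x] rkhs_vanish[OF s(1) that] by (simp add: LIMSEQ_const_iff)
  have tail: "(\<lambda>t. s n t - \<xi> t) \<in> rkhs F \<and> H.nrm (\<lambda>t. s n t - \<xi> t) \<le> e"
    if e: "0 \<le> e" and N: "\<And>m. m \<ge> N \<Longrightarrow> H.nrm (\<lambda>t. s n t - s m t) \<le> e" for n e N
  proof -
    have "cmod (pair a (\<lambda>t. s n t - \<xi> t)) \<le> e * span.nrm a" if a: "a \<in> coeffs01" for a
    proof (rule LIMSEQ_le_const2)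
      show "(\<lambda>m. cmod (pair a (\<lambda>t. s n t - s m t))) \<longlonglongrightarrow> cmod (pair a (\<lambda>t. s n t - \<xi> t))"
        by (intro tendsto_norm pair_tendsto a tendsto_diff tendsto_const \<xi>)
      have "cmod (pair a (\<lambda>t. s n t - s m t)) \<le> e * span.nrm a" if "m \<ge> N" for m
        by (rule order_trans[OF pair_bound[OF a H.diff_mem[OF s(1) s(1)]]])
           (intro mult_right_mono N that span.nrm_nonneg a)
      then show "\<exists>N. \<forall>m\<ge>N. cmod (pair a (\<lambda>t. s n t - s m t)) \<le> e * span.nrm a" by blast
    qed
    then show ?thesis
      using rkhs_criterion[of "\<lambda>t. s n t - \<xi> t" e] van rkhs_vanish[OF s(1)] e by auto
  qed
  have lim: "\<exists>N. \<forall>n\<ge>N. H.nrm (\<lambda>t. s n t - \<xi> t) < e \<and> (\<lambda>t. s n t - \<xi> t) \<in> rkhs F" if e: "0 < e" for e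
  proof -
    obtain N where N: "\<forall>m\<ge>N. \<forall>n\<ge>N. H.nrm (\<lambda>t. s m t - s n t) < e/2"
      using H.nCauchyD[OF s(2), of "e/2"] e by auto
    have "H.nrm (\<lambda>t. s n t - \<xi> t) < e \<and> (\<lambda>t. s n t - \<xi> t) \<in> rkhs F" if "n \<ge> N" for n
    proof -
      have "(\<lambda>t. s n t - \<xi> t) \<in> rkhs F \<and> H.nrm (\<lambda>t. s n t - \<xi> t) \<le> e/2"
        by (rule tail[of _ N]) (use N that e in \<open>auto intro: less_imp_le\<close>)
      then show ?thesis using e by auto
    qed
    then show ?thesis by blast
  qed
  from lim[of 1] obtain n where "(\<lambda>t. s n t - \<xi> t) \<in> rkhs F" by auto
  from H.diff_mem[OF s(1)[of n] this] have \<xi>m: "\<xi> \<in> rkhs F" by simp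
  have "(\<lambda>n. H.nrm (\<lambda>t. s n t - \<xi> t)) \<longlonglongrightarrow> 0"
  proof (rule LIMSEQ_I)
    fix e :: real assume "0 < e"
    then show "\<exists>N. \<forall>n\<ge>N. norm (H.nrm (\<lambda>t. s n t - \<xi> t) - 0) < e"
      using lim[of e] H.nrm_nonneg[OF H.diff_mem[OF s(1) \<xi>m]] by auto
  qed
  with \<xi>m that show ?thesis by blast
qed

end

section \<open>The exponential kernel and its square root\<close>

lemma continuous_eq_on_closed01:
  fixes f g :: "real \<Rightarrow> complex"
  assumes "continuous_on {0..1} f" "continuous_on {0..1} g"
    and "\<And>x. 0 < x \<Longrightarrow> x < 1 \<Longrightarrow> f x = g x" and "x \<in> {0..1}"
  shows "f x = g x"
proof -
  have "closure {0<..<1::real} = {0..1}" by simp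
  moreover have "f x - g x = 0"
  proof (rule continuous_constant_on_closure[of "{0<..<1::real}" "\<lambda>x. f x - g x" 0])
    show "continuous_on (closure {0<..<1}) (\<lambda>x. f x - g x)"
      using assms by (simp add: continuous_on_diff)
  qed (use assms in auto)
  ultimately show ?thesis by simp
qed

lemma cmod_sq_eq: "complex_of_real ((cmod z)\<^sup>2) = cnj z * z"
  using complex_norm_square[of z] by (simp only: mult.commute)

text \<open>
  For \<open>0 \<le> x, y \<le> 1\<close> one has
  \<open>e\<^bsup>-|x-y|\<^esup> = e\<^bsup>-x\<^esup> e\<^bsup>-y\<^esup> + 2 \<integral>\<^sub>0\<^sup>1 step_exp x t * step_exp y t dt\<close>, so that
  \<open>x \<mapsto> (e\<^bsup>-x\<^esup>, \<surd>2 step_exp x)\<close> embeds the kernel into \<open>\<complex> \<oplus> L\<^sup>2(0,1)\<close>. The function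
  \<open>t \<mapsto> step_exp x t\<close> is the restriction of \<open>e\<^bsup>t-x\<^esup>\<close> to \<open>t < x\<close>.
\<close>

definition step_exp :: "real \<Rightarrow> real \<Rightarrow> real" where
  "step_exp x t = (if t < x then exp (t - x) else 0)"

lemma step_exp_has_integral:
  fixes g :: "real \<Rightarrow> complex"
  assumes g: "continuous_on {0..1} g" and x: "0 \<le> x" "x \<le> 1"
  shows "((\<lambda>t. of_real (step_exp x t) * g t) has_integral
          integral {0..x} (\<lambda>t. of_real (exp (t - x)) * g t)) {0..1}"
proof -
  have 1: "((\<lambda>t. of_real (step_exp x t) * g t) has_integral
          integral {0..x} (\<lambda>t. of_real (exp (t - x)) * g t)) {0..x}"
  proof (rule has_integral_spike_finite[of "{x}"])
    show "((\<lambda>t. of_real (exp (t - x)) * g t) has_integral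
          integral {0..x} (\<lambda>t. of_real (exp (t - x)) * g t)) {0..x}"
      by (intro integrable_integral integrable_continuous_real continuous_intros
          continuous_on_subset[OF g]) (use x in auto)
  qed (auto simp: step_exp_def)
  have 2: "((\<lambda>t. of_real (step_exp x t) * g t) has_integral 0) {x..1}"
    by (rule has_integral_is_0) (auto simp: step_exp_def)
  from has_integral_combine[OF x 1 2] show ?thesis by simp
qed

lemma step_exp_gram:
  assumes "0 \<le> x" "x \<le> 1" "0 \<le> y" "y \<le> 1"
  shows "((\<lambda>t. step_exp x t * step_exp y t) has_integral (exp (- \<bar>x - y\<bar>) - exp (- x - y)) / 2) {0..1}"
  using assms
proof (induction x y rule: linorder_wlog)
  case (sym x y)
  have "- y - x = - x - y" by simp
  with sym show ?case by (simp only: mult.commute[of "step_exp y _"] abs_minus_commute[of y x])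
next
  case (le x y)
  have 1: "((\<lambda>t. step_exp x t * step_exp y t) has_integral (exp (x - y) - exp (- x - y)) / 2) {0..x}"
  proof (rule has_integral_spike_finite[of "{x}"])
    have "((\<lambda>t. exp (2 * t - x - y)) has_integral exp (2 * x - x - y) / 2 - exp (2 * 0 - x - y) / 2) {0..x}"
      by (rule fundamental_theorem_of_calculus)
         (use le in \<open>auto intro!: derivative_eq_intros simp: has_real_derivative_iff_has_vector_derivative[symmetric]\<close>)
    then show "((\<lambda>t. exp (2 * t - x - y)) has_integral (exp (x - y) - exp (- x - y)) / 2) {0..x}"
      by (simp add: diff_divide_distrib)
  qed (use le in \<open>auto simp: step_exp_def exp_add[symmetric]\<close>)
  have 2: "((\<lambda>t. step_exp x t * step_exp y t) has_integral 0) {x..1}"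
    by (rule has_integral_is_0) (auto simp: step_exp_def)
  show ?case using has_integral_combine[OF _ _ 1 2] le by simp
qed

definition feature :: "(real \<Rightarrow> complex) \<Rightarrow> real \<Rightarrow> complex" where
  "feature a t = (\<Sum>x | a x \<noteq> 0. a x * of_real (step_exp x t))"

definition feature0 :: "(real \<Rightarrow> complex) \<Rightarrow> complex" where
  "feature0 a = (\<Sum>x | a x \<noteq> 0. a x * of_real (exp (- x)))"

locale exp_kernel =
  fixes F :: "real \<Rightarrow> complex"
  assumes F: "\<And>x. \<bar>x\<bar> < 1 \<Longrightarrow> F x = complex_of_real (exp (- \<bar>x\<bar>))"
begin

text \<open>
  The squared norm of a kernel combination is that of its image in \<open>\<complex> \<oplus> L\<^sup>2(0,1)\<close>; in
  particular the exponential kernel is positive semidefinite.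
\<close>

lemma feature_norm:
  assumes a: "a \<in> coeffs01"
  shows "((\<lambda>t. (cmod (feature a t))\<^sup>2) has_integral
           (Re (ker_form F a a) - (cmod (feature0 a))\<^sup>2) / 2) {0..1}"
proof -
  let ?S = "{x. a x \<noteq> 0}"
  have S: "finite ?S" "\<And>x. x \<in> ?S \<Longrightarrow> 0 < x \<and> x < 1" using a by (auto simp: coeffs01_def)
  have "((\<lambda>t. \<Sum>x\<in>?S. \<Sum>y\<in>?S. (cnj (a x) * a y) * of_real (step_exp x t * step_exp y t)) has_integral
      (\<Sum>x\<in>?S. \<Sum>y\<in>?S. (cnj (a x) * a y) * of_real ((exp (- \<bar>x - y\<bar>) - exp (- x - y)) / 2))) {0..1}"
    by (intro has_integral_sum S has_integral_mult_right has_integral_of_real step_exp_gram)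
       (use S in \<open>auto intro: less_imp_le\<close>)
  also have "(\<lambda>t. \<Sum>x\<in>?S. \<Sum>y\<in>?S. (cnj (a x) * a y) * of_real (step_exp x t * step_exp y t)) =
      (\<lambda>t. of_real ((cmod (feature a t))\<^sup>2))"
  proof
    fix t
    have "of_real ((cmod (feature a t))\<^sup>2) = cnj (feature a t) * feature a t"
      by (rule cmod_sq_eq)
    also have "\<dots> = (\<Sum>x\<in>?S. \<Sum>y\<in>?S. (cnj (a x) * a y) * of_real (step_exp x t * step_exp y t))"
      unfolding feature_def cnj_sum sum_product by (intro sum.cong refl) simp
    finally show "(\<Sum>x\<in>?S. \<Sum>y\<in>?S. (cnj (a x) * a y) * of_real (step_exp x t * step_exp y t)) =
      of_real ((cmod (feature a t))\<^sup>2)" ..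
  qed
  also have "(\<Sum>x\<in>?S. \<Sum>y\<in>?S. (cnj (a x) * a y) * of_real ((exp (- \<bar>x - y\<bar>) - exp (- x - y)) / 2)) =
     (ker_form F a a - of_real ((cmod (feature0 a))\<^sup>2)) / 2"
  proof -
    have 1: "of_real ((cmod (feature0 a))\<^sup>2) = (\<Sum>x\<in>?S. \<Sum>y\<in>?S. (cnj (a x) * a y) * of_real (exp (- x - y)))"
    proof -
      have "of_real ((cmod (feature0 a))\<^sup>2) = cnj (feature0 a) * feature0 a"
        by (rule cmod_sq_eq)
      also have "\<dots> = (\<Sum>x\<in>?S. \<Sum>y\<in>?S. (cnj (a x) * a y) * of_real (exp (- x) * exp (- y)))"
        unfolding feature0_def cnj_sum sum_product by (intro sum.cong refl) simp
      finally show ?thesis by (simp add: exp_add[symmetric])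
    qed
    have 2: "ker_form F a a = (\<Sum>x\<in>?S. \<Sum>y\<in>?S. (cnj (a x) * a y) * of_real (exp (- \<bar>x - y\<bar>)))"
      unfolding ker_form_def
    proof (intro sum.cong refl)
      fix x y assume "x \<in> ?S" "y \<in> ?S"
      then have "\<bar>x - y\<bar> < 1" using S(2)[of x] S(2)[of y] by auto
      then show "cnj (a x) * a y * F (x - y) = cnj (a x) * a y * of_real (exp (- \<bar>x - y\<bar>))"
        by (simp add: F)
    qed
    show ?thesis unfolding 1 2 by (simp add: sum_subtractf[symmetric] sum_divide_distrib algebra_simps diff_divide_distrib)
  qed
  finally have "((\<lambda>t. complex_of_real ((cmod (feature a t))\<^sup>2)) has_integral
      (ker_form F a a - of_real ((cmod (feature0 a))\<^sup>2)) / 2) {0..1}" .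
  from has_integral_linear[OF this bounded_linear_Re] show ?thesis
    by (simp add: o_def Re_divide_numeral)
qed

sublocale pd_kernel F
proof
  show "F (- x) = cnj (F x)" if "\<bar>x\<bar> < 1" for x
    using that by (simp add: F)
  show "0 \<le> Re (ker_form F a a)" if a: "a \<in> coeffs01" for a
  proof -
    have "0 \<le> (Re (ker_form F a a) - (cmod (feature0 a))\<^sup>2) / 2"
      by (rule has_integral_nonneg[OF feature_norm[OF a]]) simp
    then have "(cmod (feature0 a))\<^sup>2 \<le> Re (ker_form F a a)" by simp
    then show ?thesis by (rule order_trans[OF zero_le_power2])
  qed
qed

lemma feature0_le: "a \<in> coeffs01 \<Longrightarrow> cmod (feature0 a) \<le> span.nrm a"
proof -
  assume a: "a \<in> coeffs01"
  have "0 \<le> (Re (ker_form F a a) - (cmod (feature0 a))\<^sup>2) / 2"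
    by (rule has_integral_nonneg[OF feature_norm[OF a]]) simp
  then have "(cmod (feature0 a))\<^sup>2 \<le> (span.nrm a)\<^sup>2" by (simp add: span.nrm_sq a)
  then show ?thesis by (rule power2_le_imp_le) (simp add: span.nrm_nonneg a)
qed

text \<open>
  The hypothesis on \<open>f\<close> is the solution formula of \<open>f' + f = p\<close>, \<open>f(0) = b\<close>. It writes
  \<open>pair a f\<close> as an inner product in \<open>\<complex> \<oplus> L\<^sup>2(0,1)\<close> of the image of \<open>a\<close> with
  \<open>(b, p / \<surd>2)\<close>, which the Cauchy-Schwarz inequality bounds. So continuously differentiable functions
  on \<open>[0,1]\<close> lie in the space, and their norm is controlled by uniform bounds on the function
  and its derivative.
\<close>

lemma nrm_le_sup:
  assumes van: "\<And>x. \<not> (0 < x \<and> x < 1) \<Longrightarrow> f x = 0"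
    and p: "continuous_on {0..1} p" "\<And>t. t \<in> {0..1} \<Longrightarrow> cmod (p t) \<le> P"
    and b: "cmod b \<le> K"
    and f: "\<And>x. 0 < x \<Longrightarrow> x < 1 \<Longrightarrow> f x = of_real (exp (- x)) * b + integral {0..x} (\<lambda>t. of_real (exp (t - x)) * p t)"
  shows "f \<in> rkhs F" "H.nrm f \<le> K + P"
proof -
  have P: "0 \<le> P" using order_trans[OF norm_ge_zero p(2)[of 0]] by simp
  have K: "0 \<le> K" by (rule order_trans[OF norm_ge_zero b])
  have bd: "cmod (pair a f) \<le> (K + P) * span.nrm a" if a: "a \<in> coeffs01" for a
  proof -
    let ?S = "{x. a x \<noteq> 0}"
    have S: "finite ?S" "\<And>x. x \<in> ?S \<Longrightarrow> 0 < x \<and> x < 1" using a by (auto simp: coeffs01_def)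
    define R where "R = (\<Sum>x\<in>?S. cnj (a x) * integral {0..x} (\<lambda>t. of_real (exp (t - x)) * p t))"
    have "((\<lambda>t. \<Sum>x\<in>?S. cnj (a x) * (of_real (step_exp x t) * p t)) has_integral R) {0..1}"
      unfolding R_def
      by (intro has_integral_sum S has_integral_mult_right step_exp_has_integral p) (use S(2) less_imp_le in blast)+
    also have "(\<lambda>t. \<Sum>x\<in>?S. cnj (a x) * (of_real (step_exp x t) * p t)) = (\<lambda>t. cnj (feature a t) * p t)"
      unfolding feature_def cnj_sum sum_distrib_right by (intro ext sum.cong refl) simp
    finally have R: "((\<lambda>t. cnj (feature a t) * p t) has_integral R) {0..1}" .
    \<comment> \<open>Instead of the integral of \<open>|feature a|\<close>, bound \<open>|feature a|
      \<le> (|feature a|\<^sup>2 / s + s) / 2\<close>; a strict bound \<open>s\<close> avoids dividing by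
      \<open>0\<close> when the norm vanishes.\<close>
    have "cmod R \<le> P * s" if s: "span.nrm a < s" for s
    proof -
      have s0: "0 < s" using s span.nrm_nonneg[OF a] by linarith
      define I where "I = (Re (ker_form F a a) - (cmod (feature0 a))\<^sup>2) / 2"
      have "I \<le> Re (ker_form F a a) / 2" by (simp add: I_def)
      also have "\<dots> \<le> s\<^sup>2 / 2"
        unfolding span.nrm_sq[OF a, symmetric] using s span.nrm_nonneg[OF a] by (simp add: power_mono)
      finally have I: "I \<le> s\<^sup>2 / 2" .
      have "((\<lambda>t. P * (((cmod (feature a t))\<^sup>2 / s + s) / 2)) has_integral P * ((I / s + s) / 2)) {0..1}"
        using has_integral_mult_right[OF has_integral_divide[OF has_integral_add[OF
            has_integral_divide[OF feature_norm[OF a], of s] has_integral_const_real[of s 0 1]], of 2], of P]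
        by (simp add: I_def)
      from has_integral_norm_bound_integral_component[OF R this, of 1]
      have "cmod R \<le> P * ((I / s + s) / 2)"
      proof (simp only: inner_real_def mult_1_right, elim meta_mp)
        fix t :: real assume t: "t \<in> {0..1}"
        have "cmod (feature a t) \<le> ((cmod (feature a t))\<^sup>2 / s + s) / 2"
        proof -
          have "0 \<le> (cmod (feature a t) - s)\<^sup>2" by simp
          then have "cmod (feature a t) * (2 * s) \<le> (cmod (feature a t))\<^sup>2 + s * s"
            by (simp add: power2_diff power2_eq_square algebra_simps)
          then show ?thesis using s0 by (simp add: field_simps power2_eq_square)
        qed
        then have "cmod (feature a t) * cmod (p t) \<le> ((cmod (feature a t))\<^sup>2 / s + s) / 2 * P"
          using p(2)[OF t] P s0 by (intro mult_mono) auto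
        then show "cmod (cnj (feature a t) * p t) \<le> P * (((cmod (feature a t))\<^sup>2 / s + s) / 2)"
          by (simp add: norm_mult mult.commute)
      qed
      also have "\<dots> \<le> P * s"
      proof (rule mult_left_mono[OF _ P])
        have "I \<le> s * s" using order_trans[OF I, of "s\<^sup>2"] by (simp add: power2_eq_square)
        then have "I / s \<le> s" using s0 by (simp add: field_simps)
        then show "(I / s + s) / 2 \<le> s" by simp
      qed
      finally show ?thesis .
    qed
    then have Rle: "cmod R \<le> P * span.nrm a"
    proof -
      have "((\<lambda>s. P * s) \<longlongrightarrow> P * span.nrm a) (at_right (span.nrm a))"
        by (intro tendsto_intros)
      then show ?thesis
        by (rule tendsto_lowerbound)
           (auto simp: eventually_at_right_field intro!: exI[of _ "span.nrm a + 1"] \<open>\<And>s. span.nrm a < s \<Longrightarrow> cmod R \<le> P * s\<close>)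
    qed
    have "pair a f = cnj (feature0 a) * b + R"
    proof -
      have "pair a f = (\<Sum>x\<in>?S. cnj (a x) * (of_real (exp (- x)) * b + integral {0..x} (\<lambda>t. of_real (exp (t - x)) * p t)))"
        unfolding pair_def by (intro sum.cong refl) (use S(2) f in simp)
      also have "\<dots> = cnj (feature0 a) * b + R"
        by (simp add: R_def feature0_def sum.distrib sum_distrib_right distrib_left mult.assoc)
      finally show ?thesis .
    qed
    then have "cmod (pair a f) \<le> cmod (feature0 a) * cmod b + cmod R"
      using norm_triangle_ineq[of "cnj (feature0 a) * b" R] by (simp add: norm_mult)
    also have "\<dots> \<le> span.nrm a * K + P * span.nrm a"
      by (intro add_mono mult_mono Rle feature0_le a b) (simp_all add: span.nrm_nonneg a)
    finally show ?thesis by (simp add: algebra_simps)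
  qed
  show "f \<in> rkhs F" by (rule rkhs_criterion(1)[OF van bd])
  show "H.nrm f \<le> K + P" by (rule rkhs_criterion(2)[OF van bd]) (use P K in auto)
qed

text \<open>
  The reproducing kernel at \<open>x\<close>, including the endpoints \<open>x = 0\<close> and \<open>x = 1\<close>, where it equals
  \<open>e\<^bsup>-t\<^esup>\<close> and \<open>e\<^bsup>t-1\<^esup>\<close>: the two defect vectors of the derivation.
\<close>

definition kern :: "real \<Rightarrow> real \<Rightarrow> complex" where
  "kern x = on01 (\<lambda>t. of_real (exp (- \<bar>t - x\<bar>)))"

lemma kern_interior: "0 < x \<Longrightarrow> x < 1 \<Longrightarrow> kern x = ker_comb F (delta x)"
  unfolding kern_def ker_comb_delta by (auto simp: on01_def fun_eq_iff F)

text \<open>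
  For interior \<open>x\<close> this is the Cauchy-Schwarz inequality with \<open>\<parallel>kern x\<parallel> = 1\<close>. An endpoint is
  approached by interior points, and \<open>pair a\<close> depends on finitely many values only.
\<close>

lemma kern_bound:
  assumes x: "x \<in> {0..1}" and a: "a \<in> coeffs01"
  shows "cmod (pair a (kern x)) \<le> 1 * span.nrm a"
proof -
  \<comment> \<open>Moving \<open>x\<close> towards the midpoint keeps the sequence inside the open
    interval, whichever point of \<open>[0,1]\<close> it tends to.\<close>
  define y where "y = (\<lambda>n. x + (1/2 - x) * inverse (real (Suc n)))"
  have yx: "y \<longlonglongrightarrow> x"
    using tendsto_add[OF tendsto_const tendsto_mult_right_zero[OF LIMSEQ_inverse_real_of_nat, of "1/2 - x"], of x]
    by (simp add: y_def)
  have y: "0 < y n" "y n < 1" for n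
  proof -
    define u where "u = inverse (real (Suc n))"
    have u: "0 < u" "u \<le> 1" by (auto simp: u_def field_simps)
    have "y n = (1 - u) * x + u / 2" by (simp add: y_def u_def algebra_simps)
    moreover have "0 \<le> (1 - u) * x" "(1 - u) * x \<le> (1 - u) * 1"
      using u x mult_left_mono[of x 1 "1 - u"] by auto
    ultimately show "0 < y n" "y n < 1" using u by auto
  qed
  have bd: "cmod (pair a (kern (y n))) \<le> span.nrm a" for n
  proof -
    have d: "delta (y n) \<in> coeffs01" by (rule delta_mem[OF y])
    have "H.nrm (kern (y n)) = 1"
      unfolding kern_interior[OF y] nrm_ker_comb[OF d] span.nrm_def ker_form_eq_pair[OF d] pair_delta
      using y[of n] by (simp add: ker_comb_delta on01_def F)
    then show ?thesis
      using pair_bound[OF a ker_comb_mem[OF d]] by (simp add: kern_interior y)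
  qed
  have "(\<lambda>n. cmod (pair a (kern (y n)))) \<longlonglongrightarrow> cmod (pair a (kern x))"
    by (intro tendsto_norm pair_tendsto a) (auto simp: kern_def on01_def intro!: tendsto_intros yx)
  then show ?thesis by (simp add: LIMSEQ_le_const2 bd)
qed

lemma kern_mem: "x \<in> {0..1} \<Longrightarrow> kern x \<in> rkhs F"
  by (rule rkhs_criterion(1)[OF _ kern_bound]) (auto simp: kern_def on01_def)

lemma nrm_kern: "x \<in> {0..1} \<Longrightarrow> H.nrm (kern x) \<le> 1"
  by (rule rkhs_criterion(2)[OF _ kern_bound]) (auto simp: kern_def on01_def)

text \<open>
  Every element of the space extends continuously to \<open>[0,1]\<close>. Taking the inner product with the
  kernel as the definition makes the extension linear and bounded, at the endpoints as well.
\<close>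

definition cext :: "(real \<Rightarrow> complex) \<Rightarrow> real \<Rightarrow> complex" where
  "cext \<xi> x = rkhs_inner F (kern x) \<xi>"

lemma cext_interior: "\<xi> \<in> rkhs F \<Longrightarrow> 0 < x \<Longrightarrow> x < 1 \<Longrightarrow> cext \<xi> x = \<xi> x"
  by (simp add: cext_def kern_interior inner_ker_comb delta_mem pair_delta)

lemma cext_bound: "\<xi> \<in> rkhs F \<Longrightarrow> x \<in> {0..1} \<Longrightarrow> cmod (cext \<xi> x) \<le> H.nrm \<xi>"
  using order_trans[OF H.Cauchy_Schwarz[OF kern_mem] mult_right_mono[OF nrm_kern H.nrm_nonneg]]
  by (simp add: cext_def)

lemma cext_add: "\<xi> \<in> rkhs F \<Longrightarrow> \<eta> \<in> rkhs F \<Longrightarrow> x \<in> {0..1} \<Longrightarrow> cext (\<lambda>t. \<xi> t + \<eta> t) x = cext \<xi> x + cext \<eta> x"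
  by (simp add: cext_def H.B_add kern_mem)

lemma cext_diff: "\<xi> \<in> rkhs F \<Longrightarrow> \<eta> \<in> rkhs F \<Longrightarrow> x \<in> {0..1} \<Longrightarrow> cext (\<lambda>t. \<xi> t - \<eta> t) x = cext \<xi> x - cext \<eta> x"
  by (simp add: cext_def H.B_diff kern_mem)

lemma cext_scale: "\<xi> \<in> rkhs F \<Longrightarrow> x \<in> {0..1} \<Longrightarrow> cext (\<lambda>t. c * \<xi> t) x = c * cext \<xi> x"
  by (simp add: cext_def H.B_scale kern_mem)

lemma nrm_kern_diff:
  assumes x: "0 < x" "x < 1" and y: "y \<in> {0..1}"
  shows "H.nrm (\<lambda>t. kern x t - kern y t) \<le> sqrt (2 * \<bar>x - y\<bar>)"
proof -
  have m: "kern x \<in> rkhs F" "kern y \<in> rkhs F" using x y by (auto intro: kern_mem)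
  have "rkhs_inner F (kern x) (kern y) = kern y x"
    using cext_interior[OF m(2) x] by (simp add: cext_def)
  then have "rkhs_inner F (kern x) (kern y) = of_real (exp (- \<bar>x - y\<bar>))"
    using x by (simp add: kern_def on01_def)
  then have "(H.nrm (\<lambda>t. kern x t - kern y t))\<^sup>2 = (H.nrm (kern x))\<^sup>2 - 2 * exp (- \<bar>x - y\<bar>) + (H.nrm (kern y))\<^sup>2"
    by (simp add: H.nrm_diff_sq m)
  also have "\<dots> \<le> 1 - 2 * exp (- \<bar>x - y\<bar>) + 1"
    using nrm_kern[of x] nrm_kern[of y] x y H.nrm_nonneg[OF m(1)] H.nrm_nonneg[OF m(2)]
    by (intro add_mono diff_mono) (auto simp: power_le_one)
  also have "\<dots> \<le> 2 * \<bar>x - y\<bar>"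
    using exp_ge_add_one_self[of "- \<bar>x - y\<bar>"] by simp
  finally show ?thesis by (simp add: real_le_rsqrt)
qed

text \<open>
  \<open>\<parallel>kern x - kern y\<parallel>\<^sup>2 \<le> 2 - 2 e\<^bsup>-|x-y|\<^esup> \<le> 2 |x - y|\<close>, so elements of the space are Hoelder
  continuous with exponent \<open>1/2\<close>.
\<close>

lemma cext_continuous:
  assumes \<xi>: "\<xi> \<in> rkhs F"
  shows "continuous_on {0..1} (cext \<xi>)"
  unfolding continuous_on_def
proof
  fix x :: real assume x: "x \<in> {0..1}"
  have le: "cmod (cext \<xi> y - cext \<xi> x) \<le> sqrt (2 * \<bar>y - x\<bar>) * H.nrm \<xi>"
    if y: "y \<in> {0..1}" and d: "\<bar>y - x\<bar> < 1" for y
  proof -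
    have m: "kern x \<in> rkhs F" "kern y \<in> rkhs F" using x y by (auto intro: kern_mem)
    have "H.nrm (\<lambda>t. kern y t - kern x t) \<le> sqrt (2 * \<bar>y - x\<bar>)"
    proof -
      \<comment> \<open>Distance less than \<open>1\<close> excludes the pair of the two
        endpoints.\<close>
      consider "0 < y \<and> y < 1" | "0 < x \<and> x < 1" | "x = y" using x y d by force
      then show ?thesis
      proof cases
        case 1 then show ?thesis using nrm_kern_diff[of y x] x by simp
      next
        case 2 then show ?thesis using nrm_kern_diff[of x y] y H.nrm_minus_commute[OF m]
          by (simp add: abs_minus_commute)
      next
        case 3 then show ?thesis using H.nrm_scale[OF m(1), of 0] by simp
      qed
    qed
    moreover have "cext \<xi> y - cext \<xi> x = rkhs_inner F (\<lambda>t. kern y t - kern x t) \<xi>"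
      by (simp add: cext_def H.B_diff_left m \<xi>)
    ultimately show ?thesis
      using order_trans[OF H.Cauchy_Schwarz[OF H.diff_mem[OF m(2,1)] \<xi>] mult_right_mono[OF _ H.nrm_nonneg[OF \<xi>]]]
      by simp
  qed
  have "((\<lambda>y. cext \<xi> y - cext \<xi> x) \<longlongrightarrow> 0) (at x within {0..1})"
  proof (rule Lim_null_comparison)
    have "((\<lambda>y. sqrt (2 * \<bar>y - x\<bar>) * H.nrm \<xi>) \<longlongrightarrow> sqrt (2 * \<bar>x - x\<bar>) * H.nrm \<xi>) (at x within {0..1})"
      by (intro tendsto_intros)
    then show "((\<lambda>y. sqrt (2 * \<bar>y - x\<bar>) * H.nrm \<xi>) \<longlongrightarrow> 0) (at x within {0..1})" by simp
    show "\<forall>\<^sub>F y in at x within {0..1}. cmod (cext \<xi> y - cext \<xi> x) \<le> sqrt (2 * \<bar>y - x\<bar>) * H.nrm \<xi>"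
      unfolding eventually_at by (rule exI[of _ 1]) (auto simp: dist_norm intro!: le)
  qed
  then show "(cext \<xi> \<longlongrightarrow> cext \<xi> x) (at x within {0..1})" by (simp add: LIM_zero_iff)
qed

lemma cext_eqI:
  assumes "\<xi> \<in> rkhs F" "continuous_on {0..1} g" "\<And>x. 0 < x \<Longrightarrow> x < 1 \<Longrightarrow> \<xi> x = g x" "x \<in> {0..1}"
  shows "cext \<xi> x = g x"
  by (rule continuous_eq_on_closed01[OF cext_continuous])
     (use assms in \<open>auto simp: cext_interior\<close>)

lemma cext_kern: "x \<in> {0..1} \<Longrightarrow> y \<in> {0..1} \<Longrightarrow> cext (kern y) x = of_real (exp (- \<bar>x - y\<bar>))"
  by (rule cext_eqI[where g = "\<lambda>x. of_real (exp (- \<bar>x - y\<bar>))"])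
     (simp_all add: kern_mem continuous_intros, simp add: kern_def on01_def)

end

section \<open>Smeared kernels and weak derivatives\<close>

lemma exp_vector_derivative:
  "((\<lambda>y. complex_of_real (exp y)) has_vector_derivative of_real (exp y)) (at y within S)"
  by (intro has_vector_derivative_of_real)
     (auto simp: has_real_derivative_iff_has_vector_derivative[symmetric] intro!: derivative_eq_intros)

lemma exp_minus_vector_derivative:
  "((\<lambda>y. complex_of_real (exp (- y))) has_vector_derivative of_real (- exp (- y))) (at y within S)"
  by (intro has_vector_derivative_of_real)
     (auto simp: has_real_derivative_iff_has_vector_derivative[symmetric] intro!: derivative_eq_intros)

context exp_kernel
begin

lemma cext_ker_comb:
  assumes a: "a \<in> coeffs01" and y: "y \<in> {0..1}"
  shows "cext (ker_comb F a) y = (\<Sum>x | a x \<noteq> 0. a x * of_real (exp (- \<bar>y - x\<bar>)))"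
proof (rule cext_eqI[OF ker_comb_mem[OF a] _ _ y])
  show "continuous_on {0..1} (\<lambda>y. \<Sum>x | a x \<noteq> 0. a x * of_real (exp (- \<bar>y - x\<bar>)))"
    by (intro continuous_intros)
  fix t :: real assume t: "0 < t" "t < 1"
  have "F (t - x) = of_real (exp (- \<bar>t - x\<bar>))" if "a x \<noteq> 0" for x
  proof -
    have "x \<in> {0<..<1}" using a that by (auto simp: coeffs01_def)
    then show ?thesis using t by (intro F) auto
  qed
  then show "ker_comb F a t = (\<Sum>x | a x \<noteq> 0. a x * of_real (exp (- \<bar>t - x\<bar>)))"
    using t by (simp add: ker_comb_def on01_def)
qed

lemma smear_eq:
  assumes x: "0 < x" "x < 1"
  shows "smear F \<phi> x = integral {0..1} (\<lambda>y. \<phi> y * of_real (exp (- \<bar>x - y\<bar>)))"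
proof -
  have "smear F \<phi> x = integral {0..1} (\<lambda>y. \<phi> y * F (x - y))"
    using x by (simp add: smear_def on01_def)
  also have "\<dots> = integral {0..1} (\<lambda>y. \<phi> y * of_real (exp (- \<bar>x - y\<bar>)))"
    by (rule integral_cong) (use x in \<open>auto simp: F\<close>)
  finally show ?thesis .
qed

lemma pair_smear:
  assumes \<phi>: "continuous_on {0..1} \<phi>" and a: "a \<in> coeffs01"
  shows "pair a (smear F \<phi>) = integral {0..1} (\<lambda>y. \<phi> y * cnj (cext (ker_comb F a) y))"
proof -
  let ?S = "{x. a x \<noteq> 0}"
  have S: "finite ?S" "\<And>x. x \<in> ?S \<Longrightarrow> 0 < x \<and> x < 1" using a by (auto simp: coeffs01_def)
  have "pair a (smear F \<phi>) = (\<Sum>x\<in>?S. cnj (a x) * integral {0..1} (\<lambda>y. \<phi> y * of_real (exp (- \<bar>x - y\<bar>))))"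
    unfolding pair_def by (intro sum.cong refl) (use S smear_eq in simp)
  also have "\<dots> = integral {0..1} (\<lambda>y. \<Sum>x\<in>?S. cnj (a x) * (\<phi> y * of_real (exp (- \<bar>x - y\<bar>))))"
    by (subst integral_sum)
       (auto simp: S intro!: integrable_continuous_real continuous_intros \<phi>)
  also have "\<dots> = integral {0..1} (\<lambda>y. \<phi> y * cnj (cext (ker_comb F a) y))"
    by (rule integral_cong)
       (simp add: cext_ker_comb a sum_distrib_left abs_minus_commute algebra_simps)
  finally show ?thesis .
qed

lemma continuous_bounded01:
  fixes \<phi> :: "real \<Rightarrow> complex"
  assumes "continuous_on {0..1} \<phi>"
  obtains K where "0 \<le> K" "\<And>t. t \<in> {0..1} \<Longrightarrow> cmod (\<phi> t) \<le> K"
proof -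
  have "compact (\<phi> ` {0..1})" by (intro compact_continuous_image assms compact_Icc)
  then obtain K where K: "\<forall>z\<in>\<phi> ` {0..1}. norm z \<le> K" using compact_imp_bounded bounded_iff by metis
  show ?thesis by (rule that[of "max K 0"]) (use K in force)+
qed

lemma integral_mult_cext_bound:
  assumes \<phi>: "continuous_on {0..1} \<phi>" and K: "\<And>t. t \<in> {0..1} \<Longrightarrow> cmod (\<phi> t) \<le> K" "0 \<le> K"
    and \<xi>: "\<xi> \<in> rkhs F"
  shows "cmod (integral {0..1} (\<lambda>y. \<phi> y * cext \<xi> y)) \<le> K * H.nrm \<xi>"
proof -
  have "cmod (integral {0..1} (\<lambda>y. \<phi> y * cext \<xi> y)) \<le> (K * H.nrm \<xi>) * (1 - 0)"
  proof (rule integral_bound)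
    show "continuous_on {0..1} (\<lambda>y. \<phi> y * cext \<xi> y)"
      by (intro continuous_intros \<phi> cext_continuous \<xi>)
    show "cmod (\<phi> t * cext \<xi> t) \<le> K * H.nrm \<xi>" if "t \<in> {0..1}" for t
      unfolding norm_mult by (intro mult_mono K cext_bound \<xi> that) simp
  qed simp
  then show ?thesis by simp
qed

text \<open>
  The pairing of \<open>smear F \<phi>\<close> with a kernel combination \<open>g\<close> is the integral of \<open>\<phi>\<close> against the
  conjugate of \<open>g\<close>, and \<open>|g|\<close> is bounded by the norm of \<open>g\<close>.
\<close>

lemma smear_mem:
  assumes \<phi>: "continuous_on {0..1} \<phi>"
  shows "smear F \<phi> \<in> rkhs F"
proof -
  obtain K where K: "0 \<le> K" "\<And>t. t \<in> {0..1} \<Longrightarrow> cmod (\<phi> t) \<le> K"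
    using continuous_bounded01[OF \<phi>] by blast
  have "cmod (pair a (smear F \<phi>)) \<le> K * span.nrm a" if a: "a \<in> coeffs01" for a
  proof -
    have "cnj (pair a (smear F \<phi>)) = integral {0..1} (\<lambda>y. cnj (\<phi> y) * cext (ker_comb F a) y)"
      unfolding pair_smear[OF \<phi> a] by (simp add: integral_cnj)
    moreover have "cmod (integral {0..1} (\<lambda>y. cnj (\<phi> y) * cext (ker_comb F a) y)) \<le> K * H.nrm (ker_comb F a)"
      by (rule integral_mult_cext_bound) (use K \<phi> a in \<open>auto intro!: continuous_intros ker_comb_mem\<close>)
    ultimately show ?thesis by (metis complex_mod_cnj nrm_ker_comb[OF a])
  qed
  then show ?thesis by (rule rkhs_criterion(1)[rotated]) (auto simp: smear_def on01_def)
qed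

text \<open>
  \<open>smear F \<phi>\<close> is the integral of \<open>\<phi>(y) kern y\<close> over \<open>y\<close>. The formula is a finite sum over
  kernels when \<open>\<xi>\<close> is a kernel combination, and both sides are continuous in \<open>\<xi>\<close>.
\<close>

lemma inner_smear:
  assumes \<phi>: "continuous_on {0..1} \<phi>" and \<xi>: "\<xi> \<in> rkhs F"
  shows "rkhs_inner F (smear F \<phi>) \<xi> = integral {0..1} (\<lambda>y. cnj (\<phi> y) * cext \<xi> y)"
proof -
  define I where "I = (\<lambda>\<xi>. integral {0..1} (\<lambda>y. cnj (\<phi> y) * cext \<xi> y))"
  obtain K where K: "0 \<le> K" "\<And>t. t \<in> {0..1} \<Longrightarrow> cmod (\<phi> t) \<le> K"
    using continuous_bounded01[OF \<phi>] by blast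
  obtain a where r: "rkhs_repr F a \<xi>" using \<xi> by (auto simp: rkhs_def)
  have a: "\<And>n. a n \<in> coeffs01" using r by (simp add: repr_iff)
  have sm: "smear F \<phi> \<in> rkhs F" by (rule smear_mem[OF \<phi>])
  define \<xi>n where "\<xi>n = (\<lambda>n. ker_comb F (a n))"
  have \<xi>n: "\<xi>n n \<in> rkhs F" for n by (simp add: \<xi>n_def ker_comb_mem a)
  have null: "(\<lambda>n. H.nrm (\<lambda>t. \<xi>n n t - \<xi> t)) \<longlonglongrightarrow> 0"
    unfolding \<xi>n_def by (rule repr_tendsto[OF r])
  have eq: "rkhs_inner F (smear F \<phi>) (\<xi>n n) = I (\<xi>n n)" for n
  proof -
    have "rkhs_inner F (smear F \<phi>) (\<xi>n n) = cnj (pair (a n) (smear F \<phi>))"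
      by (subst H.B_herm[OF \<xi>n sm]) (simp add: \<xi>n_def inner_ker_comb a sm)
    then show ?thesis unfolding pair_smear[OF \<phi> a] I_def \<xi>n_def by (simp add: integral_cnj)
  qed
  have "(\<lambda>n. I (\<xi>n n) - I \<xi>) \<longlonglongrightarrow> 0"
  proof (rule Lim_null_comparison)
    show "(\<lambda>n. K * H.nrm (\<lambda>t. \<xi>n n t - \<xi> t)) \<longlonglongrightarrow> 0" using tendsto_mult_left[OF null, of K] by simp
    have "cmod (I (\<xi>n n) - I \<xi>) \<le> K * H.nrm (\<lambda>t. \<xi>n n t - \<xi> t)" for n
    proof -
      have "I (\<xi>n n) - I \<xi> = integral {0..1} (\<lambda>y. cnj (\<phi> y) * cext (\<xi>n n) y - cnj (\<phi> y) * cext \<xi> y)"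
        unfolding I_def
        by (rule integral_diff[symmetric])
           (intro integrable_continuous_real continuous_intros \<phi> cext_continuous \<xi>n \<xi>)+
      also have "\<dots> = integral {0..1} (\<lambda>y. cnj (\<phi> y) * cext (\<lambda>t. \<xi>n n t - \<xi> t) y)"
        by (rule integral_cong) (simp add: cext_diff \<xi> \<xi>n algebra_simps)
      finally show ?thesis
        using integral_mult_cext_bound[of "\<lambda>y. cnj (\<phi> y)" K "\<lambda>t. \<xi>n n t - \<xi> t"] K \<phi>
        by (simp add: H.diff_mem \<xi> \<xi>n continuous_intros)
    qed
    then show "\<forall>\<^sub>F n in sequentially. cmod (I (\<xi>n n) - I \<xi>) \<le> K * H.nrm (\<lambda>t. \<xi>n n t - \<xi> t)" by simp
  qed
  then have "(\<lambda>n. I (\<xi>n n)) \<longlonglongrightarrow> I \<xi>" by (simp add: LIM_zero_iff)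
  moreover have "(\<lambda>n. I (\<xi>n n)) \<longlonglongrightarrow> rkhs_inner F (smear F \<phi>) \<xi>"
    unfolding eq[symmetric] by (rule H.B_tendsto[OF \<xi>n \<xi> sm null])
  ultimately have "rkhs_inner F (smear F \<phi>) \<xi> = I \<xi>" by (rule LIMSEQ_unique[rotated])
  then show ?thesis by (simp only: I_def)
qed

lemma cext_smear:
  assumes \<phi>: "continuous_on {0..1} \<phi>" and x: "x \<in> {0..1}"
  shows "cext (smear F \<phi>) x = integral {0..1} (\<lambda>y. \<phi> y * of_real (exp (- \<bar>x - y\<bar>)))"
proof -
  have "cext (smear F \<phi>) x = cnj (rkhs_inner F (smear F \<phi>) (kern x))"
    unfolding cext_def by (rule H.B_herm[OF smear_mem[OF \<phi>] kern_mem[OF x]])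
  also have "\<dots> = integral {0..1} (\<lambda>y. \<phi> y * cnj (cext (kern x) y))"
    unfolding inner_smear[OF \<phi> kern_mem[OF x]] by (simp add: integral_cnj)
  also have "\<dots> = integral {0..1} (\<lambda>y. \<phi> y * of_real (exp (- \<bar>x - y\<bar>)))"
    by (rule integral_cong) (use x in \<open>simp add: cext_kern abs_minus_commute\<close>)
  finally show ?thesis .
qed

lemma cext_smear_split:
  assumes \<phi>: "continuous_on {0..1} \<phi>" and x: "x \<in> {0..1}"
  shows "cext (smear F \<phi>) x =
    of_real (exp (- x)) * integral {0..x} (\<lambda>y. of_real (exp y) * \<phi> y) +
    of_real (exp x) * integral {x..1} (\<lambda>y. of_real (exp (- y)) * \<phi> y)"
proof -
  let ?g = "\<lambda>y. \<phi> y * of_real (exp (- \<bar>x - y\<bar>))"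
  have "integral {0..1} ?g = integral {0..x} ?g + integral {x..1} ?g"
    using x by (intro Henstock_Kurzweil_Integration.integral_combine[symmetric] integrable_continuous_real continuous_intros \<phi>) auto
  also have "integral {0..x} ?g = integral {0..x} (\<lambda>y. of_real (exp (- x)) * (of_real (exp y) * \<phi> y))"
    by (rule integral_cong) (auto simp: exp_add[symmetric] of_real_mult[symmetric] mult.assoc[symmetric] simp del: of_real_mult)
  also have "integral {x..1} ?g = integral {x..1} (\<lambda>y. of_real (exp x) * (of_real (exp (- y)) * \<phi> y))"
    by (rule integral_cong) (auto simp: exp_add[symmetric] of_real_mult[symmetric] mult.assoc[symmetric] simp del: of_real_mult)
  finally show ?thesis using cext_smear[OF \<phi> x] by simp
qed

text \<open>
  The relation \<open>\<eta> = \<xi>'\<close>, stated with an integral so that it survives uniform limits.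
\<close>

definition deriv_pair :: "(real \<Rightarrow> complex) \<Rightarrow> (real \<Rightarrow> complex) \<Rightarrow> bool" where
  "deriv_pair \<xi> \<eta> \<longleftrightarrow> \<xi> \<in> rkhs F \<and> \<eta> \<in> rkhs F \<and>
     (\<forall>x\<in>{0..1}. cext \<xi> x = cext \<xi> 0 + integral {0..x} (cext \<eta>))"

lemma vderiv_eqI: "(f has_vector_derivative f') (at x) \<Longrightarrow> vderiv f x = f'"
  by (simp add: vderiv_def vector_derivative_at)

lemma test_fun_derivative:
  assumes \<phi>: "\<phi> \<in> test_funs01"
  shows "(\<phi> has_vector_derivative vderiv \<phi> x) (at x)"
proof -
  have "(vderiv ^^ 0) \<phi> differentiable_on UNIV" using \<phi> unfolding test_funs01_def by blast
  then show ?thesis by (simp add: differentiable_on_def vderiv_def vector_derivative_works)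
qed

lemma test_fun_continuous: "\<phi> \<in> test_funs01 \<Longrightarrow> continuous_on S \<phi>"
  by (intro continuous_at_imp_continuous_on ballI has_vector_derivative_continuous[OF test_fun_derivative])

lemma test_fun_vderiv_continuous:
  assumes "\<phi> \<in> test_funs01" shows "continuous_on S (vderiv \<phi>)"
proof -
  have "(vderiv ^^ 1) \<phi> differentiable_on UNIV" using assms unfolding test_funs01_def by blast
  then have "continuous_on UNIV (vderiv \<phi>)" by (simp add: differentiable_imp_continuous_on)
  then show ?thesis by (rule continuous_on_subset) simp
qed

lemma test_fun_vanish: "\<phi> \<in> test_funs01 \<Longrightarrow> x \<le> 0 \<or> 1 \<le> x \<Longrightarrow> \<phi> x = 0"
proof -
  assume "\<phi> \<in> test_funs01" and x: "x \<le> 0 \<or> 1 \<le> x"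
  then have "closure {x. \<phi> x \<noteq> 0} \<subseteq> {0<..<1}" by (simp add: test_funs01_def)
  then have "{x. \<phi> x \<noteq> 0} \<subseteq> {0<..<1}" using closure_subset by (rule order_trans[rotated])
  then show ?thesis using x by auto
qed

text \<open>
  By \<open>cext_smear_split\<close> the smeared kernel is \<open>e\<^bsup>-x\<^esup> A(x) + e\<^bsup>x\<^esup> B(x)\<close> with \<open>A\<close> vanishing at \<open>0\<close> and
  \<open>B\<close> at \<open>1\<close>; its derivative is \<open>-e\<^bsup>-x\<^esup> A(x) + e\<^bsup>x\<^esup> B(x)\<close>, which is also the smearing of \<open>\<phi>'\<close> after an
  integration by parts. The boundary relations can be read off: \<open>f' = f\<close> at \<open>0\<close> and
  \<open>f' = -f\<close> at \<open>1\<close>.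
\<close>

lemma deriv_pair_smear:
  assumes \<phi>: "\<phi> \<in> test_funs01"
  shows "deriv_pair (smear F \<phi>) (smear F (vderiv \<phi>))"
    and "cext (smear F (vderiv \<phi>)) 0 = cext (smear F \<phi>) 0"
    and "cext (smear F (vderiv \<phi>)) 1 = - cext (smear F \<phi>) 1"
proof -
  have c: "continuous_on {0..1} \<phi>" and c': "continuous_on {0..1} (vderiv \<phi>)"
    using \<phi> by (auto intro: test_fun_continuous test_fun_vderiv_continuous)
  define A where "A = (\<lambda>x. integral {0..x} (\<lambda>y. of_real (exp y) * \<phi> y))"
  define B where "B = (\<lambda>x. integral {x..1} (\<lambda>y. of_real (exp (- y)) * \<phi> y))"
  have s: "cext (smear F \<phi>) x = of_real (exp (- x)) * A x + of_real (exp x) * B x" if "x \<in> {0..1}" for x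
    unfolding A_def B_def by (rule cext_smear_split[OF c that])
  have s': "cext (smear F (vderiv \<phi>)) x = - of_real (exp (- x)) * A x + of_real (exp x) * B x"
    if x: "x \<in> {0..1}" for x
  proof -
    have "((\<lambda>y. of_real (exp y) * vderiv \<phi> y + of_real (exp y) * \<phi> y) has_integral
        of_real (exp x) * \<phi> x - of_real (exp 0) * \<phi> 0) {0..x}"
    proof (rule fundamental_theorem_of_calculus)
      fix y :: real
      have "((\<lambda>y. complex_of_real (exp y) * \<phi> y) has_vector_derivative
         (of_real (exp y) * vderiv \<phi> y + of_real (exp y) * \<phi> y)) (at y)"
        by (intro has_vector_derivative_mult exp_vector_derivative exp_minus_vector_derivative test_fun_derivative \<phi>)
      then show "((\<lambda>y. complex_of_real (exp y) * \<phi> y) has_vector_derivative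
         (of_real (exp y) * vderiv \<phi> y + of_real (exp y) * \<phi> y)) (at y within {0..x})"
        by (rule has_vector_derivative_at_within)
    qed (use x in auto)
    moreover have "(\<lambda>y. of_real (exp y) * \<phi> y) integrable_on {0..x}"
      using x by (intro integrable_continuous_real continuous_intros continuous_on_subset[OF c]) auto
    ultimately have "((\<lambda>y. of_real (exp y) * vderiv \<phi> y + of_real (exp y) * \<phi> y - of_real (exp y) * \<phi> y)
        has_integral of_real (exp x) * \<phi> x - of_real (exp 0) * \<phi> 0 - A x) {0..x}"
      unfolding A_def by (intro has_integral_diff integrable_integral)
    then have 1: "integral {0..x} (\<lambda>y. of_real (exp y) * vderiv \<phi> y) = of_real (exp x) * \<phi> x - A x"
      using test_fun_vanish[OF \<phi>, of 0] by (simp add: integral_unique)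
    have "((\<lambda>y. of_real (exp (- y)) * vderiv \<phi> y - of_real (exp (- y)) * \<phi> y) has_integral
        of_real (exp (- 1)) * \<phi> 1 - of_real (exp (- x)) * \<phi> x) {x..1}"
    proof (rule fundamental_theorem_of_calculus)
      fix y :: real
      have "((\<lambda>y. complex_of_real (exp (- y)) * \<phi> y) has_vector_derivative
         (of_real (exp (- y)) * vderiv \<phi> y + of_real (- exp (- y)) * \<phi> y)) (at y)"
        by (intro has_vector_derivative_mult exp_vector_derivative exp_minus_vector_derivative test_fun_derivative \<phi>)
      then show "((\<lambda>y. complex_of_real (exp (- y)) * \<phi> y) has_vector_derivative
         (of_real (exp (- y)) * vderiv \<phi> y - of_real (exp (- y)) * \<phi> y)) (at y within {x..1})"
        by (rule has_vector_derivative_at_within[OF has_vector_derivative_eq_rhs]) simp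
    qed (use x in auto)
    moreover have "(\<lambda>y. of_real (exp (- y)) * \<phi> y) integrable_on {x..1}"
      using x by (intro integrable_continuous_real continuous_intros continuous_on_subset[OF c]) auto
    ultimately have "((\<lambda>y. of_real (exp (- y)) * vderiv \<phi> y - of_real (exp (- y)) * \<phi> y + of_real (exp (- y)) * \<phi> y)
        has_integral of_real (exp (- 1)) * \<phi> 1 - of_real (exp (- x)) * \<phi> x + B x) {x..1}"
      unfolding B_def by (intro has_integral_add integrable_integral)
    then have 2: "integral {x..1} (\<lambda>y. of_real (exp (- y)) * vderiv \<phi> y) = - of_real (exp (- x)) * \<phi> x + B x"
      using test_fun_vanish[OF \<phi>, of 1] by (simp add: integral_unique)
    show ?thesis
      unfolding cext_smear_split[OF c' x] 1 2 by (simp add: algebra_simps)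
  qed
  show "cext (smear F (vderiv \<phi>)) 0 = cext (smear F \<phi>) 0" by (simp add: s s' A_def)
  show "cext (smear F (vderiv \<phi>)) 1 = - cext (smear F \<phi>) 1" by (simp add: s s' B_def)
  have "cext (smear F \<phi>) x = cext (smear F \<phi>) 0 + integral {0..x} (cext (smear F (vderiv \<phi>)))"
    if x: "x \<in> {0..1}" for x
  proof -
    have "(cext (smear F (vderiv \<phi>)) has_integral cext (smear F \<phi>) x - cext (smear F \<phi>) 0) {0..x}"
    proof (rule fundamental_theorem_of_calculus)
      fix y assume "y \<in> {0..x}"
      then have y: "y \<in> {0..1}" using x by auto
      have dA: "(A has_vector_derivative of_real (exp y) * \<phi> y) (at y within {0..1})"
        unfolding A_def by (rule integral_has_vector_derivative) (use y in \<open>auto intro!: continuous_intros c\<close>)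
      have dB: "(B has_vector_derivative - (of_real (exp (- y)) * \<phi> y)) (at y within {0..1})"
        unfolding B_def by (rule integral_has_vector_derivative') (use y in \<open>auto intro!: continuous_intros c\<close>)
      have "((\<lambda>x. of_real (exp (- x)) * A x + of_real (exp x) * B x) has_vector_derivative
          (of_real (exp (- y)) * (of_real (exp y) * \<phi> y) + of_real (- exp (- y)) * A y) +
          (of_real (exp y) * (- (of_real (exp (- y)) * \<phi> y)) + of_real (exp y) * B y)) (at y within {0..1})"
        by (intro has_vector_derivative_add has_vector_derivative_mult dA dB exp_vector_derivative exp_minus_vector_derivative)
      then have "((\<lambda>x. of_real (exp (- x)) * A x + of_real (exp x) * B x) has_vector_derivative
          cext (smear F (vderiv \<phi>)) y) (at y within {0..1})"
        by (rule has_vector_derivative_eq_rhs) (simp add: s'[OF y] algebra_simps)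
      from has_vector_derivative_transform[OF y s this]
      have "(cext (smear F \<phi>) has_vector_derivative cext (smear F (vderiv \<phi>)) y) (at y within {0..1})" .
      then show "(cext (smear F \<phi>) has_vector_derivative cext (smear F (vderiv \<phi>)) y) (at y within {0..x})"
        by (rule has_vector_derivative_within_subset) (use x in auto)
    qed (use x in auto)
    then show ?thesis by (simp add: integral_unique)
  qed
  then show "deriv_pair (smear F \<phi>) (smear F (vderiv \<phi>))"
    unfolding deriv_pair_def using smear_mem[OF c] smear_mem[OF c'] by blast
qed

end

section \<open>Bump functions and the lemma of du Bois-Reymond\<close>

text \<open>
  For \<open>p = 1\<close> this is the standard smooth function that is flat at \<open>0\<close>. With an arbitrary
  polynomial in \<open>1/t\<close> as a factor the family is closed under differentiation.
\<close>

definition flat_exp :: "real poly \<Rightarrow> real \<Rightarrow> real" where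
  "flat_exp p t = (if 0 < t then poly p (1 / t) * exp (- (1 / t)) else 0)"

lemma poly_exp_tendsto_0: "((\<lambda>y. poly p y * exp (- y)) \<longlongrightarrow> 0) at_top" for p :: "real poly"
proof -
  have "((\<lambda>y. \<Sum>i\<le>degree p. coeff p i * (y ^ i / exp y)) \<longlongrightarrow> (\<Sum>i\<le>degree p. coeff p i * 0)) at_top"
    by (intro tendsto_intros tendsto_power_div_exp_0)
  then show ?thesis
    by (simp add: poly_altdef sum_distrib_right exp_minus divide_inverse mult.assoc)
qed

lemma flat_exp_derivative:
  "(flat_exp p has_real_derivative flat_exp ([:0, 0, 1:] * (p - pderiv p)) t) (at t)"
proof -
  consider "0 < t" | "t < 0" | "t = 0" by linarith
  then show ?thesis
  proof cases
    case 1
    have "((\<lambda>t. poly p (1 / t) * exp (- (1 / t))) has_real_derivative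
        flat_exp ([:0, 0, 1:] * (p - pderiv p)) t) (at t)"
      using 1
      by (auto intro!: derivative_eq_intros DERIV_chain'[OF _ poly_DERIV]
          simp: flat_exp_def field_simps power2_eq_square)
    then show ?thesis
      by (rule has_field_derivative_transform_within_open[where S = "{0<..}"])
         (use 1 in \<open>auto simp: flat_exp_def\<close>)
  next
    case 2
    have "((\<lambda>t. 0) has_real_derivative flat_exp ([:0, 0, 1:] * (p - pderiv p)) t) (at t)"
      using 2 by (simp add: flat_exp_def)
    then show ?thesis
      by (rule has_field_derivative_transform_within_open[where S = "{..<0}"])
         (use 2 in \<open>auto simp: flat_exp_def\<close>)
  next
    case 3
    have "((\<lambda>y. poly (pCons 0 p) y * exp (- y)) \<longlongrightarrow> 0) at_top" by (rule poly_exp_tendsto_0)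
    then have "((\<lambda>h. poly (pCons 0 p) (1 / h) * exp (- (1 / h))) \<longlongrightarrow> 0) (at_right 0)"
      by (rule filterlim_compose) (simp add: divide_inverse filterlim_inverse_at_top_right)
    moreover have "\<forall>\<^sub>F h in at_right 0. poly (pCons 0 p) (1 / h) * exp (- (1 / h)) = (flat_exp p (0 + h) - flat_exp p 0) / h"
      using eventually_at_right_less[of 0] by eventually_elim (simp add: flat_exp_def)
    ultimately have R: "((\<lambda>h. (flat_exp p (0 + h) - flat_exp p 0) / h) \<longlongrightarrow> 0) (at_right 0)"
      by (rule Lim_transform_eventually)
    have "\<forall>\<^sub>F h in at_left (0::real). (flat_exp p (0 + h) - flat_exp p 0) / h = 0"
      by (rule eventually_at_leftI[of "-1"]) (auto simp: flat_exp_def)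
    then have L: "((\<lambda>h. (flat_exp p (0 + h) - flat_exp p 0) / h) \<longlongrightarrow> 0) (at_left 0)"
      by (rule tendsto_eventually)
    have "(flat_exp p has_real_derivative 0) (at 0)"
      unfolding DERIV_def using filterlim_split_at[OF L R] .
    then show ?thesis using 3 by (simp add: flat_exp_def)
  qed
qed

text \<open>
  An algebra of functions that is closed under differentiation; its members are therefore
  infinitely differentiable, without a separate treatment of higher derivatives of products.
\<close>

inductive_set smooth_alg :: "(real \<Rightarrow> complex) set" where
  base: "(\<lambda>t. of_real (flat_exp p (c * (t - a)))) \<in> smooth_alg"
| add: "f \<in> smooth_alg \<Longrightarrow> g \<in> smooth_alg \<Longrightarrow> (\<lambda>t. f t + g t) \<in> smooth_alg"
| mult: "f \<in> smooth_alg \<Longrightarrow> g \<in> smooth_alg \<Longrightarrow> (\<lambda>t. f t * g t) \<in> smooth_alg"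

lemma smooth_alg_derivative:
  "f \<in> smooth_alg \<Longrightarrow> \<exists>f'\<in>smooth_alg. \<forall>t. (f has_vector_derivative f' t) (at t)"
proof (induction rule: smooth_alg.induct)
  case (base p c a)
  define q where "q = smult c ([:0, 0, 1:] * (p - pderiv p))"
  have "((\<lambda>t. flat_exp p (c * (t - a))) has_real_derivative flat_exp q (c * (t - a))) (at t)" for t
  proof -
    have "((\<lambda>t. c * (t - a)) has_real_derivative c) (at t)" by (auto intro!: derivative_eq_intros)
    from DERIV_chain2[OF flat_exp_derivative this]
    show ?thesis by (rule DERIV_cong) (simp add: q_def flat_exp_def algebra_simps)
  qed
  then have "\<forall>t. ((\<lambda>t. complex_of_real (flat_exp p (c * (t - a)))) has_vector_derivative
      of_real (flat_exp q (c * (t - a)))) (at t)"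
    by (intro allI has_vector_derivative_of_real)
  then show ?case using smooth_alg.base by (intro bexI)
next
  case (add f g)
  then obtain f' g' where "f' \<in> smooth_alg" "g' \<in> smooth_alg"
    "\<And>t. (f has_vector_derivative f' t) (at t)" "\<And>t. (g has_vector_derivative g' t) (at t)" by blast
  then show ?case
    by (intro bexI[of _ "\<lambda>t. f' t + g' t"]) (auto intro: smooth_alg.add has_vector_derivative_add)
next
  case (mult f g)
  then obtain f' g' where *: "f' \<in> smooth_alg" "g' \<in> smooth_alg"
    "\<And>t. (f has_vector_derivative f' t) (at t)" "\<And>t. (g has_vector_derivative g' t) (at t)" by blast
  have "((\<lambda>t. f t * g t) has_vector_derivative f t * g' t + f' t * g t) (at t)" for t
    by (rule has_vector_derivative_mult[OF *(3,4)])
  moreover have "(\<lambda>t. f t * g' t + f' t * g t) \<in> smooth_alg"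
    by (intro smooth_alg.add smooth_alg.mult mult.hyps *)
  ultimately show ?case by (intro bexI[of _ "\<lambda>t. f t * g' t + f' t * g t"]) auto
qed

lemma smooth_alg_vderiv_pow: "f \<in> smooth_alg \<Longrightarrow> (vderiv ^^ k) f \<in> smooth_alg"
proof (induction k)
  case (Suc k)
  then obtain f' where f': "f' \<in> smooth_alg" "\<And>t. ((vderiv ^^ k) f has_vector_derivative f' t) (at t)"
    using smooth_alg_derivative by blast
  then have "vderiv ((vderiv ^^ k) f) = f'"
    by (auto simp: vderiv_def fun_eq_iff vector_derivative_at)
  then show ?case using f' by simp
qed simp

lemma smooth_alg_differentiable: "f \<in> smooth_alg \<Longrightarrow> (vderiv ^^ k) f differentiable_on UNIV"
  using smooth_alg_derivative[OF smooth_alg_vderiv_pow, of f k]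
  by (force simp: differentiable_on_def has_vector_derivative_def differentiable_def)

lemma smooth_alg_continuous: "f \<in> smooth_alg \<Longrightarrow> continuous_on S f"
  using smooth_alg_differentiable[of f 0] continuous_on_subset[OF differentiable_imp_continuous_on]
  by force

definition bump :: "real \<Rightarrow> real \<Rightarrow> real" where
  "bump e t = flat_exp 1 (t + e) * flat_exp 1 (e - t)"

lemma bump_nonneg: "0 \<le> bump e t"
  by (simp add: bump_def flat_exp_def)

lemma bump_pos_iff: "bump e t \<noteq> 0 \<longleftrightarrow> \<bar>t\<bar> < e"
  by (auto simp: bump_def flat_exp_def)

lemma bump_smooth: "(\<lambda>t. of_real (bump e (t - s))) \<in> smooth_alg"
proof -
  have "(\<lambda>t. of_real (flat_exp 1 (1 * (t - (s - e)))) * of_real (flat_exp 1 (-1 * (t - (s + e))))) \<in> smooth_alg"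
    by (intro smooth_alg.mult smooth_alg.base)
  then show ?thesis by (simp add: bump_def algebra_simps)
qed

lemma bump_diff_smooth: "(\<lambda>t. of_real (bump e (t - s1) - bump e (t - s2))) \<in> smooth_alg"
proof -
  \<comment> \<open>The algebra contains the negative of a bump because the constant polynomial
    \<open>-1\<close> is admitted in \<open>flat_exp\<close>.\<close>
  have "(\<lambda>t. of_real (flat_exp [:-1:] (1 * (t - (s2 - e)))) * of_real (flat_exp 1 (-1 * (t - (s2 + e))))) \<in> smooth_alg"
    by (intro smooth_alg.mult smooth_alg.base)
  from smooth_alg.add[OF bump_smooth[of e s1] this]
  moreover have "flat_exp [:-1:] t = - flat_exp 1 t" for t by (simp add: flat_exp_def)
  ultimately show ?thesis by (simp add: bump_def algebra_simps)
qed

lemma bump_continuous: "continuous_on S (\<lambda>t. bump e (t - s))"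
  using continuous_on_Re[OF smooth_alg_continuous[OF bump_smooth[of e s]]] by simp

definition bump_mass :: "real \<Rightarrow> real" where
  "bump_mass e = integral {-e..e} (bump e)"

lemma bump_has_integral:
  assumes "a \<le> s - e" "s + e \<le> b"
  shows "((\<lambda>t. bump e (t - s)) has_integral bump_mass e) {a..b}"
proof -
  have "(bump e has_integral bump_mass e) {-e..e}"
    unfolding bump_mass_def
    using bump_continuous[of "{-e..e}" e 0] by (intro integrable_integral integrable_continuous_real) simp
  then have "((\<lambda>t. bump e (t - s)) has_integral bump_mass e) {-e + s..e + s}"
    by (subst has_integral_shift_Icc_real[symmetric]) (simp add: o_def)
  then show ?thesis
  proof (rule has_integral_on_superset)
    fix t assume "t \<notin> {-e + s..e + s}"
    then have "\<not> \<bar>t - s\<bar> < e" by auto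
    then show "bump e (t - s) = 0" using bump_pos_iff by blast
  qed (use assms in auto)
qed

lemma bump_mass_pos:
  assumes "0 < e" shows "0 < bump_mass e"
proof -
  have "bump_mass e \<noteq> 0"
  proof
    assume "bump_mass e = 0"
    then have "(bump e has_integral 0) (cbox (-e) e)"
      using bump_has_integral[of "-e" 0 e e] by simp
    then have "bump e 0 = 0"
      using bump_continuous[of "{-e..e}" e 0] assms bump_nonneg
      by (intro has_integral_0_cbox_imp_0[of "-e" e "bump e"]) auto
    then show False using bump_pos_iff[of e 0] assms by simp
  qed
  moreover have "0 \<le> bump_mass e"
    by (rule has_integral_nonneg[OF bump_has_integral[of "-e" 0 e e]]) (simp_all add: bump_nonneg)
  ultimately show ?thesis by simp
qed

text \<open>
  Two translates of a bump have the same mass, so the primitive of their difference vanishes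
  on both sides of their supports and is a test function.
\<close>

lemma bump_primitive:
  assumes s: "0 < s1 - e" "s1 + e < 1" "0 < s2 - e" "s2 + e < 1" and e: "0 < e"
  obtains \<phi> where "\<phi> \<in> test_funs01" "vderiv \<phi> = (\<lambda>t. of_real (bump e (t - s1) - bump e (t - s2)))"
proof -
  define g :: "real \<Rightarrow> complex" where "g = (\<lambda>t. of_real (bump e (t - s1) - bump e (t - s2)))"
  define l where "l = min (s1 - e) (s2 - e)"
  define r where "r = max (s1 + e) (s2 + e)"
  have lr: "0 < l" "l \<le> r" "r < 1" using s e by (auto simp: l_def r_def)
  have gs: "g \<in> smooth_alg" unfolding g_def by (rule bump_diff_smooth)
  have g0: "g t = 0" if "t \<notin> {l..r}" for t
  proof -
    have "\<not> \<bar>t - s1\<bar> < e" "\<not> \<bar>t - s2\<bar> < e" using that by (auto simp: l_def r_def)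
    then have "bump e (t - s1) = 0" "bump e (t - s2) = 0" using bump_pos_iff by blast+
    then show ?thesis by (simp add: g_def)
  qed
  define \<phi> where "\<phi> = (\<lambda>t. integral {0..t} g)"
  have left: "\<phi> t = 0" if "t < l" for t
  proof -
    have "integral {0..t} g = integral {0..t} (\<lambda>_. 0)"
      by (rule integral_cong) (use that g0 in auto)
    then show ?thesis by (simp add: \<phi>_def)
  qed
  have right: "\<phi> t = 0" if t: "r < t" for t
  proof -
    have "((\<lambda>t. bump e (t - s1) - bump e (t - s2)) has_integral bump_mass e - bump_mass e) {0..t}"
      by (intro has_integral_diff bump_has_integral) (use t s in \<open>auto simp: r_def\<close>)
    from has_integral_of_real[OF this, where ?'b = complex] have "(g has_integral 0) {0..t}"
      unfolding g_def by simp
    then show ?thesis by (simp add: \<phi>_def integral_unique)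
  qed
  have deriv: "(\<phi> has_vector_derivative g t) (at t)" for t
  proof (cases "t < l")
    case True
    have "((\<lambda>t. 0) has_vector_derivative g t) (at t)" using g0[of t] True by simp
    then show ?thesis
      by (rule has_vector_derivative_transform_within_open[where S = "{..<l}"]) (use True left in auto)
  next
    case False
    then have t: "0 < t" using lr by simp
    have "(\<phi> has_vector_derivative g t) (at t within {0..t + 1})"
      unfolding \<phi>_def by (rule integral_has_vector_derivative) (use t smooth_alg_continuous[OF gs] in auto)
    then show ?thesis using at_within_Icc_at[of 0 t "t + 1"] t by simp
  qed
  have vd: "vderiv \<phi> = g" using deriv by (auto simp: vderiv_def fun_eq_iff vector_derivative_at)
  have "(vderiv ^^ k) \<phi> differentiable_on UNIV" for k
  proof (cases k)
    case 0
    then show ?thesis using deriv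
      by (auto simp: differentiable_on_def has_vector_derivative_def differentiable_def)
  next
    case (Suc j)
    then show ?thesis using smooth_alg_differentiable[OF gs, of j] by (simp add: funpow_swap1 vd)
  qed
  moreover have "closure {t. \<phi> t \<noteq> 0} \<subseteq> {l..r}"
    by (rule closure_minimal) (use left right in \<open>auto simp: not_less[symmetric]\<close>)
  moreover have "{l..r} \<subseteq> {0<..<1}" using lr by auto
  ultimately have "\<phi> \<in> test_funs01" unfolding test_funs01_def by blast
  then show ?thesis using that vd by (simp add: g_def)
qed

text \<open>
  Testing with the primitive of the difference of two bumps, which concentrate at \<open>s1\<close> and
  \<open>s2\<close>, compares local averages of \<open>u\<close> near these points.
\<close>

lemma du_Bois_Reymond:
  fixes u :: "real \<Rightarrow> complex"
  assumes u: "continuous_on {0..1} u"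
    and orth: "\<And>\<phi>. \<phi> \<in> test_funs01 \<Longrightarrow> integral {0..1} (\<lambda>t. cnj (vderiv \<phi> t) * u t) = 0"
    and s: "0 < s1" "s1 < 1" "0 < s2" "s2 < 1"
  shows "u s1 = u s2"
proof (rule ccontr)
  assume "u s1 \<noteq> u s2"
  define \<eta> where "\<eta> = cmod (u s1 - u s2) / 3"
  have \<eta>: "0 < \<eta>" using \<open>u s1 \<noteq> u s2\<close> by (simp add: \<eta>_def)
  have near: "\<exists>d>0. \<forall>t\<in>{0..1}. \<bar>t - s\<bar> < d \<longrightarrow> cmod (u t - u s) \<le> \<eta>" if "0 < s" "s < 1" for s
  proof -
    have "s \<in> {0..1}" using that by simp
    then obtain d where "0 < d" "\<forall>t\<in>{0..1}. dist t s < d \<longrightarrow> dist (u t) (u s) < \<eta>"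
      using u \<eta> unfolding continuous_on_iff by blast
    then show ?thesis by (intro exI[of _ d]) (auto simp: dist_norm intro: less_imp_le)
  qed
  obtain d1 d2 where d: "0 < d1" "\<forall>t\<in>{0..1}. \<bar>t - s1\<bar> < d1 \<longrightarrow> cmod (u t - u s1) \<le> \<eta>"
    "0 < d2" "\<forall>t\<in>{0..1}. \<bar>t - s2\<bar> < d2 \<longrightarrow> cmod (u t - u s2) \<le> \<eta>"
    using near[OF s(1,2)] near[OF s(3,4)] by blast
  \<comment> \<open>Small enough for \<open>u\<close> to be nearly constant on the supports of both
    bumps, and for these to stay inside \<open>(0,1)\<close>.\<close>
  define e where "e = Min {d1, d2, s1 / 2, s2 / 2, (1 - s1) / 2, (1 - s2) / 2}"
  have "0 < e" using d(1,3) s unfolding e_def by simp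
  moreover have "e \<le> d1" "e \<le> d2" "e \<le> s1 / 2" "e \<le> s2 / 2" "e \<le> (1 - s1) / 2" "e \<le> (1 - s2) / 2"
    unfolding e_def by (rule Min_le; simp)+
  ultimately have e: "0 < e" "e \<le> d1" "e \<le> d2" "e \<le> s1 / 2" "e \<le> s2 / 2" "e \<le> (1 - s1) / 2" "e \<le> (1 - s2) / 2"
    by simp_all
  obtain \<phi> where \<phi>: "\<phi> \<in> test_funs01" "vderiv \<phi> = (\<lambda>t. of_real (bump e (t - s1) - bump e (t - s2)))"
    by (rule bump_primitive[of s1 e s2]) (use e s in auto)
  have local_mean: "\<exists>i. ((\<lambda>t. of_real (bump e (t - s)) * u t) has_integral of_real (bump_mass e) * u s + i) {0..1} \<and>
      cmod i \<le> bump_mass e * \<eta>"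
    if s: "0 < s - e" "s + e < 1" and near: "\<forall>t\<in>{0..1}. \<bar>t - s\<bar> < e \<longrightarrow> cmod (u t - u s) \<le> \<eta>" for s
  proof -
    have m: "((\<lambda>t. bump e (t - s)) has_integral bump_mass e) {0..1}"
      by (rule bump_has_integral) (use s in auto)
    define i where "i = integral {0..1} (\<lambda>t. of_real (bump e (t - s)) * (u t - u s))"
    have i: "((\<lambda>t. of_real (bump e (t - s)) * (u t - u s)) has_integral i) {0..1}"
      unfolding i_def by (intro integrable_integral integrable_continuous_real continuous_intros u bump_continuous)
    have "((\<lambda>t. of_real (bump e (t - s)) * u s + of_real (bump e (t - s)) * (u t - u s)) has_integral
        of_real (bump_mass e) * u s + i) {0..1}"
      by (intro has_integral_add i has_integral_mult_left has_integral_of_real m)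
    then have "((\<lambda>t. of_real (bump e (t - s)) * u t) has_integral of_real (bump_mass e) * u s + i) {0..1}"
      by (simp add: right_diff_distrib)
    moreover have "cmod i \<le> (bump_mass e * \<eta>) \<bullet> 1"
    proof (rule has_integral_norm_bound_integral_component[OF i has_integral_mult_left[OF m]])
      fix t :: real assume t: "t \<in> {0..1}"
      show "cmod (of_real (bump e (t - s)) * (u t - u s)) \<le> (bump e (t - s) * \<eta>) \<bullet> 1"
      proof (cases "\<bar>t - s\<bar> < e")
        case True
        then show ?thesis using near t bump_nonneg[of e "t - s"] by (simp add: norm_mult mult_left_mono)
      next
        case False
        then have "bump e (t - s) = 0" using bump_pos_iff by blast
        then show ?thesis by simp
      qed
    qed
    ultimately show ?thesis by auto
  qed
  have loc1: "0 < s1 - e" "s1 + e < 1" "\<forall>t\<in>{0..1}. \<bar>t - s1\<bar> < e \<longrightarrow> cmod (u t - u s1) \<le> \<eta>"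
    using e s d(2) by auto
  have loc2: "0 < s2 - e" "s2 + e < 1" "\<forall>t\<in>{0..1}. \<bar>t - s2\<bar> < e \<longrightarrow> cmod (u t - u s2) \<le> \<eta>"
    using e s d(4) by auto
  obtain i1 where i1: "((\<lambda>t. of_real (bump e (t - s1)) * u t) has_integral of_real (bump_mass e) * u s1 + i1) {0..1}"
      "cmod i1 \<le> bump_mass e * \<eta>"
    using local_mean[OF loc1] by blast
  obtain i2 where i2: "((\<lambda>t. of_real (bump e (t - s2)) * u t) has_integral of_real (bump_mass e) * u s2 + i2) {0..1}"
      "cmod i2 \<le> bump_mass e * \<eta>"
    using local_mean[OF loc2] by blast
  have "((\<lambda>t. cnj (vderiv \<phi> t) * u t) has_integral
      (of_real (bump_mass e) * u s1 + i1) - (of_real (bump_mass e) * u s2 + i2)) {0..1}"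
    using has_integral_diff[OF i1(1) i2(1)] by (simp add: \<phi>(2) left_diff_distrib)
  then have "(of_real (bump_mass e) * u s1 + i1) - (of_real (bump_mass e) * u s2 + i2) = 0"
    using orth[OF \<phi>(1)] by (simp add: integral_unique)
  then have eq: "of_real (bump_mass e) * (u s1 - u s2) = i2 - i1" by (simp add: algebra_simps)
  have "bump_mass e * cmod (u s1 - u s2) = cmod (of_real (bump_mass e) * (u s1 - u s2))"
    using bump_mass_pos[OF e(1)] by (simp add: norm_mult)
  also have "\<dots> \<le> cmod i2 + cmod i1" unfolding eq by (rule norm_triangle_ineq4)
  also have "\<dots> \<le> bump_mass e * (2 * \<eta>)" using i1(2) i2(2) by simp
  finally have "cmod (u s1 - u s2) \<le> 2 * \<eta>" using bump_mass_pos[OF e(1)] by simp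
  then show False using \<eta> by (simp add: \<eta>_def)
qed

section \<open>The closure of the derivation\<close>

lemma vderiv_pow_lin:
  assumes "\<And>k. (vderiv ^^ k) f differentiable_on UNIV" "\<And>k. (vderiv ^^ k) g differentiable_on UNIV"
  shows "(vderiv ^^ k) (\<lambda>t. f t + c * g t) = (\<lambda>t. (vderiv ^^ k) f t + c * (vderiv ^^ k) g t)"
proof (induction k)
  case (Suc k)
  have d: "((vderiv ^^ k) f has_vector_derivative (vderiv ^^ Suc k) f t) (at t)"
    "((vderiv ^^ k) g has_vector_derivative (vderiv ^^ Suc k) g t) (at t)" for t
    using assms(1)[of k] assms(2)[of k]
    by (simp_all add: differentiable_on_def vderiv_def vector_derivative_works)
  have "((\<lambda>t. (vderiv ^^ k) f t + c * (vderiv ^^ k) g t) has_vector_derivative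
      (vderiv ^^ Suc k) f t + c * (vderiv ^^ Suc k) g t) (at t)" for t
    by (intro has_vector_derivative_add has_vector_derivative_mult_right d)
  then have "vderiv (\<lambda>t. (vderiv ^^ k) f t + c * (vderiv ^^ k) g t) =
      (\<lambda>t. (vderiv ^^ Suc k) f t + c * (vderiv ^^ Suc k) g t)"
    by (auto simp: vderiv_def vector_derivative_at fun_eq_iff)
  then show ?case using Suc by simp
qed simp

lemma test_funs01_lin:
  assumes "\<phi> \<in> test_funs01" "\<psi> \<in> test_funs01"
  shows "(\<lambda>t. \<phi> t + c * \<psi> t) \<in> test_funs01"
    and "vderiv (\<lambda>t. \<phi> t + c * \<psi> t) = (\<lambda>t. vderiv \<phi> t + c * vderiv \<psi> t)"
proof -
  have d: "(vderiv ^^ k) \<phi> differentiable_on UNIV" "(vderiv ^^ k) \<psi> differentiable_on UNIV" for k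
    using assms unfolding test_funs01_def by blast+
  show "vderiv (\<lambda>t. \<phi> t + c * \<psi> t) = (\<lambda>t. vderiv \<phi> t + c * vderiv \<psi> t)"
    using vderiv_pow_lin[OF d, of 1 c] by simp
  have "closure {t. \<phi> t + c * \<psi> t \<noteq> 0} \<subseteq> closure ({t. \<phi> t \<noteq> 0} \<union> {t. \<psi> t \<noteq> 0})"
    by (rule closure_mono) auto
  also have "\<dots> \<subseteq> {0<..<1}" using assms by (simp add: closure_Un test_funs01_def)
  finally show "(\<lambda>t. \<phi> t + c * \<psi> t) \<in> test_funs01"
    unfolding test_funs01_def vderiv_pow_lin[OF d]
    by (auto simp: vderiv_pow_lin[OF d] intro!: differentiable_on_add differentiable_on_mult differentiable_on_const d)
qed

lemma test_funs01_zero: "(\<lambda>t. 0) \<in> test_funs01" "vderiv (\<lambda>t. 0) = (\<lambda>t. 0)"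
proof -
  show v: "vderiv (\<lambda>t. 0) = (\<lambda>t. 0)" by (simp add: vderiv_def)
  have "(vderiv ^^ k) (\<lambda>t. 0) = (\<lambda>t. 0)" for k by (induction k) (simp_all add: v)
  then show "(\<lambda>t. 0) \<in> test_funs01" by (simp add: test_funs01_def)
qed

lemma cmod_exp_le: "cmod (exp w) \<le> exp (cmod w)"
  by (simp add: complex_Re_le_cmod)

text \<open>
  The integrated form of \<open>U' = \<i> (z U + Z)\<close>; multiplication by \<open>e\<^bsup>-\<i> z t\<^esup>\<close> removes the term
  with \<open>U\<close>.
\<close>

lemma variation_of_constants:
  fixes U Z :: "real \<Rightarrow> complex"
  assumes U: "continuous_on {0..1} U" and Z: "continuous_on {0..1} Z"
    and eq: "\<And>x. x \<in> {0..1} \<Longrightarrow> U x = U 0 + integral {0..x} (\<lambda>t. \<i> * (Z t + z * U t))"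
    and x: "x \<in> {0..1}"
  shows "U x = exp (\<i> * z * of_real x) * (U 0 + integral {0..x} (\<lambda>t. \<i> * exp (- \<i> * z * of_real t) * Z t))"
proof -
  have "((\<lambda>t. \<i> * exp (- \<i> * z * of_real t) * Z t) has_integral
      exp (- \<i> * z * of_real x) * U x - exp (- \<i> * z * of_real 0) * U 0) {0..x}"
  proof (rule fundamental_theorem_of_calculus)
    fix t assume "t \<in> {0..x}"
    then have t: "t \<in> {0..1}" using x by auto
    have "((\<lambda>x. U 0 + integral {0..x} (\<lambda>t. \<i> * (Z t + z * U t))) has_vector_derivative
        0 + \<i> * (Z t + z * U t)) (at t within {0..1})"
      by (intro has_vector_derivative_add has_vector_derivative_const integral_has_vector_derivative
          continuous_intros U Z t)
    from has_vector_derivative_transform[OF t eq this]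
    have dU: "(U has_vector_derivative \<i> * (Z t + z * U t)) (at t within {0..1})" by simp
    have dE: "((\<lambda>t. exp (- \<i> * z * of_real t)) has_vector_derivative - \<i> * z * exp (- \<i> * z * of_real t)) (at t within {0..1})"
      by (rule has_vector_derivative_real_field) (auto intro!: derivative_eq_intros)
    have "((\<lambda>t. exp (- \<i> * z * of_real t) * U t) has_vector_derivative
        exp (- \<i> * z * of_real t) * (\<i> * (Z t + z * U t)) + (- \<i> * z * exp (- \<i> * z * of_real t)) * U t) (at t within {0..1})"
      by (rule has_vector_derivative_mult[OF dE dU])
    then have "((\<lambda>t. exp (- \<i> * z * of_real t) * U t) has_vector_derivative
        \<i> * exp (- \<i> * z * of_real t) * Z t) (at t within {0..1})"
      by (rule has_vector_derivative_eq_rhs) (simp add: algebra_simps)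
    then show "((\<lambda>t. exp (- \<i> * z * of_real t) * U t) has_vector_derivative
        \<i> * exp (- \<i> * z * of_real t) * Z t) (at t within {0..x})"
      by (rule has_vector_derivative_within_subset) (use x in auto)
  qed (use x in auto)
  then have "U 0 + integral {0..x} (\<lambda>t. \<i> * exp (- \<i> * z * of_real t) * Z t) = exp (- \<i> * z * of_real x) * U x"
    by (simp add: integral_unique)
  then show ?thesis by (simp add: mult.assoc[symmetric] exp_add[symmetric])
qed

text \<open>
  The characteristic function of \<open>A\<^sub>\<theta>\<close>: the exponential \<open>e\<^bsup>\<i> z x\<^esup>\<close> satisfies the boundary
  condition of \<open>A\<^sub>\<theta>\<close>, which is \<open>u'(1) + u(1) = e\<^bsup>\<i> \<theta>\<^esup> (u(0) - u'(0))\<close>, if and only if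
  \<open>char_fun \<theta> z = 0\<close>.
\<close>

definition char_fun :: "real \<Rightarrow> complex \<Rightarrow> complex" where
  "char_fun \<theta> z = (1 + \<i> * z) * exp (\<i> * z) - cis \<theta> * (1 - \<i> * z)"

context exp_kernel
begin

lemma smear_lin:
  assumes "continuous_on {0..1} \<phi>" "continuous_on {0..1} \<psi>"
  shows "smear F (\<lambda>t. \<phi> t + c * \<psi> t) = (\<lambda>t. smear F \<phi> t + c * smear F \<psi> t)"
proof
  fix x
  show "smear F (\<lambda>t. \<phi> t + c * \<psi> t) x = smear F \<phi> x + c * smear F \<psi> x"
  proof (cases "0 < x \<and> x < 1")
    case True
    let ?e = "\<lambda>y. complex_of_real (exp (- \<bar>x - y\<bar>))"
    have "integral {0..1} (\<lambda>y. (\<phi> y + c * \<psi> y) * ?e y) = integral {0..1} (\<lambda>y. \<phi> y * ?e y + c * (\<psi> y * ?e y))"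
      by (simp add: distrib_right mult.assoc)
    also have "\<dots> = integral {0..1} (\<lambda>y. \<phi> y * ?e y) + integral {0..1} (\<lambda>y. c * (\<psi> y * ?e y))"
      by (rule integral_add) (intro integrable_continuous_real continuous_intros assms)+
    finally show ?thesis using True by (simp add: smear_eq)
  qed (auto simp: smear_def on01_def)
qed

lemma smear_zero: "smear F (\<lambda>t. 0) = (\<lambda>t. 0)"
  by (simp add: smear_def on01_def)

lemma D_graph_zero: "(\<lambda>t. 0, \<lambda>t. 0) \<in> D_graph F"
  unfolding D_graph_def mem_Collect_eq
  by (rule exI[of _ "\<lambda>t. 0"]) (simp add: test_funs01_zero smear_zero)

lemma D_graph_lin:
  assumes "(s, r) \<in> D_graph F" "(s', r') \<in> D_graph F"
  shows "(\<lambda>t. s t + c * s' t, \<lambda>t. r t + c * r' t) \<in> D_graph F"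
proof -
  obtain \<phi> \<psi> where *: "\<phi> \<in> test_funs01" "\<psi> \<in> test_funs01" "s = smear F \<phi>" "r = smear F (vderiv \<phi>)"
    "s' = smear F \<psi>" "r' = smear F (vderiv \<psi>)"
    using assms unfolding D_graph_def by blast
  have "smear F (\<lambda>t. \<phi> t + c * \<psi> t) = (\<lambda>t. s t + c * s' t)"
    "smear F (vderiv (\<lambda>t. \<phi> t + c * \<psi> t)) = (\<lambda>t. r t + c * r' t)"
    unfolding test_funs01_lin(2)[OF *(1,2)] *
    by (intro smear_lin test_fun_continuous test_fun_vderiv_continuous *)+
  then show ?thesis using test_funs01_lin(1)[OF *(1,2)] unfolding D_graph_def mem_Collect_eq
    by (intro exI[of _ "\<lambda>t. \<phi> t + c * \<psi> t"]) simp
qed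

text \<open>
  Robin conditions, \<open>\<xi>' = \<xi>\<close> at \<open>0\<close> and \<open>\<xi>' = -\<xi>\<close> at \<open>1\<close>. They express that \<open>\<xi>\<close> is a
  smeared kernel \<open>\<integral> \<phi>(y) e\<^bsup>-|x-y|\<^esup> dy\<close> with \<open>\<phi> = (\<xi> - \<xi>'')/2\<close>.
\<close>

definition robin_pair :: "(real \<Rightarrow> complex) \<Rightarrow> (real \<Rightarrow> complex) \<Rightarrow> bool" where
  "robin_pair \<xi> \<eta> \<longleftrightarrow> deriv_pair \<xi> \<eta> \<and> cext \<eta> 0 = cext \<xi> 0 \<and> cext \<eta> 1 = - cext \<xi> 1"

lemma robin_pair_mem: "robin_pair \<xi> \<eta> \<Longrightarrow> \<xi> \<in> rkhs F" "robin_pair \<xi> \<eta> \<Longrightarrow> \<eta> \<in> rkhs F"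
  by (auto simp: robin_pair_def deriv_pair_def)

lemma D_graph_robin: "(s, r) \<in> D_graph F \<Longrightarrow> robin_pair s r"
  unfolding D_graph_def robin_pair_def using deriv_pair_smear by blast

lemma cext_tendsto:
  assumes s: "\<And>n. s n \<in> rkhs F" and \<xi>: "\<xi> \<in> rkhs F" and lim: "(\<lambda>n. H.nrm (\<lambda>t. s n t - \<xi> t)) \<longlonglongrightarrow> 0"
    and x: "x \<in> {0..1}"
  shows "(\<lambda>n. cext (s n) x) \<longlonglongrightarrow> cext \<xi> x"
  unfolding cext_def by (rule H.B_tendsto[OF s \<xi> kern_mem[OF x] lim])

text \<open>
  Convergence in norm is uniform on \<open>[0,1]\<close>, and all relations in \<open>robin_pair\<close> pass to uniform
  limits.
\<close>

lemma op_closure_robin: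
  assumes "(\<xi>, \<eta>) \<in> op_closure F (D_graph F)"
  shows "robin_pair \<xi> \<eta>"
proof -
  obtain s r where m: "\<xi> \<in> rkhs F" "\<eta> \<in> rkhs F" and sr: "\<And>n. (s n, r n) \<in> D_graph F"
    and lim: "(\<lambda>n. H.nrm (\<lambda>t. s n t - \<xi> t)) \<longlonglongrightarrow> 0" "(\<lambda>n. H.nrm (\<lambda>t. r n t - \<eta> t)) \<longlonglongrightarrow> 0"
    using assms unfolding op_closure_def rkhs_tendsto_def rkhs_norm_eq by blast
  have d: "robin_pair (s n) (r n)" for n by (rule D_graph_robin[OF sr])
  note mem = robin_pair_mem[OF d]
  have ls: "(\<lambda>n. cext (s n) x) \<longlonglongrightarrow> cext \<xi> x" and lr: "(\<lambda>n. cext (r n) x) \<longlonglongrightarrow> cext \<eta> x" if "x \<in> {0..1}" for x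
    by (rule cext_tendsto[OF mem(1) m(1) lim(1) that], rule cext_tendsto[OF mem(2) m(2) lim(2) that])
  have 0: "cext \<eta> 0 = cext \<xi> 0"
    using LIMSEQ_unique[OF ls[of 0]] lr[of 0] d by (simp add: robin_pair_def)
  have 1: "cext \<eta> 1 = - cext \<xi> 1"
    using LIMSEQ_unique[OF tendsto_minus[OF ls[of 1]]] lr[of 1] d by (simp add: robin_pair_def)
  have "cext \<xi> x = cext \<xi> 0 + integral {0..x} (cext \<eta>)" if x: "x \<in> {0..1}" for x
  proof (rule LIMSEQ_unique[OF ls[OF x]])
    have "(\<lambda>n. integral {0..x} (cext (r n)) - integral {0..x} (cext \<eta>)) \<longlonglongrightarrow> 0"
    proof (rule Lim_null_comparison[OF _ lim(2)])
      have "cmod (integral {0..x} (cext (r n)) - integral {0..x} (cext \<eta>)) \<le> H.nrm (\<lambda>t. r n t - \<eta> t)" for n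
      proof -
        have sub: "{0..x} \<subseteq> {0..1}" using x by auto
        have c: "continuous_on {0..x} (cext (r n))" "continuous_on {0..x} (cext \<eta>)"
          using continuous_on_subset[OF cext_continuous sub] mem m by blast+
        have "integral {0..x} (cext (r n)) - integral {0..x} (cext \<eta>) = integral {0..x} (\<lambda>t. cext (r n) t - cext \<eta> t)"
          by (rule integral_diff[symmetric]) (intro integrable_continuous_real c)+
        also have "cmod (integral {0..x} (\<lambda>t. cext (r n) t - cext \<eta> t)) \<le> H.nrm (\<lambda>t. r n t - \<eta> t) * (x - 0)"
        proof (rule integral_bound)
          show "cmod (cext (r n) t - cext \<eta> t) \<le> H.nrm (\<lambda>t. r n t - \<eta> t)" if "t \<in> {0..x}" for t
          proof -
            have t: "t \<in> {0..1}" using that sub by blast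
            show ?thesis
              using cext_bound[OF H.diff_mem[OF mem(2) m(2)] t] cext_diff[OF mem(2) m(2) t] by metis
          qed
        qed (use x in \<open>auto intro!: continuous_intros c\<close>)
        also have "\<dots> \<le> H.nrm (\<lambda>t. r n t - \<eta> t) * 1"
          using x by (intro mult_left_mono H.nrm_nonneg H.diff_mem mem m) auto
        finally show ?thesis by simp
      qed
      then show "\<forall>\<^sub>F n in sequentially. cmod (integral {0..x} (cext (r n)) - integral {0..x} (cext \<eta>)) \<le> H.nrm (\<lambda>t. r n t - \<eta> t)"
        by simp
    qed
    then have "(\<lambda>n. integral {0..x} (cext (r n))) \<longlonglongrightarrow> integral {0..x} (cext \<eta>)" by (simp add: LIM_zero_iff)
    then have "(\<lambda>n. cext (s n) 0 + integral {0..x} (cext (r n))) \<longlonglongrightarrow> cext \<xi> 0 + integral {0..x} (cext \<eta>)"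
      by (intro tendsto_add ls) simp_all
    moreover have "cext (s n) x = cext (s n) 0 + integral {0..x} (cext (r n))" for n
      using d[of n] x unfolding robin_pair_def deriv_pair_def by blast
    ultimately show "(\<lambda>n. cext (s n) x) \<longlonglongrightarrow> cext \<xi> 0 + integral {0..x} (cext \<eta>)" by simp
  qed
  then show ?thesis using 0 1 m unfolding robin_pair_def deriv_pair_def by blast
qed

lemma D_graph_closure: "(s, r) \<in> D_graph F \<Longrightarrow> (s, r) \<in> op_closure F (D_graph F)"
proof -
  assume a: "(s, r) \<in> D_graph F"
  have "H.nrm (\<lambda>t. 0) = 0" using H.nrm_scale[OF H.zero_mem, of 0] by simp
  then show ?thesis
    using a robin_pair_mem[OF D_graph_robin[OF a]]
    unfolding op_closure_def rkhs_tendsto_def rkhs_norm_eq mem_Collect_eq prod.case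
    by (intro conjI exI[of _ "\<lambda>n. s"] exI[of _ "\<lambda>n. r"]) simp_all
qed

lemma op_closure_lin:
  assumes "(\<xi>, \<eta>) \<in> op_closure F (D_graph F)" "(\<xi>', \<eta>') \<in> op_closure F (D_graph F)"
  shows "(\<lambda>t. \<xi> t + c * \<xi>' t, \<lambda>t. \<eta> t + c * \<eta>' t) \<in> op_closure F (D_graph F)"
proof -
  obtain s r where m: "\<xi> \<in> rkhs F" "\<eta> \<in> rkhs F" and sr: "\<And>n. (s n, r n) \<in> D_graph F"
    and lim: "(\<lambda>n. H.nrm (\<lambda>t. s n t - \<xi> t)) \<longlonglongrightarrow> 0" "(\<lambda>n. H.nrm (\<lambda>t. r n t - \<eta> t)) \<longlonglongrightarrow> 0"
    using assms(1) unfolding op_closure_def rkhs_tendsto_def rkhs_norm_eq by blast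
  obtain s' r' where m': "\<xi>' \<in> rkhs F" "\<eta>' \<in> rkhs F" and sr': "\<And>n. (s' n, r' n) \<in> D_graph F"
    and lim': "(\<lambda>n. H.nrm (\<lambda>t. s' n t - \<xi>' t)) \<longlonglongrightarrow> 0" "(\<lambda>n. H.nrm (\<lambda>t. r' n t - \<eta>' t)) \<longlonglongrightarrow> 0"
    using assms(2) unfolding op_closure_def rkhs_tendsto_def rkhs_norm_eq by blast
  note mem = robin_pair_mem[OF D_graph_robin[OF sr]] robin_pair_mem[OF D_graph_robin[OF sr']]
  have "(\<lambda>n. H.nrm (\<lambda>t. (s n t + c * s' n t) - (\<xi> t + c * \<xi>' t))) \<longlonglongrightarrow> 0"
    by (rule H.nrm_tendsto_lin[OF mem(1,3) m(1) m'(1) lim(1) lim'(1)])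
  moreover have "(\<lambda>n. H.nrm (\<lambda>t. (r n t + c * r' n t) - (\<eta> t + c * \<eta>' t))) \<longlonglongrightarrow> 0"
    by (rule H.nrm_tendsto_lin[OF mem(2,4) m(2) m'(2) lim(2) lim'(2)])
  moreover have "(\<lambda>t. s n t + c * s' n t, \<lambda>t. r n t + c * r' n t) \<in> D_graph F" for n
    by (rule D_graph_lin[OF sr sr'])
  moreover have "(\<lambda>t. \<xi> t + c * \<xi>' t) \<in> rkhs F" "(\<lambda>t. \<eta> t + c * \<eta>' t) \<in> rkhs F"
    by (intro H.add_mem H.scale_mem m m')+
  ultimately show ?thesis
    unfolding op_closure_def rkhs_tendsto_def rkhs_norm_eq mem_Collect_eq prod.case
    by (intro conjI exI[of _ "\<lambda>n t. s n t + c * s' n t"] exI[of _ "\<lambda>n t. r n t + c * r' n t"]) auto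
qed

lemma deriv_pair_mem: "deriv_pair \<xi> \<eta> \<Longrightarrow> \<xi> \<in> rkhs F" "deriv_pair \<xi> \<eta> \<Longrightarrow> \<eta> \<in> rkhs F"
  by (simp_all add: deriv_pair_def)

lemma deriv_pair_eq: "deriv_pair \<xi> \<eta> \<Longrightarrow> x \<in> {0..1} \<Longrightarrow> cext \<xi> x = cext \<xi> 0 + integral {0..x} (cext \<eta>)"
  unfolding deriv_pair_def by blast

lemma deriv_pair_lin:
  assumes "deriv_pair \<xi> \<eta>" "deriv_pair \<xi>' \<eta>'"
  shows "deriv_pair (\<lambda>t. \<xi> t + c * \<xi>' t) (\<lambda>t. \<eta> t + c * \<eta>' t)"
proof -
  note m = deriv_pair_mem[OF assms(1)] deriv_pair_mem[OF assms(2)]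
  have lin: "cext (\<lambda>t. a t + c * b t) x = cext a x + c * cext b x" if "a \<in> rkhs F" "b \<in> rkhs F" "x \<in> {0..1}" for a b x
    by (simp only: cext_add[OF that(1) H.scale_mem[OF that(2)] that(3)] cext_scale[OF that(2,3)])
  have "cext (\<lambda>t. \<xi> t + c * \<xi>' t) x = cext (\<lambda>t. \<xi> t + c * \<xi>' t) 0 + integral {0..x} (cext (\<lambda>t. \<eta> t + c * \<eta>' t))"
    if x: "x \<in> {0..1}" for x
  proof -
    have sub: "{0..x} \<subseteq> {0..1}" using x by auto
    have "integral {0..x} (cext (\<lambda>t. \<eta> t + c * \<eta>' t)) = integral {0..x} (\<lambda>t. cext \<eta> t + c * cext \<eta>' t)"
      by (rule integral_cong) (use sub in \<open>auto intro!: lin m\<close>)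
    also have "\<dots> = integral {0..x} (cext \<eta>) + integral {0..x} (\<lambda>t. c * cext \<eta>' t)"
      by (rule integral_add)
         (intro integrable_continuous_real continuous_intros continuous_on_subset[OF cext_continuous sub] m)+
    also have "integral {0..x} (\<lambda>t. c * cext \<eta>' t) = c * integral {0..x} (cext \<eta>')" by simp
    finally have i: "integral {0..x} (cext (\<lambda>t. \<eta> t + c * \<eta>' t)) = integral {0..x} (cext \<eta>) + c * integral {0..x} (cext \<eta>')" .
    show ?thesis
      unfolding i lin[OF m(1,3) x] using lin[OF m(1,3), of 0] deriv_pair_eq[OF assms(1) x] deriv_pair_eq[OF assms(2) x]
      by (simp add: distrib_left)
  qed
  then show ?thesis unfolding deriv_pair_def using m by (simp add: H.add_mem H.scale_mem del: atLeastAtMost_iff)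
qed

lemma deriv_pairI:
  assumes m: "\<xi> \<in> rkhs F" "\<eta> \<in> rkhs F"
    and d: "\<And>x. x \<in> {0..1} \<Longrightarrow> (cext \<xi> has_vector_derivative cext \<eta> x) (at x within {0..1})"
  shows "deriv_pair \<xi> \<eta>"
  unfolding deriv_pair_def
proof (intro conjI m ballI)
  fix x :: real assume x: "x \<in> {0..1}"
  have "(cext \<eta> has_integral cext \<xi> x - cext \<xi> 0) {0..x}"
    by (rule fundamental_theorem_of_calculus)
       (use x in \<open>auto intro: has_vector_derivative_within_subset[OF d]\<close>)
  then show "cext \<xi> x = cext \<xi> 0 + integral {0..x} (cext \<eta>)" by (simp add: integral_unique)
qed

lemma deriv_pair_kern0: "deriv_pair (kern 0) (\<lambda>t. - kern 0 t)"
proof (rule deriv_pairI)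
  have m: "kern 0 \<in> rkhs F" by (rule kern_mem) simp
  then show "kern 0 \<in> rkhs F" "(\<lambda>t. - kern 0 t) \<in> rkhs F" using H.scale_mem[OF m, of "-1"] by simp_all
  fix x :: real assume x: "x \<in> {0..1}"
  have k: "cext (kern 0) y = of_real (exp (- y))" if "y \<in> {0..1}" for y
    using that by (simp add: cext_kern)
  have "cext (\<lambda>t. - kern 0 t) x = of_real (- exp (- x))"
    using cext_scale[OF m x, of "-1"] k[OF x] by simp
  then show "(cext (kern 0) has_vector_derivative cext (\<lambda>t. - kern 0 t) x) (at x within {0..1})"
    using has_vector_derivative_transform[OF x k exp_minus_vector_derivative] by simp
qed

lemma deriv_pair_kern1: "deriv_pair (kern 1) (kern 1)"
proof (rule deriv_pairI)
  show m: "kern 1 \<in> rkhs F" "kern 1 \<in> rkhs F" by (auto intro: kern_mem)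
  fix x :: real assume x: "x \<in> {0..1}"
  have k: "cext (kern 1) y = of_real (exp (y - 1))" if "y \<in> {0..1}" for y
    using that by (simp add: cext_kern)
  have "((\<lambda>y. complex_of_real (exp (y - 1))) has_vector_derivative of_real (exp (x - 1))) (at x within {0..1})"
    by (intro has_vector_derivative_of_real)
       (auto simp: has_real_derivative_iff_has_vector_derivative[symmetric] intro!: derivative_eq_intros)
  then show "(cext (kern 1) has_vector_derivative cext (kern 1) x) (at x within {0..1})"
    using has_vector_derivative_transform[OF x k] k[OF x] by simp
qed

text \<open>
  Apply \<open>nrm_le_sup\<close> with \<open>p = \<xi>' + \<xi>\<close>; its solution formula is variation of constants with
  \<open>z = \<i>\<close>.
\<close>

lemma nrm_deriv_pair:
  assumes d: "deriv_pair \<xi> \<eta>"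
    and K: "\<And>x. x \<in> {0..1} \<Longrightarrow> cmod (cext \<xi> x) \<le> K" and L: "\<And>x. x \<in> {0..1} \<Longrightarrow> cmod (cext \<eta> x) \<le> L"
  shows "H.nrm \<xi> \<le> K + (K + L)"
proof (rule nrm_le_sup(2)[where p = "\<lambda>t. cext \<xi> t + cext \<eta> t" and b = "cext \<xi> 0"])
  note m = deriv_pair_mem[OF d]
  show "continuous_on {0..1} (\<lambda>t. cext \<xi> t + cext \<eta> t)" by (intro continuous_intros cext_continuous m)
  show "cmod (cext \<xi> t + cext \<eta> t) \<le> K + L" if "t \<in> {0..1}" for t
    by (rule norm_triangle_mono[OF K[OF that] L[OF that]])
  show "cmod (cext \<xi> 0) \<le> K" by (rule K) simp
  show "\<xi> x = 0" if "\<not> (0 < x \<and> x < 1)" for x by (rule rkhs_vanish[OF m(1) that])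
  fix x :: real assume x: "0 < x" "x < 1"
  have eq: "cext \<xi> x = cext \<xi> 0 + integral {0..x} (\<lambda>t. \<i> * ((- \<i> * (cext \<xi> t + cext \<eta> t)) + \<i> * cext \<xi> t))" if "x \<in> {0..1}" for x
    using deriv_pair_eq[OF d that] by (simp add: algebra_simps)
  have "cext \<xi> x = exp (\<i> * \<i> * of_real x) * (cext \<xi> 0 + integral {0..x} (\<lambda>t. \<i> * exp (- \<i> * \<i> * of_real t) * (- \<i> * (cext \<xi> t + cext \<eta> t))))"
    by (rule variation_of_constants[OF _ _ eq]) (use x in \<open>auto intro!: continuous_intros cext_continuous m\<close>)
  also have "\<dots> = of_real (exp (- x)) * cext \<xi> 0 + of_real (exp (- x)) * integral {0..x} (\<lambda>t. of_real (exp t) * (cext \<xi> t + cext \<eta> t))"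
  proof -
    have "\<i> * exp (- \<i> * \<i> * of_real t) * (- \<i> * w) = of_real (exp t) * w" for t :: real and w
      by (simp add: exp_of_real[symmetric] algebra_simps)
    then show ?thesis by (simp only:) (simp add: exp_of_real[symmetric] distrib_left)
  qed
  also have "of_real (exp (- x)) * integral {0..x} (\<lambda>t. of_real (exp t) * (cext \<xi> t + cext \<eta> t)) =
      integral {0..x} (\<lambda>t. of_real (exp (t - x)) * (cext \<xi> t + cext \<eta> t))"
    by (simp add: exp_diff exp_minus field_simps flip: integral_mult_right)
  finally show "\<xi> x = of_real (exp (- x)) * cext \<xi> 0 + integral {0..x} (\<lambda>t. of_real (exp (t - x)) * (cext \<xi> t + cext \<eta> t))"
    using cext_interior[OF m(1) x] by simp
qed

end

section \<open>The spectrum of the selfadjoint extension\<close>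

context exp_kernel
begin

lemma kern_bdry_mem: "kern 0 \<in> rkhs F" "kern 1 \<in> rkhs F"
  by (auto intro: kern_mem)

text \<open>
  For \<open>\<sigma> = 1\<close> this is the vector \<open>e\<^bsup>-x\<^esup> + e\<^bsup>\<i> \<theta>\<^esup> e\<^bsup>x-1\<^esup>\<close> that is adjoined to the domain; for
  \<open>\<sigma> = -1\<close> it is the negative of its derivative.
\<close>

definition defect_vec :: "real \<Rightarrow> complex \<Rightarrow> real \<Rightarrow> complex" where
  "defect_vec \<theta> \<sigma> = (\<lambda>t. kern 0 t + \<sigma> * cis \<theta> * kern 1 t)"

lemma defect_vec_mem: "defect_vec \<theta> \<sigma> \<in> rkhs F"
  unfolding defect_vec_def by (intro H.add_mem H.scale_mem kern_bdry_mem)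

lemma cext_lin:
  "a \<in> rkhs F \<Longrightarrow> b \<in> rkhs F \<Longrightarrow> x \<in> {0..1} \<Longrightarrow> cext (\<lambda>t. a t + c * b t) x = cext a x + c * cext b x"
  by (simp only: cext_add H.scale_mem cext_scale)

lemma cext_defect_vec:
  "x \<in> {0..1} \<Longrightarrow> cext (defect_vec \<theta> \<sigma>) x = of_real (exp (- x)) + \<sigma> * cis \<theta> * of_real (exp (x - 1))"
  unfolding defect_vec_def by (subst cext_lin) (auto simp: kern_bdry_mem cext_kern)

lemma deriv_pair_defect_vec: "deriv_pair (defect_vec \<theta> \<sigma>) (\<lambda>t. -1 * defect_vec \<theta> (-\<sigma>) t)"
  using deriv_pair_lin[OF deriv_pair_kern0 deriv_pair_kern1, of "\<sigma> * cis \<theta>"]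
  by (simp add: defect_vec_def algebra_simps)

text \<open>
  The extension of \<open>-\<i> G\<close> by the defect vector. Besides the closure of the derivation, it is
  applied to the derivation itself: the range on that smaller domain is explicit enough to
  determine its orthogonal complement.
\<close>

definition ext_graph :: "real \<Rightarrow> op_graph \<Rightarrow> op_graph" where
  "ext_graph \<theta> G = {(\<lambda>t. h t + c * defect_vec \<theta> 1 t, \<lambda>t. - \<i> * h' t + \<i> * c * defect_vec \<theta> (-1) t) | h h' c. (h, h') \<in> G}"

lemma vderiv_robin_pair:
  assumes d: "robin_pair h h'" and x: "0 < x" "x < 1"
  shows "vderiv h x = h' x"
proof -
  have dp: "deriv_pair h h'" using d by (simp add: robin_pair_def)
  note m = deriv_pair_mem[OF dp]
  have "((\<lambda>x. cext h 0 + integral {0..x} (cext h')) has_vector_derivative 0 + cext h' x) (at x within {0..1})"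
    by (intro has_vector_derivative_add has_vector_derivative_const integral_has_vector_derivative cext_continuous m)
       (use x in simp)
  then have "((\<lambda>x. cext h 0 + integral {0..x} (cext h')) has_vector_derivative h' x) (at x)"
    using x cext_interior[OF m(2) x] at_within_Icc_at[of 0 x 1] by simp
  then have "(h has_vector_derivative h' x) (at x)"
  proof (rule has_vector_derivative_transform_within_open[where S = "{0<..<1}"])
    show "cext h 0 + integral {0..y} (cext h') = h y" if "y \<in> {0<..<1}" for y
      using deriv_pair_eq[OF dp, of y] cext_interior[OF m(1), of y] that by simp
  qed (use x in auto)
  then show ?thesis by (rule vderiv_eqI)
qed

lemma A_graph_eq: "A_graph F \<theta> = ext_graph \<theta> (op_closure F (D_graph F))"
proof -
  have eq1: "on01 (\<lambda>x. h x + c * (exp (- of_real x) + cis \<theta> * exp (of_real x - 1))) = (\<lambda>t. h t + c * defect_vec \<theta> 1 t)"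
    if "robin_pair h h'" for h h' c
    using rkhs_vanish[OF robin_pair_mem(1)[OF that]]
    by (auto simp: fun_eq_iff on01_def defect_vec_def kern_def exp_of_real[symmetric])
  have eq2: "on01 (\<lambda>x. - \<i> * vderiv h x + \<i> * c * (exp (- of_real x) - cis \<theta> * exp (of_real x - 1))) =
      (\<lambda>t. - \<i> * h' t + \<i> * c * defect_vec \<theta> (-1) t)"
    if "robin_pair h h'" for h h' c
    using rkhs_vanish[OF robin_pair_mem(2)[OF that]] vderiv_robin_pair[OF that]
    by (auto simp: fun_eq_iff on01_def defect_vec_def kern_def exp_of_real[symmetric])
  show ?thesis
  proof (intro equalityI subsetI)
    fix p assume "p \<in> A_graph F \<theta>"
    then obtain h h' c where p: "p = (on01 (\<lambda>x. h x + c * (exp (- of_real x) + cis \<theta> * exp (of_real x - 1))),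
       on01 (\<lambda>x. - \<i> * vderiv h x + \<i> * c * (exp (- of_real x) - cis \<theta> * exp (of_real x - 1))))"
      and h: "(h, h') \<in> op_closure F (D_graph F)"
      unfolding A_graph_def by blast
    show "p \<in> ext_graph \<theta> (op_closure F (D_graph F))"
      unfolding p eq1[OF op_closure_robin[OF h]] eq2[OF op_closure_robin[OF h]] ext_graph_def using h by blast
  next
    fix p assume "p \<in> ext_graph \<theta> (op_closure F (D_graph F))"
    then obtain h h' c where p: "p = (\<lambda>t. h t + c * defect_vec \<theta> 1 t, \<lambda>t. - \<i> * h' t + \<i> * c * defect_vec \<theta> (-1) t)"
      and h: "(h, h') \<in> op_closure F (D_graph F)"
      unfolding ext_graph_def by blast
    show "p \<in> A_graph F \<theta>"
      unfolding p eq1[OF op_closure_robin[OF h], symmetric] eq2[OF op_closure_robin[OF h], symmetric] A_graph_def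
      using h by blast
  qed
qed

lemma ext_graph_lin:
  assumes G: "\<And>s r s' r' c. (s, r) \<in> G \<Longrightarrow> (s', r') \<in> G \<Longrightarrow> (\<lambda>t. s t + c * s' t, \<lambda>t. r t + c * r' t) \<in> G"
    and "(\<xi>, \<eta>) \<in> ext_graph \<theta> G" "(\<xi>', \<eta>') \<in> ext_graph \<theta> G"
  shows "(\<lambda>t. \<xi> t + k * \<xi>' t, \<lambda>t. \<eta> t + k * \<eta>' t) \<in> ext_graph \<theta> G"
proof -
  obtain h h' c where 1: "(h, h') \<in> G" "\<xi> = (\<lambda>t. h t + c * defect_vec \<theta> 1 t)" "\<eta> = (\<lambda>t. - \<i> * h' t + \<i> * c * defect_vec \<theta> (-1) t)"
    using assms(2) unfolding ext_graph_def by blast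
  obtain g g' d where 2: "(g, g') \<in> G" "\<xi>' = (\<lambda>t. g t + d * defect_vec \<theta> 1 t)" "\<eta>' = (\<lambda>t. - \<i> * g' t + \<i> * d * defect_vec \<theta> (-1) t)"
    using assms(3) unfolding ext_graph_def by blast
  have "(\<lambda>t. \<xi> t + k * \<xi>' t) = (\<lambda>t. (h t + k * g t) + (c + k * d) * defect_vec \<theta> 1 t)"
    "(\<lambda>t. \<eta> t + k * \<eta>' t) = (\<lambda>t. - \<i> * (h' t + k * g' t) + \<i> * (c + k * d) * defect_vec \<theta> (-1) t)"
    unfolding 1 2 by (simp_all add: fun_eq_iff algebra_simps)
  then show ?thesis using G[OF 1(1) 2(1), of k] unfolding ext_graph_def mem_Collect_eq
    by (intro exI[of _ "\<lambda>t. h t + k * g t"] exI[of _ "\<lambda>t. h' t + k * g' t"] exI[of _ "c + k * d"]) simp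
qed

lemma A_graph_lin:
  assumes "(\<xi>, \<eta>) \<in> A_graph F \<theta>" "(\<xi>', \<eta>') \<in> A_graph F \<theta>"
  shows "(\<lambda>t. \<xi> t + k * \<xi>' t, \<lambda>t. \<eta> t + k * \<eta>' t) \<in> A_graph F \<theta>"
  using ext_graph_lin[of "op_closure F (D_graph F)", OF op_closure_lin] assms unfolding A_graph_eq by blast

lemma A_graph_diff:
  assumes "(\<xi>, \<eta>) \<in> A_graph F \<theta>" "(\<xi>', \<eta>') \<in> A_graph F \<theta>"
  shows "(\<lambda>t. \<xi> t - \<xi>' t, \<lambda>t. \<eta> t - \<eta>' t) \<in> A_graph F \<theta>"
  using A_graph_lin[OF assms, of "-1"] by simp

text \<open>
  The boundary condition holds on the closure of the derivation, where both sides vanish, and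
  for the defect vector, where both sides equal \<open>2 e\<^bsup>\<i> \<theta>\<^esup>\<close>.
\<close>

lemma A_graph_bvp:
  assumes "(\<xi>, \<eta>) \<in> A_graph F \<theta>"
  shows "\<eta> \<in> rkhs F" "deriv_pair \<xi> (\<lambda>t. \<i> * \<eta> t)"
    "\<i> * cext \<eta> 1 + cext \<xi> 1 = cis \<theta> * (cext \<xi> 0 - \<i> * cext \<eta> 0)"
proof -
  obtain h h' c where h: "robin_pair h h'" and \<xi>: "\<xi> = (\<lambda>t. h t + c * defect_vec \<theta> 1 t)"
    and \<eta>: "\<eta> = (\<lambda>t. - \<i> * h' t + \<i> * c * defect_vec \<theta> (-1) t)"
    using assms op_closure_robin unfolding A_graph_eq ext_graph_def by blast
  note m = robin_pair_mem[OF h]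
  show \<eta>m: "\<eta> \<in> rkhs F" unfolding \<eta> by (intro H.add_mem H.scale_mem m defect_vec_mem)
  have "deriv_pair \<xi> (\<lambda>t. h' t + c * (-1 * defect_vec \<theta> (-1) t))"
    unfolding \<xi> by (rule deriv_pair_lin[OF _ deriv_pair_defect_vec]) (use h in \<open>simp add: robin_pair_def\<close>)
  also have "(\<lambda>t. h' t + c * (-1 * defect_vec \<theta> (-1) t)) = (\<lambda>t. \<i> * \<eta> t)"
    by (simp add: \<eta> fun_eq_iff algebra_simps)
  finally show "deriv_pair \<xi> (\<lambda>t. \<i> * \<eta> t)" .
  have ex: "cext \<xi> x = cext h x + c * cext (defect_vec \<theta> 1) x"
    "cext \<eta> x = - \<i> * cext h' x + \<i> * c * cext (defect_vec \<theta> (-1)) x" if "x \<in> {0..1}" for x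
    unfolding \<xi> \<eta> using that by (simp_all only: cext_lin m defect_vec_mem H.scale_mem cext_scale)
  have b: "cext h' 0 = cext h 0" "cext h' 1 = - cext h 1" using h by (auto simp: robin_pair_def)
  show "\<i> * cext \<eta> 1 + cext \<xi> 1 = cis \<theta> * (cext \<xi> 0 - \<i> * cext \<eta> 0)"
    by (simp add: ex b cext_defect_vec algebra_simps)
qed

text \<open>
  With \<open>\<zeta> = \<eta> - z \<xi>\<close> the boundary value problem reads \<open>\<xi>' = \<i> (z \<xi> + \<zeta>)\<close>. Variation of
  constants expresses \<open>\<xi>\<close> through \<open>\<zeta>\<close> and \<open>\<xi>(0)\<close>, and the boundary condition becomes a linear
  equation for \<open>\<xi>(0)\<close> with coefficient \<open>char_fun \<theta> z\<close>. Uniform bounds for \<open>\<xi>\<close> and \<open>\<xi>'\<close> then give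
  the bound in norm.
\<close>

lemma bounded_below:
  assumes z: "char_fun \<theta> z \<noteq> 0"
  obtains M where "0 \<le> M"
    "\<And>\<xi> \<eta>. (\<xi>, \<eta>) \<in> A_graph F \<theta> \<Longrightarrow> H.nrm \<xi> \<le> M * H.nrm (\<lambda>t. \<eta> t - z * \<xi> t)"
proof -
  define E where "E = exp (cmod z)"
  define K0 where "K0 = (2 + (1 + cmod z) * E * E) / cmod (char_fun \<theta> z)"
  define K where "K = E * (K0 + E)"
  have E1: "1 \<le> E" by (simp add: E_def)
  have K0: "0 \<le> K0" unfolding K0_def using E1 by (intro divide_nonneg_nonneg add_nonneg_nonneg mult_nonneg_nonneg) auto
  have K: "0 \<le> K" unfolding K_def using E1 K0 by simp
  show ?thesis
  proof (rule that[of "K + (K + (1 + cmod z * K))"])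
    show "0 \<le> K + (K + (1 + cmod z * K))" using K by simp
    fix \<xi> \<eta> assume A: "(\<xi>, \<eta>) \<in> A_graph F \<theta>"
    note bvp = A_graph_bvp[OF A]
    define \<zeta> where "\<zeta> = (\<lambda>t. \<eta> t - z * \<xi> t)"
    have \<xi>m: "\<xi> \<in> rkhs F" by (rule deriv_pair_mem(1)[OF bvp(2)])
    have \<zeta>m: "\<zeta> \<in> rkhs F" unfolding \<zeta>_def by (intro H.diff_mem H.scale_mem bvp \<xi>m)
    define N where "N = H.nrm \<zeta>"
    have N: "0 \<le> N" unfolding N_def by (rule H.nrm_nonneg[OF \<zeta>m])
    have Z: "cmod (cext \<zeta> x) \<le> N" if "x \<in> {0..1}" for x
      unfolding N_def by (rule cext_bound[OF \<zeta>m that])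
    have \<eta>ex: "cext \<eta> x = cext \<zeta> x + z * cext \<xi> x" if "x \<in> {0..1}" for x
    proof -
      have "\<eta> = (\<lambda>t. \<zeta> t + z * \<xi> t)" by (simp add: \<zeta>_def)
      then show ?thesis using cext_lin[OF \<zeta>m \<xi>m that] by simp
    qed
    have eq: "cext \<xi> x = cext \<xi> 0 + integral {0..x} (\<lambda>t. \<i> * (cext \<zeta> t + z * cext \<xi> t))" if x: "x \<in> {0..1}" for x
    proof -
      have "integral {0..x} (cext (\<lambda>t. \<i> * \<eta> t)) = integral {0..x} (\<lambda>t. \<i> * (cext \<zeta> t + z * cext \<xi> t))"
        by (rule integral_cong) (use x in \<open>simp add: cext_scale bvp \<eta>ex\<close>)
      then show ?thesis using deriv_pair_eq[OF bvp(2) x] by simp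
    qed
    define I where "I = (\<lambda>x. integral {0..x} (\<lambda>t. \<i> * exp (- \<i> * z * of_real t) * cext \<zeta> t))"
    have sol: "cext \<xi> x = exp (\<i> * z * of_real x) * (cext \<xi> 0 + I x)" if "x \<in> {0..1}" for x
      unfolding I_def by (rule variation_of_constants[OF cext_continuous[OF \<xi>m] cext_continuous[OF \<zeta>m] eq that])
    have exp_le: "cmod (exp (\<i> * z * of_real x)) \<le> E" "cmod (exp (- \<i> * z * of_real x)) \<le> E" if "x \<in> {0..1}" for x
    proof -
      have "cmod (\<i> * z * of_real x) \<le> cmod z" "cmod (- \<i> * z * of_real x) \<le> cmod z"
        using that by (simp_all add: norm_mult mult_left_le)
      then show "cmod (exp (\<i> * z * of_real x)) \<le> E" "cmod (exp (- \<i> * z * of_real x)) \<le> E"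
        unfolding E_def using cmod_exp_le order_trans exp_le_cancel_iff by blast+
    qed
    have I: "cmod (I x) \<le> E * N" if x: "x \<in> {0..1}" for x
    proof -
      have "cmod (I x) \<le> (E * N) * (x - 0)"
        unfolding I_def
      proof (rule integral_bound)
        show "continuous_on {0..x} (\<lambda>t. \<i> * exp (- \<i> * z * of_real t) * cext \<zeta> t)"
          using x by (intro continuous_intros continuous_on_subset[OF cext_continuous[OF \<zeta>m]]) auto
        fix t assume "t \<in> {0..x}"
        then have t: "t \<in> {0..1}" using x by auto
        have "cmod (\<i> * exp (- \<i> * z * of_real t) * cext \<zeta> t) = cmod (exp (- \<i> * z * of_real t)) * cmod (cext \<zeta> t)"
          by (simp add: norm_mult)
        also have "\<dots> \<le> E * N" by (rule mult_mono[OF exp_le(2)[OF t] Z[OF t]]) (use E1 in auto)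
        finally show "cmod (\<i> * exp (- \<i> * z * of_real t) * cext \<zeta> t) \<le> E * N" .
      qed (use x in auto)
      also have "\<dots> \<le> (E * N) * 1" using x E1 N by (intro mult_left_mono) auto
      finally show ?thesis by simp
    qed
    have "char_fun \<theta> z * cext \<xi> 0 = - \<i> * cext \<zeta> 1 - \<i> * cis \<theta> * cext \<zeta> 0 - (1 + \<i> * z) * exp (\<i> * z) * I 1"
    proof -
      have s1: "cext \<xi> 1 = exp (\<i> * z) * (cext \<xi> 0 + I 1)" using sol[of 1] by simp
      have "\<i> * (cext \<zeta> 1 + z * cext \<xi> 1) + cext \<xi> 1 = cis \<theta> * (cext \<xi> 0 - \<i> * (cext \<zeta> 0 + z * cext \<xi> 0))"
        using bvp(3) \<eta>ex[of 0] \<eta>ex[of 1] by simp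
      then have b: "(1 + \<i> * z) * cext \<xi> 1 = cis \<theta> * (1 - \<i> * z) * cext \<xi> 0 - \<i> * cext \<zeta> 1 - \<i> * cis \<theta> * cext \<zeta> 0"
        by (simp add: algebra_simps)
      then show ?thesis unfolding s1 char_fun_def by (simp add: algebra_simps)
    qed
    then have "cmod (char_fun \<theta> z) * cmod (cext \<xi> 0) =
        cmod (- \<i> * cext \<zeta> 1 - \<i> * cis \<theta> * cext \<zeta> 0 - (1 + \<i> * z) * exp (\<i> * z) * I 1)"
      by (simp only: norm_mult[symmetric])
    also have "\<dots> \<le> N + N + (1 + cmod z) * E * (E * N)"
    proof (rule order_trans[OF norm_triangle_ineq4] , rule add_mono)
      show "cmod (- \<i> * cext \<zeta> 1 - \<i> * cis \<theta> * cext \<zeta> 0) \<le> N + N"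
        by (rule order_trans[OF norm_triangle_ineq4]) (use Z[of 0] Z[of 1] in \<open>simp add: norm_mult\<close>)
      have "cmod (1 + \<i> * z) \<le> 1 + cmod z" using norm_triangle_ineq[of 1 "\<i> * z"] by (simp add: norm_mult)
      then show "cmod ((1 + \<i> * z) * exp (\<i> * z) * I 1) \<le> (1 + cmod z) * E * (E * N)"
        unfolding norm_mult using exp_le(1)[of 1] I[of 1] E1 N by (intro mult_mono) auto
    qed
    also have "\<dots> = cmod (char_fun \<theta> z) * (K0 * N)"
    proof -
      have "cmod (char_fun \<theta> z) * K0 = 2 + (1 + cmod z) * E * E" using z by (simp add: K0_def)
      then have "cmod (char_fun \<theta> z) * K0 * N = (2 + (1 + cmod z) * E * E) * N" by (simp only:)
      then show ?thesis by (simp add: algebra_simps)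
    qed
    finally have U0: "cmod (cext \<xi> 0) \<le> K0 * N" using z by simp
    have U: "cmod (cext \<xi> x) \<le> K * N" if x: "x \<in> {0..1}" for x
    proof -
      have "cmod (cext \<xi> x) \<le> E * (K0 * N + E * N)"
        unfolding sol[OF x] norm_mult
        by (intro mult_mono exp_le x order_trans[OF norm_triangle_ineq] add_mono U0 I) (use E1 in auto)
      then show ?thesis by (simp add: K_def algebra_simps)
    qed
    have "H.nrm \<xi> \<le> K * N + (K * N + (N + cmod z * (K * N)))"
    proof (rule nrm_deriv_pair[OF bvp(2) U])
      fix x :: real assume x: "x \<in> {0..1}"
      have "cmod (cext (\<lambda>t. \<i> * \<eta> t) x) = cmod (cext \<zeta> x + z * cext \<xi> x)"
        by (simp only: cext_scale[OF bvp(1) x] \<eta>ex[OF x] norm_mult) simp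
      also have "\<dots> \<le> N + cmod z * (K * N)"
        by (rule norm_triangle_mono[OF Z[OF x]]) (simp only: norm_mult mult_left_mono[OF U[OF x] norm_ge_zero])
      finally show "cmod (cext (\<lambda>t. \<i> * \<eta> t) x) \<le> N + cmod z * (K * N)" .
    qed
    then show "H.nrm \<xi> \<le> (K + (K + (1 + cmod z * K))) * H.nrm (\<lambda>t. \<eta> t - z * \<xi> t)"
      by (simp add: N_def[symmetric] \<zeta>_def[symmetric] algebra_simps)
  qed
qed

lemma inner_shifted_smear:
  assumes \<phi>: "\<phi> \<in> test_funs01" and w: "w \<in> rkhs F"
  shows "rkhs_inner F (\<lambda>t. - \<i> * smear F (vderiv \<phi>) t - z * smear F \<phi> t) w =
    integral {0..1} (\<lambda>t. (\<i> * cnj (vderiv \<phi> t) - cnj z * cnj (\<phi> t)) * cext w t)"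
proof -
  have c: "continuous_on {0..1} \<phi>" "continuous_on {0..1} (vderiv \<phi>)"
    using \<phi> by (auto intro: test_fun_continuous test_fun_vderiv_continuous)
  note m = smear_mem[OF c(1)] smear_mem[OF c(2)]
  have "rkhs_inner F (\<lambda>t. - \<i> * smear F (vderiv \<phi>) t - z * smear F \<phi> t) w =
      \<i> * rkhs_inner F (smear F (vderiv \<phi>)) w - cnj z * rkhs_inner F (smear F \<phi>) w"
    using H.B_diff_left[OF H.scale_mem[OF m(2)] H.scale_mem[OF m(1)] w, of "- \<i>" z]
      H.B_scale_left[OF m(2) w, of "- \<i>"] H.B_scale_left[OF m(1) w, of z] by simp
  also have "\<dots> = \<i> * integral {0..1} (\<lambda>t. cnj (vderiv \<phi> t) * cext w t) - cnj z * integral {0..1} (\<lambda>t. cnj (\<phi> t) * cext w t)"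
    by (simp only: inner_smear[OF c(1) w] inner_smear[OF c(2) w])
  also have "\<dots> = integral {0..1} (\<lambda>t. \<i> * (cnj (vderiv \<phi> t) * cext w t)) - integral {0..1} (\<lambda>t. cnj z * (cnj (\<phi> t) * cext w t))"
    by (simp only: integral_mult_right)
  also have "\<dots> = integral {0..1} (\<lambda>t. \<i> * (cnj (vderiv \<phi> t) * cext w t) - cnj z * (cnj (\<phi> t) * cext w t))"
    by (rule integral_diff[symmetric]) (intro integrable_continuous_real continuous_intros c cext_continuous w)+
  also have "(\<lambda>t. \<i> * (cnj (vderiv \<phi> t) * cext w t) - cnj z * (cnj (\<phi> t) * cext w t)) =
      (\<lambda>t. (\<i> * cnj (vderiv \<phi> t) - cnj z * cnj (\<phi> t)) * cext w t)"
    by (simp add: fun_eq_iff algebra_simps)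
  finally show ?thesis .
qed

lemma cnj_test_derivative:
  assumes \<phi>: "\<phi> \<in> test_funs01"
  shows "((\<lambda>t. cnj (\<phi> t)) has_vector_derivative cnj (vderiv \<phi> t)) (at t within S)"
  using bounded_linear.has_vector_derivative[OF bounded_linear_cnj
      has_vector_derivative_at_within[OF test_fun_derivative[OF \<phi>]]] .

text \<open>
  A vector orthogonal to \<open>(-\<i> D - z) smear F \<phi>\<close> for all \<open>\<phi>\<close> is a weak solution of
  \<open>w' = \<i> z\<^sup>* w\<close>, where \<open>z\<^sup>*\<close> is the conjugate. Integrating the term with \<open>\<phi>\<close> by parts against
  the primitive \<open>P\<close> of \<open>w\<close> leaves only \<open>\<phi>'\<close>, so that \<open>\<i> w + z\<^sup>* P\<close> is constant by the lemma of
  du Bois-Reymond, and \<open>w\<close> is differentiable after all.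
\<close>

lemma orthogonal_exponential:
  assumes w: "w \<in> rkhs F"
    and orth: "\<And>\<phi>. \<phi> \<in> test_funs01 \<Longrightarrow>
      rkhs_inner F (\<lambda>t. - \<i> * smear F (vderiv \<phi>) t - z * smear F \<phi> t) w = 0"
    and x: "x \<in> {0..1}"
  shows "cext w x = cext w 0 * exp (\<i> * cnj z * of_real x)"
proof -
  have cw: "continuous_on {0..1} (cext w)" by (rule cext_continuous[OF w])
  define P where "P = (\<lambda>x. integral {0..x} (cext w))"
  have dP: "(P has_vector_derivative cext w t) (at t within {0..1})" if "t \<in> {0..1}" for t
    unfolding P_def by (rule integral_has_vector_derivative[OF cw that])
  have cP: "continuous_on {0..1} P"
    unfolding continuous_on_eq_continuous_within by (intro ballI has_vector_derivative_continuous[OF dP])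
  \<comment> \<open>The integrand of the orthogonality relation after moving the derivative onto
    \<open>\<phi>\<close>.\<close>
  define u where "u = (\<lambda>t. \<i> * cext w t + cnj z * P t)"
  have cu: "continuous_on {0..1} u" unfolding u_def by (intro continuous_intros cw cP)
  have dBR: "integral {0..1} (\<lambda>t. cnj (vderiv \<phi> t) * u t) = 0" if \<phi>: "\<phi> \<in> test_funs01" for \<phi>
  proof -
    have c: "continuous_on {0..1} \<phi>" "continuous_on {0..1} (vderiv \<phi>)"
      using \<phi> by (auto intro: test_fun_continuous test_fun_vderiv_continuous)
    have "((\<lambda>t. cnj (\<phi> t) * cext w t + cnj (vderiv \<phi> t) * P t) has_integral cnj (\<phi> 1) * P 1 - cnj (\<phi> 0) * P 0) {0..1}"
      by (rule fundamental_theorem_of_calculus)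
         (auto intro!: has_vector_derivative_mult cnj_test_derivative \<phi> dP)
    then have i1: "((\<lambda>t. cnj (\<phi> t) * cext w t + cnj (vderiv \<phi> t) * P t) has_integral 0) {0..1}"
      using test_fun_vanish[OF \<phi>, of 0] test_fun_vanish[OF \<phi>, of 1] by simp
    have "(\<lambda>t. (\<i> * cnj (vderiv \<phi> t) - cnj z * cnj (\<phi> t)) * cext w t) integrable_on {0..1}"
      by (intro integrable_continuous_real continuous_intros c cw)
    then have i2: "((\<lambda>t. (\<i> * cnj (vderiv \<phi> t) - cnj z * cnj (\<phi> t)) * cext w t) has_integral 0) {0..1}"
      using orth[OF \<phi>] unfolding inner_shifted_smear[OF \<phi> w] by (simp add: has_integral_integral)
    have "((\<lambda>t. (\<i> * cnj (vderiv \<phi> t) - cnj z * cnj (\<phi> t)) * cext w t +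
        cnj z * (cnj (\<phi> t) * cext w t + cnj (vderiv \<phi> t) * P t)) has_integral 0 + cnj z * 0) {0..1}"
      by (intro has_integral_add has_integral_mult_right i1 i2)
    then have "((\<lambda>t. cnj (vderiv \<phi> t) * u t) has_integral 0) {0..1}"
      by (simp add: u_def algebra_simps)
    then show ?thesis by (rule integral_unique)
  qed
  have half: "u t = u (1/2)" if "t \<in> {0..1}" for t
    by (rule continuous_eq_on_closed01[OF cu continuous_on_const _ that])
       (rule du_Bois_Reymond[OF cu dBR]; simp)
  have "cext w x = exp (\<i> * cnj z * of_real x) * (cext w 0 + integral {0..x} (\<lambda>t. \<i> * exp (- \<i> * cnj z * of_real t) * 0))"
  proof (rule variation_of_constants[OF cw continuous_on_const _ x])
    fix t :: real assume t: "t \<in> {0..1}"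
    have "u t = u 0" using half[OF t] half[of 0] by simp
    moreover have "P 0 = 0" by (simp add: P_def)
    ultimately have "\<i> * cext w t + cnj z * P t = \<i> * cext w 0" by (simp add: u_def)
    then have "- \<i> * (\<i> * cext w t + cnj z * P t) = - \<i> * (\<i> * cext w 0)" by (simp only:)
    then have "cext w t = cext w 0 + \<i> * cnj z * P t" by (simp add: algebra_simps)
    then show "cext w t = cext w 0 + integral {0..t} (\<lambda>t. \<i> * (0 + cnj z * cext w t))"
      by (simp add: P_def)
  qed
  then show ?thesis by simp
qed

definition wave :: "complex \<Rightarrow> real \<Rightarrow> complex" where
  "wave k = on01 (\<lambda>t. exp (\<i> * k * of_real t))"

lemma exp_linear_vector_derivative:
  fixes k :: complex
  shows "((\<lambda>t. exp (k * of_real t)) has_vector_derivative k * exp (k * of_real t)) (at t within S)"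
  by (rule has_vector_derivative_real_field) (auto intro!: derivative_eq_intros)

text \<open>
  The exponential solves \<open>f' + f = (1 + \<i> k) f\<close> with \<open>f(0) = 1\<close>.
\<close>

lemma wave_mem: "wave k \<in> rkhs F"
proof (rule nrm_le_sup(1)[where p = "\<lambda>t. (1 + \<i> * k) * exp (\<i> * k * of_real t)" and b = 1 and
      P = "cmod (1 + \<i> * k) * exp (cmod k)" and K = 1])
  show "wave k x = 0" if "\<not> (0 < x \<and> x < 1)" for x using that by (auto simp: wave_def on01_def)
  show "continuous_on {0..1} (\<lambda>t. (1 + \<i> * k) * exp (\<i> * k * of_real t))" by (intro continuous_intros)
  fix t :: real assume t: "t \<in> {0..1}"
  have "cmod (\<i> * k * of_real t) \<le> cmod k" using t by (simp add: norm_mult mult_left_le)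
  then have "cmod (exp (\<i> * k * of_real t)) \<le> exp (cmod k)"
    using order_trans[OF cmod_exp_le] exp_le_cancel_iff by blast
  then show "cmod ((1 + \<i> * k) * exp (\<i> * k * of_real t)) \<le> cmod (1 + \<i> * k) * exp (cmod k)"
    unfolding norm_mult by (intro mult_left_mono) auto
next
  fix x :: real assume x: "0 < x" "x < 1"
  have "((\<lambda>t. of_real (exp (t - x)) * ((1 + \<i> * k) * exp (\<i> * k * of_real t))) has_integral
     of_real (exp (x - x)) * exp (\<i> * k * of_real x) - of_real (exp (0 - x)) * exp (\<i> * k * of_real 0)) {0..x}"
  proof (rule fundamental_theorem_of_calculus)
    fix t :: real
    have "((\<lambda>y. complex_of_real (exp (y - x))) has_vector_derivative of_real (exp (t - x))) (at t within {0..x})"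
      by (intro has_vector_derivative_of_real)
         (auto simp: has_real_derivative_iff_has_vector_derivative[symmetric] intro!: derivative_eq_intros)
    from has_vector_derivative_mult[OF this exp_linear_vector_derivative[of "\<i> * k"]]
    show "((\<lambda>t. of_real (exp (t - x)) * exp (\<i> * k * of_real t)) has_vector_derivative
        of_real (exp (t - x)) * ((1 + \<i> * k) * exp (\<i> * k * of_real t))) (at t within {0..x})"
      by (rule has_vector_derivative_eq_rhs) (simp add: algebra_simps)
  qed (use x in auto)
  then show "wave k x = of_real (exp (- x)) * 1 + integral {0..x} (\<lambda>t. of_real (exp (t - x)) * ((1 + \<i> * k) * exp (\<i> * k * of_real t)))"
    using x by (simp add: wave_def on01_def integral_unique)
qed simp

lemma cext_wave: "x \<in> {0..1} \<Longrightarrow> cext (wave k) x = exp (\<i> * k * of_real x)"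
  by (rule cext_eqI[OF wave_mem]) (auto simp: wave_def on01_def intro!: continuous_intros)

text \<open>
  Inner products with the defect vectors are boundary values.
\<close>

lemma inner_bdry_part:
  assumes w: "w \<in> rkhs F"
  shows "rkhs_inner F (\<lambda>t. \<i> * c * defect_vec \<theta> (-1) t - z * (c * defect_vec \<theta> 1 t)) w =
    cnj (c * (\<i> - z)) * cext w 0 - cnj (c * (\<i> + z) * cis \<theta>) * cext w 1"
proof -
  have "(\<lambda>t. \<i> * c * defect_vec \<theta> (-1) t - z * (c * defect_vec \<theta> 1 t)) =
      (\<lambda>t. (c * (\<i> - z)) * kern 0 t - (c * (\<i> + z) * cis \<theta>) * kern 1 t)"
    by (simp add: defect_vec_def fun_eq_iff algebra_simps)
  then show ?thesis
    by (simp only: H.B_diff_left H.scale_mem kern_bdry_mem w H.B_scale_left cext_def)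
qed

lemma char_fun_cnj:
  "(\<i> - z) - (\<i> + z) * cis \<theta> * exp (- \<i> * z) = \<i> * exp (- \<i> * z) * char_fun \<theta> z"
proof -
  have e: "exp (- \<i> * z) * exp (\<i> * z) = 1" by (simp add: exp_add[symmetric])
  have "\<i> * exp (- \<i> * z) * char_fun \<theta> z =
      \<i> * (1 + \<i> * z) * (exp (- \<i> * z) * exp (\<i> * z)) - \<i> * (1 - \<i> * z) * cis \<theta> * exp (- \<i> * z)"
  proof -
    have "\<i> * a * ((1 + \<i> * z) * b - c * (1 - \<i> * z)) = \<i> * (1 + \<i> * z) * (a * b) - \<i> * (1 - \<i> * z) * c * a"
      for a b c by (simp add: algebra_simps)
    then show ?thesis unfolding char_fun_def .
  qed
  then show ?thesis unfolding e by (simp add: algebra_simps)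
qed

lemma nrm_eq_0_cext: "w \<in> rkhs F \<Longrightarrow> (\<And>x. x \<in> {0..1} \<Longrightarrow> cext w x = 0) \<Longrightarrow> w = (\<lambda>t. 0)"
proof
  fix t assume w: "w \<in> rkhs F" "\<And>x. x \<in> {0..1} \<Longrightarrow> cext w x = 0"
  show "w t = 0"
    using rkhs_vanish[OF w(1), of t] cext_interior[OF w(1), of t] w(2)[of t] by (cases "0 < t \<and> t < 1") auto
qed

text \<open>
  At a zero of \<open>char_fun\<close> the exponential is orthogonal to the range of \<open>A\<^sub>\<theta> - z\<close>: on the
  derivation the inner product is the integral of the derivative of a compactly supported
  function, and on the defect vector it is a multiple of the conjugate of \<open>char_fun \<theta> z\<close>.
\<close>

lemma wave_orthogonal_range:
  assumes z: "char_fun \<theta> z = 0" and A: "(\<xi>, \<eta>) \<in> A_graph F \<theta>"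
  shows "rkhs_inner F (\<lambda>t. \<eta> t - z * \<xi> t) (wave (cnj z)) = 0"
proof -
  let ?w = "wave (cnj z)"
  have w: "?w \<in> rkhs F" by (rule wave_mem)
  have D: "rkhs_inner F (\<lambda>t. - \<i> * r t - z * s t) ?w = 0" if sr: "(s, r) \<in> D_graph F" for s r
  proof -
    obtain \<phi> where \<phi>: "\<phi> \<in> test_funs01" "s = smear F \<phi>" "r = smear F (vderiv \<phi>)"
      using sr unfolding D_graph_def by blast
    have "((\<lambda>t. \<i> * (cnj (\<phi> t) * (\<i> * cnj z * exp (\<i> * cnj z * of_real t)) + cnj (vderiv \<phi> t) * exp (\<i> * cnj z * of_real t))) has_integral
      \<i> * (cnj (\<phi> 1) * exp (\<i> * cnj z * of_real 1) - cnj (\<phi> 0) * exp (\<i> * cnj z * of_real 0))) {0..1}"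
      by (intro has_integral_mult_right fundamental_theorem_of_calculus has_vector_derivative_mult
          cnj_test_derivative \<phi> exp_linear_vector_derivative) simp
    then have "((\<lambda>t. (\<i> * cnj (vderiv \<phi> t) - cnj z * cnj (\<phi> t)) * exp (\<i> * cnj z * of_real t)) has_integral 0) {0..1}"
      using test_fun_vanish[OF \<phi>(1), of 0] test_fun_vanish[OF \<phi>(1), of 1] by (simp add: algebra_simps)
    then have "((\<lambda>t. (\<i> * cnj (vderiv \<phi> t) - cnj z * cnj (\<phi> t)) * cext ?w t) has_integral 0) {0..1}"
      by (rule has_integral_eq[rotated]) (simp add: cext_wave)
    then show ?thesis unfolding \<phi> inner_shifted_smear[OF \<phi>(1) w] by (rule integral_unique)
  qed
  obtain h h' c where h: "(h, h') \<in> op_closure F (D_graph F)"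
    and \<xi>: "\<xi> = (\<lambda>t. h t + c * defect_vec \<theta> 1 t)" and \<eta>: "\<eta> = (\<lambda>t. - \<i> * h' t + \<i> * c * defect_vec \<theta> (-1) t)"
    using A unfolding A_graph_eq ext_graph_def by blast
  obtain s r where m: "h \<in> rkhs F" "h' \<in> rkhs F" and sr: "\<And>n. (s n, r n) \<in> D_graph F"
    and lim: "(\<lambda>n. H.nrm (\<lambda>t. s n t - h t)) \<longlonglongrightarrow> 0" "(\<lambda>n. H.nrm (\<lambda>t. r n t - h' t)) \<longlonglongrightarrow> 0"
    using h unfolding op_closure_def rkhs_tendsto_def rkhs_norm_eq by blast
  note mem = robin_pair_mem[OF D_graph_robin[OF sr]]
  have hm: "(\<lambda>t. - \<i> * h' t - z * h t) \<in> rkhs F" by (intro H.diff_mem H.scale_mem m)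
  have "rkhs_inner F (\<lambda>t. - \<i> * h' t - z * h t) ?w = 0"
  proof -
    have scaled: "rkhs_inner F (\<lambda>t. - \<i> * b t - z * a t) ?w = \<i> * rkhs_inner F (\<lambda>t. b t + - \<i> * z * a t) ?w"
      if "a \<in> rkhs F" "b \<in> rkhs F" for a b
    proof -
      have "(\<lambda>t. - \<i> * b t - z * a t) = (\<lambda>t. - \<i> * (b t + - \<i> * z * a t))"
        by (simp add: fun_eq_iff algebra_simps)
      then show ?thesis
        using H.B_scale_left[OF H.add_mem[OF that(2) H.scale_mem[OF that(1)]] w, of "- \<i>" "- \<i> * z"] by simp
    qed
    have "(\<lambda>n. rkhs_inner F (\<lambda>t. r n t + - \<i> * z * s n t) ?w) \<longlonglongrightarrow> rkhs_inner F (\<lambda>t. h' t + - \<i> * z * h t) ?w"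
      by (rule H.B_tendsto_left[OF _ _ w H.nrm_tendsto_lin[OF mem(2,1) m(2,1) lim(2,1)]])
         (intro H.add_mem H.scale_mem mem m)+
    moreover have "rkhs_inner F (\<lambda>t. r n t + - \<i> * z * s n t) ?w = 0" for n
      using scaled[OF mem] D[OF sr, of n] by simp
    ultimately show ?thesis using scaled[OF m] by (simp add: LIMSEQ_const_iff)
  qed
  moreover have "rkhs_inner F (\<lambda>t. \<i> * c * defect_vec \<theta> (-1) t - z * (c * defect_vec \<theta> 1 t)) ?w = 0"
  proof -
    have "rkhs_inner F (\<lambda>t. \<i> * c * defect_vec \<theta> (-1) t - z * (c * defect_vec \<theta> 1 t)) ?w =
        cnj (c * ((\<i> - z) - (\<i> + z) * cis \<theta> * exp (- \<i> * z)))"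
      unfolding inner_bdry_part[OF w] by (simp add: cext_wave exp_cnj algebra_simps)
    then show ?thesis unfolding char_fun_cnj z by simp
  qed
  moreover have "rkhs_inner F (\<lambda>t. \<eta> t - z * \<xi> t) ?w =
      rkhs_inner F (\<lambda>t. - \<i> * h' t - z * h t) ?w + rkhs_inner F (\<lambda>t. \<i> * c * defect_vec \<theta> (-1) t - z * (c * defect_vec \<theta> 1 t)) ?w"
  proof -
    have "(\<lambda>t. \<i> * c * defect_vec \<theta> (-1) t - z * (c * defect_vec \<theta> 1 t)) \<in> rkhs F"
      by (intro H.diff_mem H.scale_mem defect_vec_mem)
    from H.B_add_left[OF hm this w] show ?thesis by (simp add: \<xi> \<eta> algebra_simps)
  qed
  ultimately show ?thesis by simp
qed

text \<open>
  Orthogonality to the range on smeared kernels leaves a multiple of the exponential;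
  orthogonality to the image of the defect vector multiplies the constant by a nonzero number.
\<close>

lemma range_orthocomplement:
  assumes z: "char_fun \<theta> z \<noteq> 0" and w: "w \<in> rkhs F"
    and orth: "\<And>\<xi> \<eta>. (\<xi>, \<eta>) \<in> ext_graph \<theta> (D_graph F) \<Longrightarrow> rkhs_inner F (\<lambda>t. \<eta> t - z * \<xi> t) w = 0"
  shows "w = (\<lambda>t. 0)"
proof (rule nrm_eq_0_cext[OF w])
  have D: "rkhs_inner F (\<lambda>t. - \<i> * smear F (vderiv \<phi>) t - z * smear F \<phi> t) w = 0" if "\<phi> \<in> test_funs01" for \<phi>
  proof -
    have "(smear F \<phi>, smear F (vderiv \<phi>)) \<in> D_graph F" using that unfolding D_graph_def by blast
    then have "(\<lambda>t. smear F \<phi> t + 0 * defect_vec \<theta> 1 t, \<lambda>t. - \<i> * smear F (vderiv \<phi>) t + \<i> * 0 * defect_vec \<theta> (-1) t) \<in> ext_graph \<theta> (D_graph F)"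
      unfolding ext_graph_def by blast
    from orth[OF this] show ?thesis by simp
  qed
  have ex: "cext w x = cext w 0 * exp (\<i> * cnj z * of_real x)" if "x \<in> {0..1}" for x
    by (rule orthogonal_exponential[OF w D that])
  have "(\<lambda>t. 0 + 1 * defect_vec \<theta> 1 t, \<lambda>t. - \<i> * 0 + \<i> * 1 * defect_vec \<theta> (-1) t) \<in> ext_graph \<theta> (D_graph F)"
    using D_graph_zero unfolding ext_graph_def mem_Collect_eq
    by (intro exI[of _ "\<lambda>t. 0"] exI[of _ "1::complex"]) simp
  from orth[OF this] have "rkhs_inner F (\<lambda>t. \<i> * 1 * defect_vec \<theta> (-1) t - z * (1 * defect_vec \<theta> 1 t)) w = 0"
    by simp
  then have 1: "cnj (\<i> - z) * cext w 0 - cnj ((\<i> + z) * cis \<theta>) * (cext w 0 * exp (\<i> * cnj z)) = 0"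
    unfolding inner_bdry_part[OF w] using ex[of 1] by simp
  have 2: "cnj (\<i> - z) * cext w 0 - cnj ((\<i> + z) * cis \<theta>) * (cext w 0 * exp (\<i> * cnj z)) =
      cnj ((\<i> - z) - (\<i> + z) * cis \<theta> * exp (- \<i> * z)) * cext w 0"
    by (simp add: exp_cnj algebra_simps)
  have "cext w 0 = 0" using 1 z unfolding 2 char_fun_cnj by simp
  then show "cext w x = 0" if "x \<in> {0..1}" for x using ex[OF that] by simp
qed

lemma ext_graph_mono: "G \<subseteq> G' \<Longrightarrow> ext_graph \<theta> G \<subseteq> ext_graph \<theta> G'"
  unfolding ext_graph_def by blast

lemma ext_D_graph_subset: "ext_graph \<theta> (D_graph F) \<subseteq> A_graph F \<theta>"
  unfolding A_graph_eq by (rule ext_graph_mono) (use D_graph_closure in auto)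

text \<open>
  The Robin conditions make the coefficient of the defect vector a combination of boundary
  values, hence continuous in the graph norm.
\<close>

lemma ext_graph_coefficient:
  assumes h: "robin_pair h h'" and \<xi>: "\<xi> = (\<lambda>t. h t + c * defect_vec \<theta> 1 t)"
    and \<eta>: "\<eta> = (\<lambda>t. - \<i> * h' t + \<i> * c * defect_vec \<theta> (-1) t)"
  shows "c = (cext \<xi> 0 - \<i> * cext \<eta> 0) / 2"
proof -
  note m = robin_pair_mem[OF h]
  have 1: "cext \<xi> 0 = cext h 0 + c * cext (defect_vec \<theta> 1) 0"
    unfolding \<xi> by (rule cext_lin) (simp_all add: m defect_vec_mem)
  have 2: "cext \<eta> 0 = - \<i> * cext h' 0 + \<i> * c * cext (defect_vec \<theta> (-1)) 0"
    unfolding \<eta> using cext_lin[OF H.scale_mem[OF m(2), of "- \<i>"] defect_vec_mem, of 0 "\<i> * c" \<theta> "-1"]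
      cext_scale[OF m(2), of 0 "- \<i>"] by simp
  have "cext \<xi> 0 - \<i> * cext \<eta> 0 = 2 * c"
    unfolding 1 2 using h by (simp add: robin_pair_def cext_defect_vec algebra_simps)
  then show ?thesis by simp
qed

text \<open>
  A convergent sequence in the extension splits into convergent parts: the coefficients of the
  defect vector converge, hence so do the remainders.
\<close>

lemma graph_limit_mem:
  assumes G: "\<And>n. (x n, y n) \<in> ext_graph \<theta> (D_graph F)"
    and m: "\<xi> \<in> rkhs F" "\<eta> \<in> rkhs F"
    and lim: "(\<lambda>n. H.nrm (\<lambda>t. x n t - \<xi> t)) \<longlonglongrightarrow> 0" "(\<lambda>n. H.nrm (\<lambda>t. y n t - \<eta> t)) \<longlonglongrightarrow> 0"
  shows "(\<xi>, \<eta>) \<in> A_graph F \<theta>"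
proof -
  have A: "(x n, y n) \<in> A_graph F \<theta>" for n using G[of n] ext_D_graph_subset by blast
  have xm: "x n \<in> rkhs F" and ym: "y n \<in> rkhs F" for n
    using A_graph_bvp(1)[OF A] deriv_pair_mem(1)[OF A_graph_bvp(2)[OF A]] by blast+
  define c where "c = (\<lambda>n. (cext (x n) 0 - \<i> * cext (y n) 0) / 2)"
  define s where "s = (\<lambda>n t. x n t - c n * defect_vec \<theta> 1 t)"
  define r where "r = (\<lambda>n t. \<i> * y n t + c n * defect_vec \<theta> (-1) t)"
  have sr: "(s n, r n) \<in> D_graph F" for n
  proof -
    obtain h h' k where h: "(h, h') \<in> D_graph F" and xn: "x n = (\<lambda>t. h t + k * defect_vec \<theta> 1 t)"
      and yn: "y n = (\<lambda>t. - \<i> * h' t + \<i> * k * defect_vec \<theta> (-1) t)"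
      using G[of n] unfolding ext_graph_def by blast
    have k: "c n = k" unfolding c_def by (rule ext_graph_coefficient[OF D_graph_robin[OF h] xn yn, symmetric])
    have "s n = h" "r n = h'" unfolding s_def r_def k unfolding xn yn by (simp_all add: fun_eq_iff algebra_simps)
    then show ?thesis using h by simp
  qed
  define c0 where "c0 = (cext \<xi> 0 - \<i> * cext \<eta> 0) / 2"
  have "c \<longlonglongrightarrow> c0"
    unfolding c0_def c_def
    by (intro tendsto_divide tendsto_diff tendsto_mult tendsto_const cext_tendsto[OF xm m(1) lim(1)]
        cext_tendsto[OF ym m(2) lim(2)]) simp_all
  then have c0: "(\<lambda>n. cmod (c n - c0)) \<longlonglongrightarrow> 0"
    by (intro tendsto_norm_zero) (simp add: LIM_zero)
  define h where "h = (\<lambda>t. \<xi> t - c0 * defect_vec \<theta> 1 t)"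
  define h' where "h' = (\<lambda>t. \<i> * \<eta> t + c0 * defect_vec \<theta> (-1) t)"
  have hm: "h \<in> rkhs F" "h' \<in> rkhs F"
    unfolding h_def h'_def by (intro H.add_mem H.diff_mem H.scale_mem m defect_vec_mem)+
  have bl: "(\<lambda>n. H.nrm (\<lambda>t. c n * defect_vec \<theta> \<sigma> t - c0 * defect_vec \<theta> \<sigma> t)) \<longlonglongrightarrow> 0" for \<sigma>
    using tendsto_mult_right[OF c0, of "H.nrm (defect_vec \<theta> \<sigma>)"]
    by (simp add: H.nrm_scale[OF defect_vec_mem] left_diff_distrib[symmetric])
  have s: "(\<lambda>n. H.nrm (\<lambda>t. s n t - h t)) \<longlonglongrightarrow> 0"
    using H.nrm_tendsto_lin[OF xm H.scale_mem[OF defect_vec_mem] m(1) H.scale_mem[OF defect_vec_mem] lim(1) bl, where c = "-1"]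
    by (simp add: s_def h_def)
  have r: "(\<lambda>n. H.nrm (\<lambda>t. r n t - h' t)) \<longlonglongrightarrow> 0"
    using H.nrm_tendsto_lin[OF H.scale_mem[OF defect_vec_mem] ym H.scale_mem[OF defect_vec_mem] m(2) bl lim(2), where c = "\<i>"]
    by (simp add: r_def h'_def add.commute)
  have hh: "(h, h') \<in> op_closure F (D_graph F)"
    unfolding op_closure_def rkhs_tendsto_def rkhs_norm_eq mem_Collect_eq prod.case
    by (intro conjI hm exI[of _ s] exI[of _ r] allI sr s r)
  have "\<xi> = (\<lambda>t. h t + c0 * defect_vec \<theta> 1 t)" "\<eta> = (\<lambda>t. - \<i> * h' t + \<i> * c0 * defect_vec \<theta> (-1) t)"
    by (simp_all add: h_def h'_def fun_eq_iff algebra_simps)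
  then show ?thesis using hh unfolding A_graph_eq ext_graph_def by blast
qed

text \<open>
  The range of \<open>A\<^sub>\<theta> - z\<close> is dense, as its orthogonal complement is trivial: an approximate
  representer of \<open>v \<mapsto> \<langle>v, \<zeta>\<rangle>\<close> inside the range converges, and its limit differs from \<open>\<zeta>\<close> by a vector
  orthogonal to the range. Preimages of the approximants converge because \<open>A\<^sub>\<theta> - z\<close> is bounded
  below.
\<close>

lemma resolvent_surj:
  assumes z: "char_fun \<theta> z \<noteq> 0" and \<zeta>: "\<zeta> \<in> rkhs F"
  shows "\<exists>\<xi>. (\<xi>, \<lambda>t. \<zeta> t + z * \<xi> t) \<in> A_graph F \<theta>"
proof -
  define G where "G = ext_graph \<theta> (D_graph F)"
  define W where "W = {\<lambda>t. \<eta> t - z * \<xi> t | \<xi> \<eta>. (\<xi>, \<eta>) \<in> G}"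
  have Glin: "(\<lambda>t. \<xi> t + k * \<xi>' t, \<lambda>t. \<eta> t + k * \<eta>' t) \<in> G" if "(\<xi>, \<eta>) \<in> G" "(\<xi>', \<eta>') \<in> G" for \<xi> \<eta> \<xi>' \<eta>' k
    using ext_graph_lin[of "D_graph F", OF D_graph_lin] that unfolding G_def by blast
  have G0: "(\<lambda>t. 0, \<lambda>t. 0) \<in> G"
    using D_graph_zero unfolding G_def ext_graph_def mem_Collect_eq
    by (intro exI[of _ "\<lambda>t. 0"] exI[of _ "0::complex"]) simp
  have GA: "(\<xi>, \<eta>) \<in> A_graph F \<theta>" if "(\<xi>, \<eta>) \<in> G" for \<xi> \<eta>
    using that ext_D_graph_subset unfolding G_def by blast
  have Gm: "\<xi> \<in> rkhs F" "\<eta> \<in> rkhs F" if "(\<xi>, \<eta>) \<in> G" for \<xi> \<eta>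
    using A_graph_bvp(1)[OF GA[OF that]] deriv_pair_mem(1)[OF A_graph_bvp(2)[OF GA[OF that]]] by blast+
  have WH: "W \<subseteq> rkhs F"
  proof
    fix v assume "v \<in> W"
    then obtain \<xi> \<eta> where "(\<xi>, \<eta>) \<in> G" "v = (\<lambda>t. \<eta> t - z * \<xi> t)" unfolding W_def by blast
    then show "v \<in> rkhs F" using H.diff_mem[OF Gm(2) H.scale_mem[OF Gm(1)]] by blast
  qed
  have Wlin: "(\<lambda>t. v t + k * v' t) \<in> W" if "v \<in> W" "v' \<in> W" for v v' k
  proof -
    obtain \<xi> \<eta> \<xi>' \<eta>' where g: "(\<xi>, \<eta>) \<in> G" "(\<xi>', \<eta>') \<in> G" "v = (\<lambda>t. \<eta> t - z * \<xi> t)" "v' = (\<lambda>t. \<eta>' t - z * \<xi>' t)"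
      using \<open>v \<in> W\<close> \<open>v' \<in> W\<close> unfolding W_def by blast
    have "(\<lambda>t. v t + k * v' t) = (\<lambda>t. (\<eta> t + k * \<eta>' t) - z * (\<xi> t + k * \<xi>' t))"
      by (simp add: g fun_eq_iff algebra_simps)
    then show ?thesis unfolding W_def mem_Collect_eq using Glin[OF g(1,2), of k]
      by (intro exI[of _ "\<lambda>t. \<xi> t + k * \<xi>' t"] exI[of _ "\<lambda>t. \<eta> t + k * \<eta>' t"]) simp
  qed
  have W0: "(\<lambda>t. 0) \<in> W"
    unfolding W_def mem_Collect_eq by (rule exI[of _ "\<lambda>t. 0"], rule exI[of _ "\<lambda>t. 0"]) (simp add: G0)
  obtain v where v: "\<And>n. v n \<in> W" "H.nCauchy v" "\<And>u. u \<in> W \<Longrightarrow> (\<lambda>n. rkhs_inner F u (v n)) \<longlonglongrightarrow> rkhs_inner F u \<zeta>"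
  proof (rule H.approximate_representer[OF WH W0, of "\<lambda>u. rkhs_inner F u \<zeta>" "H.nrm \<zeta>"])
    show "(\<lambda>t. x t + y t) \<in> W" if "x \<in> W" "y \<in> W" for x y using Wlin[OF that, of 1] by simp
    show "(\<lambda>t. c * x t) \<in> W" if "x \<in> W" for c x using Wlin[OF W0 that, of c] by simp
    show "rkhs_inner F (\<lambda>t. x t + y t) \<zeta> = rkhs_inner F x \<zeta> + rkhs_inner F y \<zeta>" if "x \<in> W" "y \<in> W" for x y
      using that WH \<zeta> by (intro H.B_add_left) auto
    show "rkhs_inner F (\<lambda>t. c * x t) \<zeta> = cnj c * rkhs_inner F x \<zeta>" if "x \<in> W" for c x
      using that WH \<zeta> by (intro H.B_scale_left) auto
    show "cmod (rkhs_inner F x \<zeta>) \<le> H.nrm \<zeta> * H.nrm x" if "x \<in> W" for x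
      using H.Cauchy_Schwarz[of x \<zeta>] that WH \<zeta> by (auto simp: mult.commute)
  qed blast
  have vm: "v n \<in> rkhs F" for n using v(1) WH by blast
  obtain \<zeta>' where \<zeta>': "\<zeta>' \<in> rkhs F" "(\<lambda>n. H.nrm (\<lambda>t. v n t - \<zeta>' t)) \<longlonglongrightarrow> 0"
    using rkhs_complete[OF vm v(2)] by blast
  have "(\<lambda>t. \<zeta> t - \<zeta>' t) = (\<lambda>t. 0)"
  proof (rule range_orthocomplement[OF z H.diff_mem[OF \<zeta> \<zeta>'(1)]])
    fix \<xi> \<eta> assume "(\<xi>, \<eta>) \<in> ext_graph \<theta> (D_graph F)"
    then have uW: "(\<lambda>t. \<eta> t - z * \<xi> t) \<in> W" unfolding W_def G_def by blast
    define u where "u = (\<lambda>t. \<eta> t - z * \<xi> t)"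
    have u: "u \<in> W" "u \<in> rkhs F" using uW WH unfolding u_def by auto
    have "(\<lambda>n. rkhs_inner F u (v n)) \<longlonglongrightarrow> rkhs_inner F u \<zeta>'"
      by (rule H.B_tendsto[OF vm \<zeta>'(1) u(2) \<zeta>'(2)])
    then have "rkhs_inner F u \<zeta> = rkhs_inner F u \<zeta>'" by (rule LIMSEQ_unique[OF v(3)[OF u(1)]])
    then show "rkhs_inner F (\<lambda>t. \<eta> t - z * \<xi> t) (\<lambda>t. \<zeta> t - \<zeta>' t) = 0"
      unfolding u_def[symmetric] by (simp add: H.B_diff u \<zeta> \<zeta>')
  qed
  then have "\<zeta>' = \<zeta>" by (auto simp: fun_eq_iff)
  then have vlim: "(\<lambda>n. H.nrm (\<lambda>t. v n t - \<zeta> t)) \<longlonglongrightarrow> 0" using \<zeta>' by simp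
  have "\<exists>\<xi> \<eta>. (\<xi>, \<eta>) \<in> G \<and> v n = (\<lambda>t. \<eta> t - z * \<xi> t)" for n using v(1)[of n] unfolding W_def by blast
  then have "\<forall>n. \<exists>p. (fst p, snd p) \<in> G \<and> v n = (\<lambda>t. snd p t - z * fst p t)" by simp
  from choice[OF this] obtain p where "\<forall>n. (fst (p n), snd (p n)) \<in> G \<and> v n = (\<lambda>t. snd (p n) t - z * fst (p n) t)"
    by blast
  moreover define x where "x = (\<lambda>n. fst (p n))"
  moreover define y where "y = (\<lambda>n. snd (p n))"
  ultimately have xy: "(x n, y n) \<in> G" "v n = (\<lambda>t. y n t - z * x n t)" for n by simp_all
  note xm = Gm(1)[OF xy(1)] and ym = Gm(2)[OF xy(1)]
  obtain M where M: "0 \<le> M" "\<And>\<xi> \<eta>. (\<xi>, \<eta>) \<in> A_graph F \<theta> \<Longrightarrow> H.nrm \<xi> \<le> M * H.nrm (\<lambda>t. \<eta> t - z * \<xi> t)"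
    using bounded_below[OF z] by blast
  have "H.nCauchy x"
  proof (rule H.nCauchy_bound[OF vm xm v(2), where K = M])
    fix m n
    have "(\<lambda>t. (y m t - y n t) - z * (x m t - x n t)) = (\<lambda>t. v m t - v n t)"
      by (simp add: xy fun_eq_iff algebra_simps)
    with M(2)[OF A_graph_diff[OF GA[OF xy(1)[of m]] GA[OF xy(1)[of n]]]]
    show "H.nrm (\<lambda>t. x m t - x n t) \<le> M * H.nrm (\<lambda>t. v m t - v n t)" by simp
  qed
  then obtain \<xi> where \<xi>: "\<xi> \<in> rkhs F" "(\<lambda>n. H.nrm (\<lambda>t. x n t - \<xi> t)) \<longlonglongrightarrow> 0"
    using rkhs_complete[of x, OF xm] by blast
  have ylim: "(\<lambda>n. H.nrm (\<lambda>t. (v n t + z * x n t) - (\<zeta> t + z * \<xi> t))) \<longlonglongrightarrow> 0"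
    by (rule H.nrm_tendsto_lin[OF vm xm \<zeta> \<xi>(1) vlim \<xi>(2)])
  have "y n = (\<lambda>t. v n t + z * x n t)" for n by (simp add: xy)
  then have "(\<xi>, \<lambda>t. \<zeta> t + z * \<xi> t) \<in> A_graph F \<theta>"
    using ylim by (intro graph_limit_mem[OF xy(1)[unfolded G_def] \<xi>(1) _ \<xi>(2)] H.add_mem H.scale_mem \<zeta> \<xi>) simp
  then show ?thesis by blast
qed

theorem op_spectrum_A_graph: "op_spectrum F (A_graph F \<theta>) = {z. char_fun \<theta> z = 0}"
proof -
  have "z \<in> op_resolvent_set F (A_graph F \<theta>) \<longleftrightarrow> char_fun \<theta> z \<noteq> 0" for z
  proof
    assume z: "z \<in> op_resolvent_set F (A_graph F \<theta>)"
    show "char_fun \<theta> z \<noteq> 0"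
    proof
      assume z0: "char_fun \<theta> z = 0"
      let ?w = "wave (cnj z)"
      have "\<exists>!\<xi>. (\<xi>, \<lambda>t. ?w t + z * \<xi> t) \<in> A_graph F \<theta>"
        using z wave_mem unfolding op_resolvent_set_def by blast
      then obtain \<xi> where "(\<xi>, \<lambda>t. ?w t + z * \<xi> t) \<in> A_graph F \<theta>" by blast
      from wave_orthogonal_range[OF z0 this] have "rkhs_inner F ?w ?w = 0" by simp
      then have "H.nrm ?w = 0" by (simp add: H.nrm_def)
      then have "?w (1/2) = 0" by (rule nrm_eq_0D[OF wave_mem])
      then show False by (simp add: wave_def on01_def)
    qed
  next
    assume z: "char_fun \<theta> z \<noteq> 0"
    obtain M where M: "0 \<le> M" "\<And>\<xi> \<eta>. (\<xi>, \<eta>) \<in> A_graph F \<theta> \<Longrightarrow> H.nrm \<xi> \<le> M * H.nrm (\<lambda>t. \<eta> t - z * \<xi> t)"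
      using bounded_below[OF z] by blast
    have "\<exists>!\<xi>. (\<xi>, \<lambda>t. \<zeta> t + z * \<xi> t) \<in> A_graph F \<theta>" if \<zeta>: "\<zeta> \<in> rkhs F" for \<zeta>
    proof (rule ex_ex1I[OF resolvent_surj[OF z \<zeta>]])
      fix \<xi> \<xi>' assume a: "(\<xi>, \<lambda>t. \<zeta> t + z * \<xi> t) \<in> A_graph F \<theta>" "(\<xi>', \<lambda>t. \<zeta> t + z * \<xi>' t) \<in> A_graph F \<theta>"
      have m: "\<xi> \<in> rkhs F" "\<xi>' \<in> rkhs F"
        using deriv_pair_mem(1)[OF A_graph_bvp(2)[OF a(1)]] deriv_pair_mem(1)[OF A_graph_bvp(2)[OF a(2)]] by blast+
      have e: "(\<lambda>t. (\<zeta> t + z * \<xi> t - (\<zeta> t + z * \<xi>' t)) - z * (\<xi> t - \<xi>' t)) = (\<lambda>t. 0)"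
        by (simp add: fun_eq_iff algebra_simps)
      have "H.nrm (\<lambda>t. 0) = 0" using H.nrm_scale[OF H.zero_mem, of 0] by simp
      then have "H.nrm (\<lambda>t. \<xi> t - \<xi>' t) \<le> 0" using M(2)[OF A_graph_diff[OF a]] unfolding e by simp
      then have "H.nrm (\<lambda>t. \<xi> t - \<xi>' t) = 0" using H.nrm_nonneg[OF H.diff_mem[OF m]] by simp
      from nrm_eq_0D[OF H.diff_mem[OF m] this] show "\<xi> = \<xi>'" by (simp add: fun_eq_iff)
    qed
    then show "z \<in> op_resolvent_set F (A_graph F \<theta>)"
      unfolding op_resolvent_set_def rkhs_norm_eq using M(2) by blast
  qed
  then show ?thesis by (auto simp: op_spectrum_def)
qed

end

section \<open>Summing the residues over the spectrum\<close>

text \<open>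
  At a zero \<open>|1 + \<i> z| e\<^bsup>-Im z\<^esup> = |1 - \<i> z|\<close>, but in the upper half plane both factors on the left
  make that side smaller, and in the lower half plane larger.
\<close>

lemma char_fun_zero_real:
  assumes "char_fun \<theta> z = 0"
  shows "Im z = 0"
proof (rule ccontr)
  assume "Im z \<noteq> 0"
  have "cmod ((1 + \<i> * z) * exp (\<i> * z)) = cmod (cis \<theta> * (1 - \<i> * z))"
    using assms by (simp add: char_fun_def)
  then have eq: "cmod (1 + \<i> * z) * exp (- Im z) = cmod (1 - \<i> * z)"
    by (simp add: norm_mult)
  have p: "(cmod (1 + \<i> * z))\<^sup>2 = (1 - Im z)\<^sup>2 + (Re z)\<^sup>2" "(cmod (1 - \<i> * z))\<^sup>2 = (1 + Im z)\<^sup>2 + (Re z)\<^sup>2"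
    by (simp_all add: cmod_power2)
  consider "0 < Im z" | "Im z < 0" using \<open>Im z \<noteq> 0\<close> by linarith
  then show False
  proof cases
    case 1
    have "(cmod (1 + \<i> * z))\<^sup>2 < (cmod (1 - \<i> * z))\<^sup>2"
      unfolding p using 1 by (simp add: power2_sum power2_diff)
    then have lt: "cmod (1 + \<i> * z) < cmod (1 - \<i> * z)" by (rule power_less_imp_less_base) simp
    have "cmod (1 + \<i> * z) * exp (- Im z) \<le> cmod (1 + \<i> * z) * 1"
      using 1 by (intro mult_left_mono) auto
    then show False using eq lt by simp
  next
    case 2
    have "(cmod (1 - \<i> * z))\<^sup>2 < (cmod (1 + \<i> * z))\<^sup>2"
      unfolding p using 2 by (simp add: power2_sum power2_diff)
    then have lt: "cmod (1 - \<i> * z) < cmod (1 + \<i> * z)" by (rule power_less_imp_less_base) simp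
    have "cmod (1 + \<i> * z) * 1 \<le> cmod (1 + \<i> * z) * exp (- Im z)"
      using 2 by (intro mult_left_mono) auto
    then show False using eq lt by simp
  qed
qed

lemma char_fun_derivative:
  "(char_fun \<theta> has_field_derivative \<i> * (2 + \<i> * z) * exp (\<i> * z) + \<i> * cis \<theta>) (at z)"
  unfolding char_fun_def by (auto intro!: derivative_eq_intros simp: algebra_simps)

lemma char_fun_holomorphic: "char_fun \<theta> holomorphic_on S"
  unfolding char_fun_def by (intro holomorphic_intros)

lemma char_fun_minus_i: "char_fun \<theta> (- \<i>) = 2 * exp 1"
  by (simp add: char_fun_def)

lemma finite_char_fun_zeros:
  assumes "compact K" shows "finite {z \<in> K. char_fun \<theta> z = 0}"
proof (rule holomorphic_compact_finite_zeros[where S = UNIV])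
  show "\<not> char_fun \<theta> constant_on UNIV"
  proof
    assume "char_fun \<theta> constant_on UNIV"
    then have "char_fun \<theta> (- \<i>) = char_fun \<theta> \<i>" by (auto simp: constant_on_def)
    then have "cmod (2 * exp 1) = cmod (char_fun \<theta> \<i>)" unfolding char_fun_minus_i by simp
    also have "char_fun \<theta> \<i> = - (2 * cis \<theta>)" by (simp add: char_fun_def)
    finally have "exp (1::real) = 1" by (simp add: norm_mult)
    then show False by simp
  qed
qed (use assms char_fun_holomorphic in auto)

definition char_zeros :: "real \<Rightarrow> real set" where
  "char_zeros \<theta> = {l. char_fun \<theta> (of_real l) = 0}"

text \<open>
  Its residue at a zero \<open>\<lambda>\<close> of \<open>char_fun\<close> is the term of the series at \<open>\<lambda>\<close>; its only other pole
  is \<open>-\<i>\<close>.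
\<close>

definition res_fun :: "real \<Rightarrow> real \<Rightarrow> complex \<Rightarrow> complex" where
  "res_fun \<theta> x z = 2 * \<i> * exp (\<i> * z * of_real (1 + x)) / ((1 - \<i> * z) * char_fun \<theta> z)"

lemma one_minus_iz_eq_0_iff: "1 - \<i> * z = 0 \<longleftrightarrow> z = - \<i>"
proof
  assume "1 - \<i> * z = 0"
  then have "\<i> * z = 1" by simp
  then have "- \<i> * (\<i> * z) = - \<i> * 1" by (simp only:)
  then show "z = - \<i>" by simp
qed simp

text \<open>
  Eliminating \<open>cis \<theta>\<close> with the equation \<open>char_fun \<theta> \<lambda> = 0\<close> gives
  \<open>(1 - \<i> \<lambda>) char_fun' \<theta> \<lambda> = \<i> e\<^bsup>\<i> \<lambda>\<^esup> (\<lambda>\<^sup>2 + 3)\<close>; this is the origin of the weight \<open>2 / (\<lambda>\<^sup>2 + 3)\<close>.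
\<close>

lemma res_fun_residue_spec:
  assumes l: "l \<in> char_zeros \<theta>"
  shows "residue (res_fun \<theta> x) (of_real l) = F_term x l"
proof -
  let ?S = "{z. Im z > -1}"
  let ?z = "complex_of_real l"
  define f where "f = (\<lambda>z. 2 * \<i> * exp (\<i> * z * of_real (1 + x)) / (1 - \<i> * z))"
  define g' where "g' = \<i> * (2 + \<i> * ?z) * exp (\<i> * ?z) + \<i> * cis \<theta>"
  have z0: "char_fun \<theta> ?z = 0" using l by (simp add: char_zeros_def)
  have ne: "1 - \<i> * ?z \<noteq> 0" by (auto simp: one_minus_iz_eq_0_iff complex_eq_iff)
  have l3: "(of_real (l\<^sup>2 + 3) :: complex) \<noteq> 0"
  proof -
    have "0 < l\<^sup>2 + 3" by (simp add: add_nonneg_pos)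
    then show ?thesis unfolding of_real_eq_0_iff by simp
  qed
  have key: "(1 - \<i> * ?z) * g' = \<i> * exp (\<i> * ?z) * of_real (l\<^sup>2 + 3)"
  proof -
    have c: "cis \<theta> * (1 - \<i> * ?z) = (1 + \<i> * ?z) * exp (\<i> * ?z)" using z0 by (simp add: char_fun_def)
    have "(1 - \<i> * ?z) * g' = \<i> * (2 + \<i> * ?z) * (1 - \<i> * ?z) * exp (\<i> * ?z) + \<i> * (cis \<theta> * (1 - \<i> * ?z))"
      by (simp add: g'_def algebra_simps)
    also have "\<dots> = \<i> * exp (\<i> * ?z) * ((2 + \<i> * ?z) * (1 - \<i> * ?z) + (1 + \<i> * ?z))"
      unfolding c by (simp add: algebra_simps)
    also have "(2 + \<i> * ?z) * (1 - \<i> * ?z) + (1 + \<i> * ?z) = of_real (l\<^sup>2 + 3)"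
      by (simp add: algebra_simps power2_eq_square)
    finally show ?thesis .
  qed
  have g'0: "g' \<noteq> 0" using key l3 by auto
  have "residue (\<lambda>z. f z / char_fun \<theta> z) ?z = f ?z / g'"
  proof (rule residue_simple_pole_deriv)
    have "1 - \<i> * z \<noteq> 0" if "z \<in> ?S" for z using that unfolding one_minus_iz_eq_0_iff by auto
    then show "f holomorphic_on ?S" unfolding f_def by (intro holomorphic_intros) blast
    show "open ?S" by (rule open_halfspace_Im_gt)
    show "connected ?S" by (rule connected_halfspace_Im_gt)
    show "(char_fun \<theta> has_field_derivative g') (at ?z)" unfolding g'_def by (rule char_fun_derivative)
    show "f ?z \<noteq> 0" using ne by (simp add: f_def)
  qed (use z0 g'0 char_fun_holomorphic in auto)
  also have "\<dots> = 2 * \<i> * exp (\<i> * ?z * of_real (1 + x)) / (\<i> * exp (\<i> * ?z) * of_real (l\<^sup>2 + 3))"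
    unfolding key[symmetric] f_def by simp
  also have "exp (\<i> * ?z * of_real (1 + x)) = exp (\<i> * ?z) * exp (\<i> * ?z * of_real x)"
    by (simp add: exp_add[symmetric] algebra_simps)
  also have "2 * \<i> * (exp (\<i> * ?z) * exp (\<i> * ?z * of_real x)) / (\<i> * exp (\<i> * ?z) * of_real (l\<^sup>2 + 3)) = F_term x l"
  proof -
    have "2 * \<i> * (a * b) / (\<i> * a * c) = 2 / c * b" if "a \<noteq> 0" "c \<noteq> 0" for a b c :: complex
      using that by simp
    from this[OF exp_not_eq_zero l3] show ?thesis by (simp only: F_term_def of_real_divide of_real_numeral)
  qed
  finally show ?thesis by (simp add: f_def res_fun_def[abs_def])
qed

lemma res_fun_residue_minus_i: "residue (res_fun \<theta> x) (- \<i>) = - of_real (exp x)"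
proof -
  let ?S = "{z. Im z < 0}"
  define f where "f = (\<lambda>z. 2 * \<i> * exp (\<i> * z * of_real (1 + x)) / char_fun \<theta> z)"
  have "residue (\<lambda>z. f z / (1 - \<i> * z)) (- \<i>) = f (- \<i>) / (- \<i>)"
  proof (rule residue_simple_pole_deriv)
    show "f holomorphic_on ?S"
      unfolding f_def using char_fun_zero_real
      by (intro holomorphic_intros char_fun_holomorphic) force
    show "(\<lambda>z. 1 - \<i> * z) holomorphic_on ?S" by (intro holomorphic_intros)
    show "open ?S" by (rule open_halfspace_Im_lt)
    show "connected ?S" by (rule connected_halfspace_Im_lt)
    show "((\<lambda>z. 1 - \<i> * z) has_field_derivative - \<i>) (at (- \<i>))" by (auto intro!: derivative_eq_intros)
    show "f (- \<i>) \<noteq> 0" by (simp add: f_def char_fun_minus_i)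
  qed auto
  also have "\<dots> = - of_real (exp x)"
    by (simp add: f_def char_fun_minus_i exp_add distrib_left exp_of_real)
  finally show ?thesis by (simp add: f_def res_fun_def[abs_def] mult.commute)
qed

text \<open>
  With \<open>p = 1 - \<i> z\<close>, \<open>char_fun \<theta> z = 2 e\<^bsup>\<i> z\<^esup> - p (e\<^bsup>\<i> z\<^esup> + e\<^bsup>\<i> \<theta>\<^esup>)\<close>. The summands in the bracket have
  equal arguments on the vertical lines \<open>Re z \<in> \<theta> + 2 \<pi> \<int>\<close>, and very different absolute values far
  from the real axis; so they do not cancel, and for large \<open>|p|\<close> the bracket dominates.
\<close>

lemma char_fun_lower_bound:
  assumes p: "8 \<le> cmod (1 - \<i> * z)"
    and z: "exp (\<i> * of_real (Re z)) = cis \<theta> \<or> \<bar>Im z\<bar> \<ge> 2"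
  shows "cmod (1 - \<i> * z) * ((1 + exp (- Im z)) / 4) \<le> cmod (char_fun \<theta> z)"
proof -
  let ?p = "1 - \<i> * z" and ?e = "exp (- Im z)"
  have ne: "cmod (exp (\<i> * z)) = ?e" by simp
  have "char_fun \<theta> z = 2 * exp (\<i> * z) - ?p * (exp (\<i> * z) + cis \<theta>)"
    by (simp add: char_fun_def algebra_simps)
  then have "cmod ?p * cmod (exp (\<i> * z) + cis \<theta>) - 2 * ?e \<le> cmod (char_fun \<theta> z)"
    using norm_triangle_ineq2[of "?p * (exp (\<i> * z) + cis \<theta>)" "2 * exp (\<i> * z)"] ne
    by (simp add: norm_mult norm_minus_commute)
  moreover have "2 * ?e \<le> cmod ?p * (?e / 4)"
    using mult_right_mono[OF p, of "?e / 4"] by simp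
  moreover have "1 / 4 + ?e / 2 \<le> cmod (exp (\<i> * z) + cis \<theta>)"
    using z
  proof
    assume a: "exp (\<i> * of_real (Re z)) = cis \<theta>"
    have "exp (\<i> * z) = exp (\<i> * of_real (Re z)) * of_real ?e"
    proof -
      have "\<i> * z = \<i> * of_real (Re z) + of_real (- Im z)" by (simp add: complex_eq_iff)
      then show ?thesis by (simp only: exp_add exp_of_real)
    qed
    then have "exp (\<i> * z) + cis \<theta> = cis \<theta> * of_real (?e + 1)"
      unfolding a by (simp add: algebra_simps)
    then have "cmod (exp (\<i> * z) + cis \<theta>) = \<bar>?e + 1\<bar>" by (simp only: norm_mult norm_cis norm_of_real) simp
    moreover have "0 < ?e" by simp
    ultimately show ?thesis by linarith
  next
    assume a: "\<bar>Im z\<bar> \<ge> 2"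
    have "?e - 1 \<le> cmod (exp (\<i> * z) + cis \<theta>)"
      using norm_triangle_ineq2[of "exp (\<i> * z)" "- cis \<theta>"] by simp
    moreover have "1 - ?e \<le> cmod (exp (\<i> * z) + cis \<theta>)"
      using norm_triangle_ineq2[of "cis \<theta>" "- exp (\<i> * z)"] by (simp add: add.commute)
    ultimately have 1: "?e - 1 \<le> cmod (exp (\<i> * z) + cis \<theta>)" "1 - ?e \<le> cmod (exp (\<i> * z) + cis \<theta>)" .
    have 2: "3 \<le> ?e \<or> ?e \<le> 1/3"
    proof (cases "0 \<le> Im z")
      case True
      have "3 \<le> exp (Im z)" using exp_ge_add_one_self[of "Im z"] a True by linarith
      then show ?thesis by (simp add: exp_minus field_simps)
    next
      case False
      then show ?thesis using exp_ge_add_one_self[of "- Im z"] a by linarith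
    qed
    show ?thesis using 2
    proof
      assume "3 \<le> ?e" then show ?thesis using 1(1) by linarith
    next
      assume "?e \<le> 1/3" then show ?thesis using 1(2) by linarith
    qed
  qed
  then have "cmod ?p * (1 / 4 + ?e / 2) \<le> cmod ?p * cmod (exp (\<i> * z) + cis \<theta>)"
    by (intro mult_left_mono) auto
  moreover have "cmod ?p * ((1 + ?e) / 4) + cmod ?p * (?e / 4) = cmod ?p * (1 / 4 + ?e / 2)"
    by (simp add: field_simps)
  ultimately show ?thesis by linarith
qed

text \<open>
  For \<open>-1 \<le> x \<le> 0\<close> the numerator is at most \<open>2 (1 + e\<^bsup>-Im z\<^esup>)\<close>, which the lower bound for
  \<open>char_fun\<close> compensates.
\<close>

lemma res_fun_bound:
  assumes m: "8 \<le> m" "m \<le> cmod (1 - \<i> * z)"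
    and z: "exp (\<i> * of_real (Re z)) = cis \<theta> \<or> \<bar>Im z\<bar> \<ge> 2"
    and x: "-1 \<le> x" "x \<le> 0"
  shows "char_fun \<theta> z \<noteq> 0" "cmod (res_fun \<theta> x z) \<le> 8 / m\<^sup>2"
proof -
  let ?p = "cmod (1 - \<i> * z)" and ?e = "exp (- Im z)"
  have p: "8 \<le> ?p" using m by linarith
  note lb = char_fun_lower_bound[OF p z]
  have pos: "0 < ?p * ((1 + ?e) / 4)" by (intro mult_pos_pos divide_pos_pos add_pos_pos) (use p in auto)
  show "char_fun \<theta> z \<noteq> 0" using lb pos by auto
  have num: "cmod (2 * \<i> * exp (\<i> * z * of_real (1 + x))) \<le> 2 * (1 + ?e)"
  proof -
    \<comment> \<open>The range \<open>0 \<le> 1 + x \<le> 1\<close> enters here.\<close>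
    have "- Im z * (1 + x) \<le> max 0 (- Im z)"
    proof (cases "0 \<le> - Im z")
      case True
      then show ?thesis using mult_left_mono[of "1 + x" 1 "- Im z"] x by simp
    next
      case False
      then have "- Im z * (1 + x) \<le> 0" using x by (intro mult_nonpos_nonneg) auto
      then show ?thesis by simp
    qed
    then have "exp (- Im z * (1 + x)) \<le> exp (max 0 (- Im z))" by simp
    also have "\<dots> \<le> 1 + ?e" by (simp add: max_def)
    finally show ?thesis by (simp add: norm_mult)
  qed
  have "m\<^sup>2 / 4 * (1 + ?e) \<le> ?p * ?p / 4 * (1 + ?e)"
    using m by (intro mult_right_mono divide_right_mono) (auto simp: power2_eq_square add_nonneg_nonneg intro!: mult_mono)
  also have "\<dots> = ?p * (?p * ((1 + ?e) / 4))" by simp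
  also have "\<dots> \<le> ?p * cmod (char_fun \<theta> z)" by (rule mult_left_mono[OF lb]) simp
  finally have den: "m\<^sup>2 / 4 * (1 + ?e) \<le> ?p * cmod (char_fun \<theta> z)" .
  have "0 < m\<^sup>2 / 4 * (1 + ?e)" using m by (intro mult_pos_pos add_pos_pos) auto
  then have "cmod (res_fun \<theta> x z) \<le> 2 * (1 + ?e) / (m\<^sup>2 / 4 * (1 + ?e))"
    unfolding res_fun_def norm_divide norm_mult[of "1 - \<i> * z"] by (intro frac_le num den) (auto simp: add_nonneg_nonneg)
  also have "\<dots> = 8 / m\<^sup>2"
  proof -
    have "1 + ?e \<noteq> 0" using exp_gt_zero[of "- Im z"] by linarith
    then show ?thesis by (simp add: divide_simps)
  qed
  finally show "cmod (res_fun \<theta> x z) \<le> 8 / m\<^sup>2" .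
qed

lemma contour_integral_rectpath_bound:
  assumes le: "Re a \<le> Re b" "Im a \<le> Im b"
    and f: "continuous_on (path_image (rectpath a b)) f"
    and B: "0 \<le> B" "\<And>z. z \<in> path_image (rectpath a b) \<Longrightarrow> cmod (f z) \<le> B"
  shows "cmod (contour_integral (rectpath a b) f) \<le> B * (2 * (Re b - Re a) + 2 * (Im b - Im a))"
proof -
  define p where "p = Complex (Re b) (Im a)"
  define q where "q = Complex (Re a) (Im b)"
  have pi: "path_image (rectpath a b) =
      closed_segment a p \<union> (closed_segment p b \<union> (closed_segment b q \<union> closed_segment q a))"
    by (simp add: rectpath_def Let_def path_image_join p_def q_def)
  have ci: "f contour_integrable_on linepath u v" if "closed_segment u v \<subseteq> path_image (rectpath a b)" for u v
    by (rule contour_integrable_continuous_linepath[OF continuous_on_subset[OF f that]])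
  have bd: "cmod (contour_integral (linepath u v) f) \<le> B * cmod (v - u)"
    if "closed_segment u v \<subseteq> path_image (rectpath a b)" for u v
    by (rule contour_integral_bound_linepath[OF ci[OF that] B(1)]) (use B(2) that in blast)
  have sub: "closed_segment a p \<subseteq> path_image (rectpath a b)" "closed_segment p b \<subseteq> path_image (rectpath a b)"
    "closed_segment b q \<subseteq> path_image (rectpath a b)" "closed_segment q a \<subseteq> path_image (rectpath a b)"
    unfolding pi by blast+
  have "contour_integral (rectpath a b) f = contour_integral (linepath a p) f + (contour_integral (linepath p b) f +
      (contour_integral (linepath b q) f + contour_integral (linepath q a) f))"
    unfolding rectpath_def Let_def p_def[symmetric] q_def[symmetric]
    by (simp add: contour_integrable_joinI ci sub)
  also have "cmod \<dots> \<le> B * cmod (p - a) + (B * cmod (b - p) + (B * cmod (q - b) + B * cmod (a - q)))"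
    by (intro norm_triangle_mono bd sub)
  also have "cmod (p - a) = Re b - Re a" using le by (simp add: p_def cmod_def)
  also have "cmod (b - p) = Im b - Im a" using le by (simp add: p_def cmod_def)
  also have "cmod (q - b) = Re b - Re a" using le by (simp add: q_def cmod_def)
  also have "cmod (a - q) = Im b - Im a" using le by (simp add: q_def cmod_def)
  finally show ?thesis by (simp add: algebra_simps)
qed

definition spec_upto :: "real \<Rightarrow> nat \<Rightarrow> real set" where
  "spec_upto \<theta> n = {l \<in> char_zeros \<theta>. \<bar>l - \<theta>\<bar> < 2 * pi * real n}"

lemma spec_bounded_finite: "finite {l \<in> char_zeros \<theta>. \<bar>l - a\<bar> \<le> r}"
proof (rule finite_imageD)
  show "finite (complex_of_real ` {l \<in> char_zeros \<theta>. \<bar>l - a\<bar> \<le> r})"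
  proof (rule finite_subset)
    show "finite {z \<in> cball (of_real a) r. char_fun \<theta> z = 0}" by (rule finite_char_fun_zeros) simp
    show "complex_of_real ` {l \<in> char_zeros \<theta>. \<bar>l - a\<bar> \<le> r} \<subseteq> {z \<in> cball (of_real a) r. char_fun \<theta> z = 0}"
      by (auto simp: char_zeros_def dist_norm norm_minus_commute of_real_diff[symmetric] simp del: of_real_diff)
  qed
qed (auto simp: inj_on_def)

lemma finite_spec_upto: "finite (spec_upto \<theta> n)"
  by (rule finite_subset[OF _ spec_bounded_finite[of \<theta> \<theta> "2 * pi * real n"]]) (auto simp: spec_upto_def)

lemma exp_i_shift: "exp (\<i> * of_real (\<theta> + 2 * pi * real n)) = cis \<theta>" "exp (\<i> * of_real (\<theta> - 2 * pi * real n)) = cis \<theta>"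
proof -
  have 1: "cis (2 * pi * real n) = 1" by (rule cis_multiple_2pi) simp
  have "exp (\<i> * of_real (\<theta> + 2 * pi * real n)) = cis \<theta> * cis (2 * pi * real n)"
    by (simp only: cis_conv_exp[symmetric] cis_mult)
  then show "exp (\<i> * of_real (\<theta> + 2 * pi * real n)) = cis \<theta>" using 1 by simp
  have "exp (\<i> * of_real (\<theta> - 2 * pi * real n)) = cis \<theta> / cis (2 * pi * real n)"
    by (simp only: cis_conv_exp[symmetric] cis_divide)
  then show "exp (\<i> * of_real (\<theta> - 2 * pi * real n)) = cis \<theta>" using 1 by simp
qed

text \<open>
  The residue theorem on the square with centre \<open>\<theta>\<close> and side \<open>4 \<pi> n\<close>. By \<open>res_fun_bound\<close> the
  integral is of order \<open>1/n\<close>, and the residue at \<open>-\<i>\<close> contributes \<open>-e\<^bsup>x\<^esup>\<close>.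
\<close>

lemma partial_sum_error:
  assumes \<theta>: "0 \<le> \<theta>" "\<theta> < 2 * pi" and x: "-1 \<le> x" "x \<le> 0" and n: "4 \<le> n"
  shows "cmod ((\<Sum>l\<in>spec_upto \<theta> n. F_term x l) - of_real (exp x)) \<le> 64 * (2 * pi * real n) / (2 * pi * (real n - 2))\<^sup>2"
proof -
  define L where "L = 2 * pi * real n"
  define m where "m = 2 * pi * (real n - 2)"
  have Lm: "L = m + 2 * pi + 2 * pi" by (simp add: L_def m_def algebra_simps)
  have m8: "8 \<le> m"
  proof -
    have "2 * pi * 2 \<le> m" unfolding m_def using n by (intro mult_left_mono) auto
    then show ?thesis using pi_gt3 by linarith
  qed
  have L2: "2 \<le> L" "0 < L" using Lm m8 pi_gt3 by linarith+
  define a where "a = Complex (\<theta> - L) (- L)"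
  define b where "b = Complex (\<theta> + L) L"
  have path: "path_image (rectpath a b) = {z. Re z \<in> {\<theta> - L, \<theta> + L} \<and> Im z \<in> {-L..L}} \<union>
      {z. Im z \<in> {-L, L} \<and> Re z \<in> {\<theta> - L..\<theta> + L}}"
    using path_image_rectpath[of a b] L2 by (simp add: a_def b_def)
  have onpath: "m \<le> cmod (1 - \<i> * z) \<and> (exp (\<i> * of_real (Re z)) = cis \<theta> \<or> \<bar>Im z\<bar> \<ge> 2)"
    if z: "z \<in> path_image (rectpath a b)" for z
  proof
    \<comment> \<open>The square has centre \<open>\<theta>\<close>, not \<open>0\<close>, which costs up
      to \<open>2 \<pi>\<close>.\<close>
    have "L - 2 * pi \<le> \<bar>Re z\<bar> \<or> L \<le> \<bar>Im z\<bar>" using z \<theta> L2 unfolding path by auto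
    then have "L - 2 * pi \<le> cmod z"
      using abs_Re_le_cmod[of z] abs_Im_le_cmod[of z] pi_gt_zero by linarith
    moreover have "cmod z - 1 \<le> cmod (1 - \<i> * z)"
      using norm_triangle_ineq2[of "\<i> * z" 1] by (simp add: norm_mult norm_minus_commute)
    ultimately show "m \<le> cmod (1 - \<i> * z)" using Lm pi_gt3 by linarith
    have "Re z = \<theta> + 2 * pi * real n \<or> Re z = \<theta> - 2 * pi * real n \<or> L \<le> \<bar>Im z\<bar>"
      using z L2 unfolding path L_def by auto
    then show "exp (\<i> * of_real (Re z)) = cis \<theta> \<or> \<bar>Im z\<bar> \<ge> 2"
      using exp_i_shift[of \<theta> n] L2 by (auto simp del: of_real_add of_real_diff)
  qed
  have W0: "char_fun \<theta> z \<noteq> 0" and fb: "cmod (res_fun \<theta> x z) \<le> 8 / m\<^sup>2"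
    if "z \<in> path_image (rectpath a b)" for z
    using res_fun_bound[OF m8 _ _ x] onpath[OF that] by blast+
  have ni: "- \<i> \<notin> path_image (rectpath a b)" using onpath[of "- \<i>"] m8 by auto
  have holo: "res_fun \<theta> x holomorphic_on {z. z \<noteq> - \<i> \<and> char_fun \<theta> z \<noteq> 0}"
    unfolding res_fun_def
    by (intro holomorphic_intros char_fun_holomorphic) (simp add: one_minus_iz_eq_0_iff[symmetric])
  have int: "cmod (contour_integral (rectpath a b) (res_fun \<theta> x)) \<le> 8 / m\<^sup>2 * (2 * (Re b - Re a) + 2 * (Im b - Im a))"
  proof (rule contour_integral_rectpath_bound)
    show "continuous_on (path_image (rectpath a b)) (res_fun \<theta> x)"
      by (rule continuous_on_subset[OF holomorphic_on_imp_continuous_on[OF holo]]) (use W0 ni in auto)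
  qed (use fb L2 in \<open>auto simp: a_def b_def\<close>)
  \<comment> \<open>Any open disc that contains the square; it may contain further zeros, but around
    these the boundary of the square has winding number \<open>0\<close>.\<close>
  define S where "S = ball (0::complex) (\<theta> + L + L + 2)"
  define Z where "Z = {z \<in> cball 0 (\<theta> + L + L + 2). char_fun \<theta> z = 0}"
  define pts where "pts = insert (- \<i>) Z"
  have Zfin: "finite Z" unfolding Z_def by (rule finite_char_fun_zeros) simp
  have rect_S: "z \<in> S" if "z \<in> cbox a b" for z
  proof -
    have "\<bar>Re z\<bar> \<le> \<theta> + L" "\<bar>Im z\<bar> \<le> L" using that \<theta> by (auto simp: in_cbox_complex_iff a_def b_def)
    then have "cmod z \<le> \<theta> + L + L" using cmod_le[of z] by linarith
    then show ?thesis by (simp add: S_def)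
  qed
  have pS: "path_image (rectpath a b) \<subseteq> cbox a b"
    by (rule path_image_rectpath_subset_cbox) (use L2 in \<open>simp_all add: a_def b_def\<close>)
  have ni_Z: "- \<i> \<notin> Z" by (auto simp: Z_def char_fun_minus_i)
  have "contour_integral (rectpath a b) (res_fun \<theta> x) =
      2 * pi * \<i> * (\<Sum>p\<in>pts. winding_number (rectpath a b) p * residue (res_fun \<theta> x) p)"
  proof (rule Residue_theorem)
    show "open S" "connected S" unfolding S_def by auto
    show "finite pts" unfolding pts_def using Zfin by simp
    show "res_fun \<theta> x holomorphic_on S - pts"
      by (rule holomorphic_on_subset[OF holo]) (auto simp: S_def pts_def Z_def)
    show "path_image (rectpath a b) \<subseteq> S - pts"
      using pS rect_S W0 ni by (auto simp: pts_def Z_def)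
    show "\<forall>z. z \<notin> S \<longrightarrow> winding_number (rectpath a b) z = 0"
      using rect_S L2 by (intro allI impI winding_number_rectpath_outside) (auto simp: a_def b_def)
  qed auto
  also have "(\<Sum>p\<in>pts. winding_number (rectpath a b) p * residue (res_fun \<theta> x) p) =
      - of_real (exp x) + (\<Sum>p\<in>Z. winding_number (rectpath a b) p * residue (res_fun \<theta> x) p)"
  proof -
    have "- \<i> \<in> box a b"
      using \<theta> Lm m8 pi_gt3 by (auto simp: in_box_complex_iff a_def b_def)
    then show ?thesis
      unfolding pts_def using Zfin ni_Z by (simp add: winding_number_rectpath res_fun_residue_minus_i)
  qed
  also have "(\<Sum>p\<in>Z. winding_number (rectpath a b) p * residue (res_fun \<theta> x) p) =
      (\<Sum>p\<in>complex_of_real ` spec_upto \<theta> n. winding_number (rectpath a b) p * residue (res_fun \<theta> x) p)"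
  proof (rule sum.mono_neutral_right[OF Zfin])
    have inb: "of_real l \<in> box a b" if "l \<in> spec_upto \<theta> n" for l
      using that L2 by (auto simp: spec_upto_def in_box_complex_iff a_def b_def L_def)
    show "complex_of_real ` spec_upto \<theta> n \<subseteq> Z"
    proof
      fix z assume "z \<in> complex_of_real ` spec_upto \<theta> n"
      then obtain l where l: "z = of_real l" "l \<in> spec_upto \<theta> n" by blast
      have "z \<in> S" using rect_S[of z] inb[OF l(2)] box_subset_cbox[of a b] l(1) by blast
      then show "z \<in> Z" using l by (auto simp: Z_def S_def spec_upto_def char_zeros_def)
    qed
    show "\<forall>z\<in>Z - complex_of_real ` spec_upto \<theta> n. winding_number (rectpath a b) z * residue (res_fun \<theta> x) z = 0"
    proof
      fix z assume z: "z \<in> Z - complex_of_real ` spec_upto \<theta> n"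
      then have W: "char_fun \<theta> z = 0" by (simp add: Z_def)
      have r: "z = of_real (Re z)" using char_fun_zero_real[OF W] by (simp add: complex_eq_iff)
      have "Re z \<in> char_zeros \<theta>" using W r by (simp add: char_zeros_def)
      moreover have "Re z \<notin> spec_upto \<theta> n" using z r by auto
      ultimately have "L \<le> \<bar>Re z - \<theta>\<bar>" by (auto simp: spec_upto_def L_def)
      then have "z \<notin> box a b" by (auto simp: in_box_complex_iff a_def b_def)
      moreover have "z \<notin> path_image (rectpath a b)" using W0 W by blast
      moreover have "path_image (rectpath a b) = cbox a b - box a b"
        by (rule path_image_rectpath_cbox_minus_box) (use L2 in \<open>simp_all add: a_def b_def\<close>)
      ultimately have "z \<notin> cbox a b" by blast
      then have "winding_number (rectpath a b) z = 0"
        by (intro winding_number_rectpath_outside) (use L2 in \<open>simp_all add: a_def b_def\<close>)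
      then show "winding_number (rectpath a b) z * residue (res_fun \<theta> x) z = 0" by simp
    qed
  qed
  also have "\<dots> = (\<Sum>l\<in>spec_upto \<theta> n. F_term x l)"
  proof (subst sum.reindex)
    show "inj_on complex_of_real (spec_upto \<theta> n)" by (auto simp: inj_on_def)
    show "sum ((\<lambda>p. winding_number (rectpath a b) p * residue (res_fun \<theta> x) p) \<circ> complex_of_real) (spec_upto \<theta> n) =
        (\<Sum>l\<in>spec_upto \<theta> n. F_term x l)"
    proof (rule sum.cong[OF refl])
      fix l assume l: "l \<in> spec_upto \<theta> n"
      have "complex_of_real l \<in> box a b"
        using l L2 by (auto simp: spec_upto_def in_box_complex_iff a_def b_def L_def)
      then show "((\<lambda>p. winding_number (rectpath a b) p * residue (res_fun \<theta> x) p) \<circ> complex_of_real) l = F_term x l"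
        using l res_fun_residue_spec[of l \<theta> x] by (simp add: winding_number_rectpath spec_upto_def)
    qed
  qed
  finally have eq: "contour_integral (rectpath a b) (res_fun \<theta> x) =
      2 * pi * \<i> * ((\<Sum>l\<in>spec_upto \<theta> n. F_term x l) - of_real (exp x))" by simp
  define E where "E = cmod ((\<Sum>l\<in>spec_upto \<theta> n. F_term x l) - of_real (exp x))"
  have "2 * pi * E \<le> 8 / m\<^sup>2 * (2 * (Re b - Re a) + 2 * (Im b - Im a))"
    using int unfolding eq by (simp add: norm_mult E_def)
  also have "\<dots> = 64 * L / m\<^sup>2" by (simp add: a_def b_def)
  finally have "2 * pi * E \<le> 64 * L / m\<^sup>2" .
  moreover have "1 * E \<le> 2 * pi * E" using pi_gt3 by (intro mult_right_mono) (auto simp: E_def)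
  ultimately have "E \<le> 64 * L / m\<^sup>2" by linarith
  then show ?thesis by (simp only: E_def L_def m_def)
qed

lemma partial_sum_limit:
  assumes \<theta>: "0 \<le> \<theta>" "\<theta> < 2 * pi" and x: "-1 \<le> x" "x \<le> 0"
  shows "(\<lambda>n. \<Sum>l\<in>spec_upto \<theta> n. F_term x l) \<longlonglongrightarrow> of_real (exp x)"
proof -
  have "(\<lambda>n. 64 * (2 * pi * real n) / (2 * pi * (real n - 2))\<^sup>2) \<longlonglongrightarrow> 0"
    by real_asymp
  then have "(\<lambda>n. (\<Sum>l\<in>spec_upto \<theta> n. F_term x l) - of_real (exp x)) \<longlonglongrightarrow> 0"
    by (rule Lim_null_comparison[rotated])
       (use partial_sum_error[OF \<theta> x] in \<open>auto simp: eventually_sequentially intro!: exI[of _ 4]\<close>)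
  then show ?thesis by (simp add: LIM_zero_iff)
qed

section \<open>The extended function\<close>

definition weight :: "real \<Rightarrow> real" where
  "weight l = 2 / (l\<^sup>2 + 3)"

lemma weight_nonneg: "0 \<le> weight l"
  by (simp add: weight_def)

lemma cmod_F_term: "cmod (F_term x l) = weight l"
  unfolding F_term_def norm_mult norm_of_real by (simp add: weight_def)

lemma discrete_char_zeros: "discrete (char_zeros \<theta>)"
  unfolding discrete_altdef
proof
  fix l assume "l \<in> char_zeros \<theta>"
  obtain d where d: "0 < d" "\<forall>y\<in>{k \<in> char_zeros \<theta>. \<bar>k - l\<bar> \<le> 1}. y \<noteq> l \<longrightarrow> d \<le> dist l y"
    using finite_set_avoid[OF spec_bounded_finite[of \<theta> l 1]] by blast
  show "\<forall>\<^sub>F y in at l. y \<notin> char_zeros \<theta>"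
    unfolding eventually_at
  proof (intro exI[of _ "min d 1"] conjI ballI impI notI)
    fix y assume y: "y \<noteq> l \<and> dist y l < min d 1" "y \<in> char_zeros \<theta>"
    then have "d \<le> dist l y" using d(2) by (auto simp: dist_real_def)
    then show False using y by (simp add: dist_commute)
  qed (use d in auto)
qed

lemma finite_subset_spec_upto:
  assumes "finite A" "A \<subseteq> char_zeros \<theta>"
  shows "\<exists>N. \<forall>n\<ge>N. A \<subseteq> spec_upto \<theta> n"
proof -
  obtain r where r: "\<And>l. l \<in> A \<Longrightarrow> \<bar>l - \<theta>\<bar> \<le> r"
  proof (rule that)
    show "\<bar>l - \<theta>\<bar> \<le> Max ((\<lambda>l. \<bar>l - \<theta>\<bar>) ` A)" if "l \<in> A" for l
      using assms(1) that by (intro Max_ge) auto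
  qed
  obtain N :: nat where N: "r < real N" using reals_Archimedean2 by blast
  have "A \<subseteq> spec_upto \<theta> n" if n: "N \<le> n" for n
  proof
    fix l assume l: "l \<in> A"
    have "1 * real n \<le> 2 * pi * real n" using pi_gt3 by (intro mult_right_mono) auto
    then have "\<bar>l - \<theta>\<bar> < 2 * pi * real n" using r[OF l] N n by linarith
    then show "l \<in> spec_upto \<theta> n" using l assms(2) by (auto simp: spec_upto_def)
  qed
  then show ?thesis by blast
qed

lemma filterlim_spec_upto: "filterlim (spec_upto \<theta>) (finite_subsets_at_top (char_zeros \<theta>)) sequentially"
  unfolding filterlim_finite_subsets_at_top
proof (intro allI impI)
  fix A assume "finite A \<and> A \<subseteq> char_zeros \<theta>"
  then obtain N where "\<forall>n\<ge>N. A \<subseteq> spec_upto \<theta> n" using finite_subset_spec_upto by blast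
  then show "\<forall>\<^sub>F n in sequentially. finite (spec_upto \<theta> n) \<and> A \<subseteq> spec_upto \<theta> n \<and> spec_upto \<theta> n \<subseteq> char_zeros \<theta>"
    unfolding eventually_sequentially using finite_spec_upto by (auto simp: spec_upto_def)
qed

text \<open>
  At \<open>x = 0\<close> the terms of the series are the nonnegative weights, and its partial sums over
  \<open>spec_upto \<theta> n\<close> are bounded because they converge.
\<close>

lemma weight_summable:
  assumes \<theta>: "0 \<le> \<theta>" "\<theta> < 2 * pi"
  shows "weight summable_on char_zeros \<theta>"
proof (rule nonneg_bdd_above_summable_on)
  have "(\<lambda>n. \<Sum>l\<in>spec_upto \<theta> n. F_term 0 l) \<longlonglongrightarrow> of_real (exp 0)"
    by (rule partial_sum_limit[OF \<theta>]) simp_all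
  moreover have "(\<Sum>l\<in>spec_upto \<theta> n. F_term 0 l) = of_real (\<Sum>l\<in>spec_upto \<theta> n. weight l)" for n
    by (simp add: F_term_def weight_def)
  ultimately have "(\<lambda>n. \<Sum>l\<in>spec_upto \<theta> n. weight l) \<longlonglongrightarrow> exp 0"
    by (simp only: tendsto_of_real_iff)
  then have "Bseq (\<lambda>n. \<Sum>l\<in>spec_upto \<theta> n. weight l)" by (intro convergent_imp_Bseq convergentI)
  then obtain K where "\<forall>n. norm (\<Sum>l\<in>spec_upto \<theta> n. weight l) \<le> K" by (rule BseqE)
  then have K: "\<bar>\<Sum>l\<in>spec_upto \<theta> n. weight l\<bar> \<le> K" for n by simp
  show "bdd_above (sum weight ` {A. A \<subseteq> char_zeros \<theta> \<and> finite A})"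
  proof (rule bdd_aboveI2)
    fix A assume "A \<in> {A. A \<subseteq> char_zeros \<theta> \<and> finite A}"
    then have "\<exists>N. \<forall>n\<ge>N. A \<subseteq> spec_upto \<theta> n" by (intro finite_subset_spec_upto) auto
    then obtain n where n: "A \<subseteq> spec_upto \<theta> n" by blast
    have "sum weight A \<le> sum weight (spec_upto \<theta> n)"
      by (rule sum_mono2[OF finite_spec_upto n weight_nonneg])
    then show "sum weight A \<le> K" using K[of n] by linarith
  qed
qed (rule weight_nonneg)

lemma F_term_summable:
  assumes "0 \<le> \<theta>" "\<theta> < 2 * pi"
  shows "F_term x summable_on char_zeros \<theta>"
  by (rule abs_summable_summable) (simp add: cmod_F_term weight_summable[OF assms])

lemma F_series_continuous:
  assumes "0 \<le> \<theta>" "\<theta> < 2 * pi"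
  shows "continuous_on UNIV (\<lambda>x. \<Sum>\<^sub>\<infinity>l\<in>char_zeros \<theta>. F_term x l)"
proof (rule uniform_limit_theorem)
  show "uniform_limit UNIV (\<lambda>X x. \<Sum>l\<in>X. F_term x l) (\<lambda>x. \<Sum>\<^sub>\<infinity>l\<in>char_zeros \<theta>. F_term x l)
      (finite_subsets_at_top (char_zeros \<theta>))"
    by (rule Weierstrass_m_test_general[where M = weight and f = "\<lambda>l x. F_term x l"])
       (simp_all add: cmod_F_term weight_summable[OF assms])
  show "\<forall>\<^sub>F X in finite_subsets_at_top (char_zeros \<theta>). continuous_on UNIV (\<lambda>x. \<Sum>l\<in>X. F_term x l)"
    unfolding F_term_def by (intro always_eventually allI continuous_intros)
qed simp

lemma has_sum_finite_sum:
  fixes f :: "'i \<Rightarrow> 'a \<Rightarrow> complex"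
  assumes "finite I" "\<And>i. i \<in> I \<Longrightarrow> (f i has_sum s i) A"
  shows "((\<lambda>x. \<Sum>i\<in>I. f i x) has_sum (\<Sum>i\<in>I. s i)) A"
  using assms
proof (induction I rule: finite_induct)
  case empty
  then show ?case by (simp add: has_sum_0)
next
  case (insert i I)
  have "((\<lambda>x. f i x + (\<Sum>i\<in>I. f i x)) has_sum s i + (\<Sum>i\<in>I. s i)) A"
    by (rule has_sum_add) (use insert in auto)
  then show ?case using insert by simp
qed

text \<open>
  Each term is positive definite: the form is \<open>weight l\<close> times
  \<open>|\<Sum>\<^sub>j c\<^sub>j e\<^bsup>-\<i> l x\<^sub>j\<^esup>|\<^sup>2\<close>.
\<close>

lemma F_series_positive_definite:
  assumes \<theta>: "0 \<le> \<theta>" "\<theta> < 2 * pi"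
  shows "positive_definite (\<lambda>x. \<Sum>\<^sub>\<infinity>l\<in>char_zeros \<theta>. F_term x l)"
  unfolding positive_definite_def
proof (intro allI)
  fix n and c :: "nat \<Rightarrow> complex" and x :: "nat \<Rightarrow> real"
  define G where "G = (\<lambda>x. \<Sum>\<^sub>\<infinity>l\<in>char_zeros \<theta>. F_term x l)"
  define s where "s = (\<Sum>i<n. \<Sum>j<n. cnj (c i) * c j * G (x i - x j))"
  define e where "e = (\<lambda>l. \<Sum>j<n. c j * exp (- \<i> * of_real l * of_real (x j)))"
  have "((\<lambda>l. \<Sum>i<n. \<Sum>j<n. cnj (c i) * c j * F_term (x i - x j) l) has_sum s) (char_zeros \<theta>)"
    unfolding s_def G_def
    by (intro has_sum_finite_sum has_sum_cmult_right has_sum_infsum F_term_summable[OF \<theta>] finite_lessThan)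
  moreover have "(\<Sum>i<n. \<Sum>j<n. cnj (c i) * c j * F_term (x i - x j) l) = of_real (weight l * (cmod (e l))\<^sup>2)" for l
  proof -
    have "(\<Sum>i<n. \<Sum>j<n. cnj (c i) * c j * F_term (x i - x j) l) =
        of_real (weight l) * (\<Sum>i<n. \<Sum>j<n. cnj (c i * exp (- \<i> * of_real l * of_real (x i))) * (c j * exp (- \<i> * of_real l * of_real (x j))))"
      unfolding sum_distrib_left
    proof (intro sum.cong refl)
      fix i j
      have "exp (\<i> * of_real l * of_real (x i - x j)) = exp (\<i> * of_real l * of_real (x i)) * exp (- \<i> * of_real l * of_real (x j))"
        by (simp add: exp_add[symmetric] algebra_simps)
      then show "cnj (c i) * c j * F_term (x i - x j) l =
          of_real (weight l) * (cnj (c i * exp (- \<i> * of_real l * of_real (x i))) * (c j * exp (- \<i> * of_real l * of_real (x j))))"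
        by (simp add: F_term_def weight_def exp_cnj)
    qed
    also have "(\<Sum>i<n. \<Sum>j<n. cnj (c i * exp (- \<i> * of_real l * of_real (x i))) * (c j * exp (- \<i> * of_real l * of_real (x j)))) =
        of_real ((cmod (e l))\<^sup>2)"
      unfolding cmod_sq_eq e_def cnj_sum sum_product ..
    finally show ?thesis by simp
  qed
  ultimately have h: "((\<lambda>l. complex_of_real (weight l * (cmod (e l))\<^sup>2)) has_sum s) (char_zeros \<theta>)"
    by (simp only:)
  have "((\<lambda>l. weight l * (cmod (e l))\<^sup>2) has_sum Re s) (char_zeros \<theta>)"
    using has_sum_Re[OF h] by simp
  then have "0 \<le> Re s" by (rule has_sum_nonneg) (simp add: weight_nonneg)
  moreover have "((\<lambda>l. 0) has_sum Im s) (char_zeros \<theta>)" using has_sum_Im[OF h] by simp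
  then have "Im s = 0" using has_sum_unique[OF _ has_sum_0] by blast
  ultimately show "(\<Sum>i<n. \<Sum>j<n. cnj (c i) * c j * (\<Sum>\<^sub>\<infinity>l\<in>char_zeros \<theta>. F_term (x i - x j) l)) \<in> \<real>\<^sub>\<ge>\<^sub>0"
    unfolding s_def G_def complex_nonneg_Reals_iff by blast
qed

text \<open>
  For \<open>x \<le> 0\<close> the sum is the limit of the partial sums over \<open>spec_upto\<close>; the case \<open>x > 0\<close> follows
  since the series at \<open>-x\<close> is the conjugate of the series at \<open>x\<close>.
\<close>

lemma F_series_eq:
  assumes \<theta>: "0 \<le> \<theta>" "\<theta> < 2 * pi" and x: "\<bar>x\<bar> \<le> 1"
  shows "(\<Sum>\<^sub>\<infinity>l\<in>char_zeros \<theta>. F_term x l) = of_real (exp (- \<bar>x\<bar>))"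
proof -
  have nonpos: "(\<Sum>\<^sub>\<infinity>l\<in>char_zeros \<theta>. F_term y l) = of_real (exp y)" if y: "-1 \<le> y" "y \<le> 0" for y
  proof -
    have "(sum (F_term y) \<longlongrightarrow> (\<Sum>\<^sub>\<infinity>l\<in>char_zeros \<theta>. F_term y l)) (finite_subsets_at_top (char_zeros \<theta>))"
      using has_sum_infsum[OF F_term_summable[OF \<theta>]] unfolding has_sum_def .
    from filterlim_compose[OF this filterlim_spec_upto]
    show ?thesis by (rule LIMSEQ_unique[OF _ partial_sum_limit[OF \<theta> y]])
  qed
  show ?thesis
  proof (cases "x \<le> 0")
    case True
    then show ?thesis using nonpos[of x] x by simp
  next
    case False
    have "F_term x l = cnj (F_term (- x) l)" for l by (simp add: F_term_def exp_cnj)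
    then have "(\<Sum>\<^sub>\<infinity>l\<in>char_zeros \<theta>. F_term x l) = cnj (\<Sum>\<^sub>\<infinity>l\<in>char_zeros \<theta>. F_term (- x) l)"
      by (simp add: infsum_cnj)
    then show ?thesis using nonpos[of "- x"] x False by simp
  qed
qed

theorem corollary5p32:
  fixes F :: "real \<Rightarrow> complex" and \<theta> :: real
  assumes F: "\<And>x. \<bar>x\<bar> < 1 \<Longrightarrow> F x = complex_of_real (exp (- \<bar>x\<bar>))"
    and \<theta>: "0 \<le> \<theta>" "\<theta> < 2 * pi"
  shows "op_spectrum F (A_graph F \<theta>) \<subseteq> \<real> \<and>
    discrete (Lambda_spec F \<theta>) \<and>
    (\<forall>x. F_term x summable_on Lambda_spec F \<theta>) \<and>
    continuous_on UNIV (F_ext F \<theta>) \<and>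
    positive_definite (F_ext F \<theta>) \<and>
    (\<forall>x. \<bar>x\<bar> < 1 \<longrightarrow> F_ext F \<theta> x = F x)"
proof -
  interpret exp_kernel F by unfold_locales (rule F)
  have spec: "Lambda_spec F \<theta> = char_zeros \<theta>"
    by (simp add: Lambda_spec_def char_zeros_def op_spectrum_A_graph)
  have ext: "F_ext F \<theta> = (\<lambda>x. \<Sum>\<^sub>\<infinity>l\<in>char_zeros \<theta>. F_term x l)"
    by (simp add: F_ext_def spec fun_eq_iff)
  show ?thesis
  proof (intro conjI allI impI)
    show "op_spectrum F (A_graph F \<theta>) \<subseteq> \<real>"
      using char_fun_zero_real by (auto simp: op_spectrum_A_graph complex_is_Real_iff)
    show "discrete (Lambda_spec F \<theta>)"
      unfolding spec by (rule discrete_char_zeros)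
    show "F_term x summable_on Lambda_spec F \<theta>" for x
      unfolding spec by (rule F_term_summable[OF \<theta>])
    show "continuous_on UNIV (F_ext F \<theta>)"
      unfolding ext by (rule F_series_continuous[OF \<theta>])
    show "positive_definite (F_ext F \<theta>)"
      unfolding ext by (rule F_series_positive_definite[OF \<theta>])
    show "F_ext F \<theta> x = F x" if "\<bar>x\<bar> < 1" for x
      using F_series_eq[OF \<theta>, of x] that by (simp add: ext F)
  qed
qed

end
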